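(* Let $a=b=1/2$. The strongly parabolic directions for $X_{1/2,1/2}$ are exactly the rational directions $u/v$ such that $u$ and $v$ are both odd integers, and they are the only completely periodic directions for $X_{1/2,1/2}$.
   Context: For $(a,b)\in(0,1)^2$, let $T_{a,b}$ be the plane minus the interiors of the axis-parallel rectangles ("obstacles") of horizontal side $a$ and vertical side $b$ centered at the points of $\mathbb{Z}^2$. Label each obstacle by its center $(m,n)\in\mathbb{Z}^2$, and its sides by $\ell$ (left), $r$ (right), $b$ (bottom), $t$ (top). The translation surface $X_{a,b}$ is obtained from four copies $I,II,III,IV$ of $T_{a,b}$ by gluing by translations, for all $(m,n)\in\mathbb{Z}^2$: $(\ell,(m,n),I)$ with $(r,(-m,n),II)$; $(r,(m,n),I)$ with $(\ell,(-m,n),II)$; $(b,(m,n),I)$ with $(t,(m,-n),III)$; $(t,(m,n),I)$ with $(b,(m,-n),III)$; $(\ell,(m,n),III)$ with $(r,(-m,n),IV)$; $(r,(m,n),III)$ with $(\ell,(-m,n),IV)$; $(b,(m,n),II)$ with $(t,(m,-n),IV)$; $(t,(m,n),II)$ with $(b,(m,-n),IV)$. The corners of the obstacles give the conical singularities. "Direction" means slope. A trajectory (of the unit-speed straight-line flow in a given direction) is regular if it never hits a singularity. A cylinder is a maximal connected union of homotopic simple closed geodesics. A direction $\theta$ is completely periodic for $X_{a,b}$ if every regular trajectory in direction $\theta$ is closed; it is strongly parabolic if in addition $X_{a,b}$ decomposes into an infinite number of (closed) cylinders in direction $\theta$ which are isometric to each other. *)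

theory Defs
  imports "HOL-Analysis.Analysis"
begin

section \<open>The surface\<close>

type_synonym pt = "real \<times> real"

datatype copy = Copy_I | Copy_II | Copy_III | Copy_IV

datatype side = Left | Right | Bottom | Top

definition obstacle_interior :: "real \<Rightarrow> real \<Rightarrow> int \<times> int \<Rightarrow> pt set" where
  "obstacle_interior a b = (\<lambda>(m, n).
     {of_int m - a/2 <..< of_int m + a/2} \<times> {of_int n - b/2 <..< of_int n + b/2})"

definition table :: "real \<Rightarrow> real \<Rightarrow> pt set" where
  "table a b = UNIV - (\<Union>z. obstacle_interior a b z)"

fun side_mid :: "real \<Rightarrow> real \<Rightarrow> side \<Rightarrow> int \<times> int \<Rightarrow> pt" where
  "side_mid a b Left (m, n) = (of_int m - a/2, of_int n)"
| "side_mid a b Right (m, n) = (of_int m + a/2, of_int n)"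
| "side_mid a b Bottom (m, n) = (of_int m, of_int n - b/2)"
| "side_mid a b Top (m, n) = (of_int m, of_int n + b/2)"

fun half_side :: "real \<Rightarrow> real \<Rightarrow> side \<Rightarrow> pt" where
  "half_side a b Left = (0, b/2)"
| "half_side a b Right = (0, b/2)"
| "half_side a b Bottom = (a/2, 0)"
| "half_side a b Top = (a/2, 0)"

definition side_seg :: "real \<Rightarrow> real \<Rightarrow> side \<Rightarrow> int \<times> int \<Rightarrow> pt set" where
  "side_seg a b s z =
     closed_segment (side_mid a b s z - half_side a b s) (side_mid a b s z + half_side a b s)"

inductive glued_sides ::
  "side \<Rightarrow> int \<times> int \<Rightarrow> copy \<Rightarrow> side \<Rightarrow> int \<times> int \<Rightarrow> copy \<Rightarrow> bool" where
  "glued_sides Left (m, n) Copy_I Right (-m, n) Copy_II"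
| "glued_sides Right (m, n) Copy_I Left (-m, n) Copy_II"
| "glued_sides Bottom (m, n) Copy_I Top (m, -n) Copy_III"
| "glued_sides Top (m, n) Copy_I Bottom (m, -n) Copy_III"
| "glued_sides Left (m, n) Copy_III Right (-m, n) Copy_IV"
| "glued_sides Right (m, n) Copy_III Left (-m, n) Copy_IV"
| "glued_sides Bottom (m, n) Copy_II Top (m, -n) Copy_IV"
| "glued_sides Top (m, n) Copy_II Bottom (m, -n) Copy_IV"

text \<open>Two sides are glued by the translation that takes one midpoint to the other.\<close>

definition glued_points :: "real \<Rightarrow> real \<Rightarrow> copy \<times> pt \<Rightarrow> copy \<times> pt \<Rightarrow> bool" where
  "glued_points a b = (\<lambda>(c, p) (c', p'). \<exists>s z s' z'. glued_sides s z c s' z' c' \<and>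
     p \<in> side_seg a b s z \<and> p' = p + (side_mid a b s' z' - side_mid a b s z))"

text \<open>Points of the surface are equivalence classes; the four copies of a corner class
  become one conical point.\<close>

type_synonym spt = "(copy \<times> pt) set"

definition proj :: "real \<Rightarrow> real \<Rightarrow> copy \<times> pt \<Rightarrow> spt" where
  "proj a b x = {y. equivclp (glued_points a b) x y}"

definition surface :: "real \<Rightarrow> real \<Rightarrow> spt set" where
  "surface a b = proj a b ` (UNIV \<times> table a b)"

definition corners :: "real \<Rightarrow> real \<Rightarrow> pt set" where
  "corners a b = {(of_int m + e * a/2, of_int n + f * b/2) | (m :: int) (n :: int) e f.
     e \<in> {-1, 1} \<and> f \<in> {-1, 1}}"

definition singularities :: "real \<Rightarrow> real \<Rightarrow> spt set" where
  "singularities a b = proj a b ` (UNIV \<times> corners a b)"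

definition four_tables :: "real \<Rightarrow> real \<Rightarrow> (copy \<times> pt) topology" where
  "four_tables a b = sum_topology (\<lambda>c. top_of_set (table a b)) UNIV"

definition surface_topology :: "real \<Rightarrow> real \<Rightarrow> spt topology" where
  "surface_topology a b = topology (\<lambda>U. U \<subseteq> surface a b \<and>
     openin (four_tables a b) {x \<in> topspace (four_tables a b). proj a b x \<in> U})"

lemma topspace_four_tables: "topspace (four_tables a b) = UNIV \<times> table a b"
  by (auto simp: four_tables_def)

lemma openin_surface_topology:
  "openin (surface_topology a b) U \<longleftrightarrow> U \<subseteq> surface a b \<and>
     openin (four_tables a b) {x \<in> topspace (four_tables a b). proj a b x \<in> U}"
proof -
  let ?X = "four_tables a b"
  let ?P = "\<lambda>U. U \<subseteq> surface a b \<and> openin ?X {x \<in> topspace ?X. proj a b x \<in> U}"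
  have "istopology ?P"
    unfolding istopology_def
  proof (intro conjI allI impI)
    fix S T assume "?P S" "?P T"
    moreover have "{x \<in> topspace ?X. proj a b x \<in> S \<inter> T} =
        {x \<in> topspace ?X. proj a b x \<in> S} \<inter> {x \<in> topspace ?X. proj a b x \<in> T}"
      by blast
    ultimately show "S \<inter> T \<subseteq> surface a b"
      and "openin ?X {x \<in> topspace ?X. proj a b x \<in> S \<inter> T}"
      by auto
  next
    fix \<K> assume K: "\<forall>K\<in>\<K>. ?P K"
    have "{x \<in> topspace ?X. proj a b x \<in> \<Union>\<K>} =
        (\<Union>K\<in>\<K>. {x \<in> topspace ?X. proj a b x \<in> K})"
      by blast
    with K show "\<Union>\<K> \<subseteq> surface a b"
      and "openin ?X {x \<in> topspace ?X. proj a b x \<in> \<Union>\<K>}"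
      by auto
  qed
  then show ?thesis
    by (simp add: surface_topology_def topology_inverse')
qed

lemma topspace_surface_topology: "topspace (surface_topology a b) = surface a b"
proof -
  have "{x \<in> topspace (four_tables a b). proj a b x \<in> surface a b} = topspace (four_tables a b)"
    by (auto simp: topspace_four_tables surface_def)
  then have "openin (surface_topology a b) (surface a b)"
    by (simp add: openin_surface_topology)
  then show ?thesis
    by (metis openin_subset openin_surface_topology openin_topspace subset_antisym)
qed

lemma quotient_map_proj: "quotient_map (four_tables a b) (surface_topology a b) (proj a b)"
  by (auto simp: quotient_map_def topspace_surface_topology openin_surface_topology
      topspace_four_tables surface_def)


section \<open>Trajectories\<close>

text \<open>A direction is a slope, the vertical one included.\<close>

datatype direction = Slope real | Vertical

fun unit_vec :: "direction \<Rightarrow> pt" where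
  "unit_vec (Slope s) = (1 / sqrt (1 + s\<^sup>2), s / sqrt (1 + s\<^sup>2))"
| "unit_vec Vertical = (0, 1)"

text \<open>A bi-infinite unit-speed straight line: just after and just before each time it is a segment
  in one of the copies. A point interior to a side has two representatives; a line transverse to
  the side arrives at one of them and leaves from the other.\<close>

definition straight_line :: "real \<Rightarrow> real \<Rightarrow> direction \<Rightarrow> (real \<Rightarrow> spt) \<Rightarrow> bool" where
  "straight_line a b \<theta> \<gamma> \<longleftrightarrow> (\<forall>t. \<gamma> t \<in> surface a b \<and> (\<exists>\<epsilon>>0.
     (\<exists>(c, p) \<in> \<gamma> t. \<forall>s\<in>{0..\<epsilon>}. p + s *\<^sub>R unit_vec \<theta> \<in> table a b \<and>
        \<gamma> (t + s) = proj a b (c, p + s *\<^sub>R unit_vec \<theta>)) \<and>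
     (\<exists>(c, p) \<in> \<gamma> t. \<forall>s\<in>{0..\<epsilon>}. p - s *\<^sub>R unit_vec \<theta> \<in> table a b \<and>
        \<gamma> (t - s) = proj a b (c, p - s *\<^sub>R unit_vec \<theta>))))"

definition regular_trajectory :: "real \<Rightarrow> real \<Rightarrow> direction \<Rightarrow> (real \<Rightarrow> spt) \<Rightarrow> bool" where
  "regular_trajectory a b \<theta> \<gamma> \<longleftrightarrow>
     straight_line a b \<theta> \<gamma> \<and> range \<gamma> \<inter> singularities a b = {}"

definition completely_periodic :: "real \<Rightarrow> real \<Rightarrow> direction \<Rightarrow> bool" where
  "completely_periodic a b \<theta> \<longleftrightarrow>
     (\<forall>\<gamma>. regular_trajectory a b \<theta> \<gamma> \<longrightarrow> (\<exists>L>0. \<forall>t. \<gamma> (t + L) = \<gamma> t))"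


section \<open>Cylinders\<close>

text \<open>Simple closed geodesics in direction \<open>\<theta>\<close>, rescaled to loops on \<open>[0, 1]\<close>.\<close>

definition geodesic_loops :: "real \<Rightarrow> real \<Rightarrow> direction \<Rightarrow> (real \<Rightarrow> spt) set" where
  "geodesic_loops a b \<theta> = {(\<lambda>t. \<gamma> (L * t)) | \<gamma> L. L > 0 \<and> regular_trajectory a b \<theta> \<gamma> \<and>
     (\<forall>t. \<gamma> (t + L) = \<gamma> t) \<and> inj_on \<gamma> {0..<L}}"

text \<open>Free homotopy of loops, cf. \<open>homotopic_loops\<close>, which is only available for subsets of a
  type with a topology.\<close>

definition freely_homotopic :: "real \<Rightarrow> real \<Rightarrow> (real \<Rightarrow> spt) \<Rightarrow> (real \<Rightarrow> spt) \<Rightarrow> bool" where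
  "freely_homotopic a b = homotopic_with (\<lambda>f. f 1 = f 0) (top_of_set {0..1}) (surface_topology a b)"

definition connected_geodesic_union :: "real \<Rightarrow> real \<Rightarrow> direction \<Rightarrow> spt set \<Rightarrow> bool" where
  "connected_geodesic_union a b \<theta> C \<longleftrightarrow> (\<exists>G \<subseteq> geodesic_loops a b \<theta>. G \<noteq> {} \<and>
     (\<forall>g\<in>G. \<forall>h\<in>G. freely_homotopic a b g h) \<and>
     C = (\<Union>g\<in>G. g ` {0..1}) \<and> connectedin (surface_topology a b) C)"

definition cylinder :: "real \<Rightarrow> real \<Rightarrow> direction \<Rightarrow> spt set \<Rightarrow> bool" where
  "cylinder a b \<theta> C \<longleftrightarrow> connected_geodesic_union a b \<theta> C \<and>
     (\<forall>C'. connected_geodesic_union a b \<theta> C' \<and> C \<subseteq> C' \<longrightarrow> C' = C)"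

text \<open>Polygonal paths inside \<open>S\<close> with their lengths; each leg lies in one copy.\<close>

inductive polygonal_path :: "real \<Rightarrow> real \<Rightarrow> spt set \<Rightarrow> spt \<Rightarrow> spt \<Rightarrow> real \<Rightarrow> bool"
  for a b S x where
  refl: "x \<in> S \<Longrightarrow> polygonal_path a b S x x 0"
| leg: "polygonal_path a b S x y l \<Longrightarrow> (c, p) \<in> y \<Longrightarrow> closed_segment p q \<subseteq> table a b \<Longrightarrow>
    proj a b ` ({c} \<times> closed_segment p q) \<subseteq> S \<Longrightarrow>
    polygonal_path a b S x (proj a b (c, q)) (l + dist p q)"

definition intrinsic_dist :: "real \<Rightarrow> real \<Rightarrow> spt set \<Rightarrow> spt \<Rightarrow> spt \<Rightarrow> real" where
  "intrinsic_dist a b S x y = Inf {l. polygonal_path a b S x y l}"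

definition isometric :: "real \<Rightarrow> real \<Rightarrow> spt set \<Rightarrow> spt set \<Rightarrow> bool" where
  "isometric a b S S' \<longleftrightarrow> (\<exists>\<phi>. bij_betw \<phi> S S' \<and>
     (\<forall>x\<in>S. \<forall>y\<in>S. intrinsic_dist a b S' (\<phi> x) (\<phi> y) = intrinsic_dist a b S x y))"

text \<open>A cylinder as defined above is open, intrinsically \<open>\<real>/c\<int> \<times> (0, h)\<close>. The closed cylinders are
  the closures, which cover the surface and overlap only along their boundaries. The isometry
  condition is put on the open cylinders: the abstract closed cylinder \<open>\<real>/c\<int> \<times> [0, h]\<close> is the
  completion of the open one for the intrinsic metric, whereas the closure in the surface may
  in addition have boundary points identified.\<close>

definition strongly_parabolic :: "real \<Rightarrow> real \<Rightarrow> direction \<Rightarrow> bool" where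
  "strongly_parabolic a b \<theta> \<longleftrightarrow> completely_periodic a b \<theta> \<and>
     (\<exists>\<C>. infinite \<C> \<and> (\<forall>C\<in>\<C>. cylinder a b \<theta> C) \<and> disjoint \<C> \<and>
        (\<Union>C\<in>\<C>. surface_topology a b closure_of C) = surface a b \<and>
        (\<forall>C\<in>\<C>. \<forall>C'\<in>\<C>. isometric a b C C'))"

end

theory Submission
  imports Defs
begin

text \<open>Cut into squares of side \<open>1/2\<close>, the surface covers the torus \<open>\<real>\<^sup>2 / (1/2)\<int>\<^sup>2\<close>, branched over one point, and a
  trajectory is the development of a plane line. The free squares fall into three types according to
  the parities of their coordinates. Identifying the types with \<open>\<int>/3\<close>, crossing a vertical edge acts
  by \<open>t \<mapsto> 1 - t\<close> and crossing a horizontal edge by \<open>t \<mapsto> 2 - t\<close>. The reflections in the symmetry axes of the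
  obstacles generate a deck group that is simply transitive on the squares of each type.

  Let the slope be \<open>u/v\<close> in lowest terms. If \<open>u\<close> and \<open>v\<close> are odd, then one period of the torus line
  permutes the three types cyclically, and three periods act as a deck transformation that reverses
  both coordinates, hence as an involution. So all regular trajectories close after exactly six periods, and the
  deck group permutes the cylinders transitively. If \<open>u + v\<close> is odd, then one period moves some type
  and two periods act as a translation of the table. This translation is not the identity: the
  trajectory through the centre of a square is symmetric about that centre, so if it closed up after
  two periods, then after one period it would be in a square of the initial type.
  For irrational slopes already the trajectories on the torus are not closed.\<close>

text \<open>One period makes \<open>u + v\<close> edge crossings, and the parity of this number
  separates the cases: an even product of the maps \<open>1 - t\<close> and \<open>2 - t\<close> is
  a rotation of \<int>/3, an odd one a reflection. A reflection fixes exactly one type and squares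
  to the identity. For odd \<open>u\<close> and \<open>v\<close> the rotation might a priori be
  trivial; excluding this is the arithmetic core, and it rests on counting the crossings at cells
  \<open>(k, l)\<close> with \<open>k + l\<close> odd.

  The geometric obstacle is that a trajectory is a map into equivalence classes and names no square.
  A point on a side has two representatives, but in a direction neither horizontal nor vertical only
  one of them can depart without entering an obstacle. This makes trajectories unique and identifies
  each regular one with a developed line. For the negative results it is enough to exhibit one line
  that does not close: through the centre of a cell for finite slopes, midway between obstacles for
  the vertical one.\<close>

abbreviation (input) half_table :: "pt set" where "half_table \<equiv> table (1/2) (1/2)"
abbreviation (input) half_proj :: "copy \<times> pt \<Rightarrow> spt" where "half_proj \<equiv> proj (1/2) (1/2)"

section \<open>Points of the surface\<close>

text \<open>The copies form (\<int>/2)^2: gluing along vertical sides exchanges I with II and III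
  with IV, gluing along horizontal sides exchanges I with III and II with IV. Each kind of gluing
  changes one bit.\<close>

definition xbit :: "copy \<Rightarrow> bool" where "xbit c \<longleftrightarrow> c = Copy_II \<or> c = Copy_IV"
definition ybit :: "copy \<Rightarrow> bool" where "ybit c \<longleftrightarrow> c = Copy_III \<or> c = Copy_IV"

definition copy_of :: "bool \<Rightarrow> bool \<Rightarrow> copy" where
  "copy_of a b = (if a then if b then Copy_IV else Copy_II else if b then Copy_III else Copy_I)"

definition flip :: "bool \<Rightarrow> bool \<Rightarrow> copy \<Rightarrow> copy" where
  "flip a b c = copy_of (a \<noteq> xbit c) (b \<noteq> ybit c)"

lemma bits_copy_of [simp]: "xbit (copy_of a b) = a" "ybit (copy_of a b) = b"
  by (auto simp: xbit_def ybit_def copy_of_def)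

lemma copy_eq_iff: "c = c' \<longleftrightarrow> xbit c = xbit c' \<and> ybit c = ybit c'"
  by (cases c; cases c') (auto simp: xbit_def ybit_def)

lemma bits_flip [simp]: "xbit (flip a b c) = (a \<noteq> xbit c)" "ybit (flip a b c) = (b \<noteq> ybit c)"
  by (auto simp: flip_def)

lemma flip_flip: "flip a b (flip a' b' c) = flip (a \<noteq> a') (b \<noteq> b') c"
  by (auto simp: copy_eq_iff)

text \<open>A gluing is a translation, but on the side itself it coincides with a coordinate
  reflection: \<open>m - 1/4\<close> goes to \<open>- m + 1/4\<close>. This gives one formula for
  all obstacles.\<close>

definition reflect :: "bool \<Rightarrow> bool \<Rightarrow> pt \<Rightarrow> pt" where
  "reflect a b p = (if a then - fst p else fst p, if b then - snd p else snd p)"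

definition on_vertical_side :: "pt \<Rightarrow> bool" where
  "on_vertical_side p \<longleftrightarrow> (\<exists>m :: int. \<bar>fst p - m\<bar> = 1/4) \<and> (\<exists>n :: int. \<bar>snd p - n\<bar> \<le> 1/4)"

definition on_horizontal_side :: "pt \<Rightarrow> bool" where
  "on_horizontal_side p \<longleftrightarrow> (\<exists>n :: int. \<bar>snd p - n\<bar> = 1/4) \<and> (\<exists>m :: int. \<bar>fst p - m\<bar> \<le> 1/4)"

lemma ex_int_abs_uminus:
  "(\<exists>m :: int. P \<bar>- x - m\<bar>) \<longleftrightarrow> (\<exists>m :: int. P \<bar>x - m\<bar>)" for x :: real
proof -
  have "\<bar>- x - of_int m\<bar> = \<bar>x - of_int (- m)\<bar>" for m by simp
  then show ?thesis by (metis minus_minus)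
qed

lemma on_side_reflect [simp]:
  "on_vertical_side (reflect a b p) = on_vertical_side p"
  "on_horizontal_side (reflect a b p) = on_horizontal_side p"
  unfolding on_vertical_side_def on_horizontal_side_def reflect_def
  by (simp_all add: ex_int_abs_uminus[where P="\<lambda>t. t * 4 = 1"] ex_int_abs_uminus[where P="\<lambda>t. t * 4 \<le> 1"])

lemma side_seg_half:
  "p \<in> side_seg (1/2) (1/2) Left (m, n) \<longleftrightarrow> fst p = m - 1/4 \<and> \<bar>snd p - n\<bar> \<le> 1/4"
  "p \<in> side_seg (1/2) (1/2) Right (m, n) \<longleftrightarrow> fst p = m + 1/4 \<and> \<bar>snd p - n\<bar> \<le> 1/4"
  "p \<in> side_seg (1/2) (1/2) Bottom (m, n) \<longleftrightarrow> snd p = n - 1/4 \<and> \<bar>fst p - m\<bar> \<le> 1/4"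
  "p \<in> side_seg (1/2) (1/2) Top (m, n) \<longleftrightarrow> snd p = n + 1/4 \<and> \<bar>fst p - m\<bar> \<le> 1/4"
  by (auto simp: side_seg_def closed_segment_same_fst closed_segment_same_snd
      closed_segment_eq_real_ivl mem_Times_iff abs_if split: if_splits)

lemma glued_pointsD:
  assumes "glued_points (1/2) (1/2) (c, p) (c', p')"
  shows "on_vertical_side p \<and> (c', p') = (flip True False c, reflect True False p) \<or>
         on_horizontal_side p \<and> (c', p') = (flip False True c, reflect False True p)"
proof -
  obtain s z s' z' where g: "glued_sides s z c s' z' c'" and p: "p \<in> side_seg (1/2) (1/2) s z"
    and p': "p' = p + (side_mid (1/2) (1/2) s' z' - side_mid (1/2) (1/2) s z)"
    using assms by (auto simp: glued_points_def)
  have v: "on_vertical_side p" if "fst p = of_int m - 1/4 \<or> fst p = of_int m + 1/4" "\<bar>snd p - of_int n\<bar> \<le> 1/4" for m n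
    using that unfolding on_vertical_side_def by (intro conjI exI[of _ m] exI[of _ n]) auto
  have h: "on_horizontal_side p" if "snd p = of_int n - 1/4 \<or> snd p = of_int n + 1/4" "\<bar>fst p - of_int m\<bar> \<le> 1/4" for m n
    using that unfolding on_horizontal_side_def by (intro conjI exI[of _ m] exI[of _ n]) auto
  note simps = reflect_def flip_def copy_of_def xbit_def ybit_def
  show ?thesis
    using g
  proof cases
    case (1 m n)
    with p p' v[of m n] show ?thesis by (cases p; cases p') (simp add: side_seg_half simps)
  next
    case (2 m n)
    with p p' v[of m n] show ?thesis by (cases p; cases p') (simp add: side_seg_half simps)
  next
    case (3 m n)
    with p p' h[of n m] show ?thesis by (cases p; cases p') (simp add: side_seg_half simps)
  next
    case (4 m n)
    with p p' h[of n m] show ?thesis by (cases p; cases p') (simp add: side_seg_half simps)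
  next
    case (5 m n)
    with p p' v[of m n] show ?thesis by (cases p; cases p') (simp add: side_seg_half simps)
  next
    case (6 m n)
    with p p' v[of m n] show ?thesis by (cases p; cases p') (simp add: side_seg_half simps)
  next
    case (7 m n)
    with p p' h[of n m] show ?thesis by (cases p; cases p') (simp add: side_seg_half simps)
  next
    case (8 m n)
    with p p' h[of n m] show ?thesis by (cases p; cases p') (simp add: side_seg_half simps)
  qed
qed

lemma glued_vertical:
  assumes "on_vertical_side p"
  shows "equivclp (glued_points (1/2) (1/2)) (c, p) (flip True False c, reflect True False p)"
proof -
  have *: "glued_points (1/2) (1/2) (c, p) (flip True False c, reflect True False p)"
    if v: "on_vertical_side p" and c: "c = Copy_I \<or> c = Copy_III" for c p
  proof -
    obtain m n :: int where mn: "\<bar>fst p - m\<bar> = 1/4" "\<bar>snd p - n\<bar> \<le> 1/4"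
      using v by (auto simp: on_vertical_side_def)
    from mn(1) consider "fst p = m - 1/4" | "fst p = m + 1/4" by linarith
    then show ?thesis
    proof cases
      case 1
      have "glued_sides Left (m, n) c Right (-m, n) (flip True False c)"
        using c by (auto simp: flip_def copy_of_def xbit_def ybit_def intro: glued_sides.intros)
      then show ?thesis unfolding glued_points_def prod.case
        by (intro exI[of _ Left] exI[of _ "(m,n)"] exI[of _ Right] exI[of _ "(-m,n)"])
          (use 1 mn in \<open>cases p; auto simp: side_seg_half reflect_def\<close>)
    next
      case 2
      have "glued_sides Right (m, n) c Left (-m, n) (flip True False c)"
        using c by (auto simp: flip_def copy_of_def xbit_def ybit_def intro: glued_sides.intros)
      then show ?thesis unfolding glued_points_def prod.case
        by (intro exI[of _ Right] exI[of _ "(m,n)"] exI[of _ Left] exI[of _ "(-m,n)"])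
          (use 2 mn in \<open>cases p; auto simp: side_seg_half reflect_def\<close>)
    qed
  qed
  show ?thesis
  proof (cases "c = Copy_I \<or> c = Copy_III")
    case True
    then show ?thesis using *[OF assms] by (simp add: r_into_equivclp)
  next
    case False
    \<comment> \<open>Each glued pair of vertical sides is listed only from \<open>Copy_I\<close> or
      \<open>Copy_III\<close>; from the other two copies the relation is used backwards.\<close>
    then have "flip True False c = Copy_I \<or> flip True False c = Copy_III"
      by (cases c) (auto simp: flip_def copy_of_def xbit_def ybit_def)
    from *[OF _ this, of "reflect True False p"] assms
    have "glued_points (1/2) (1/2) (flip True False c, reflect True False p) (c, p)"
      by (simp add: flip_flip) (simp add: flip_def reflect_def copy_of_def xbit_def ybit_def split: copy.splits, cases c, auto)
    then show ?thesis by (simp add: converse_r_into_equivclp equivclp_sym r_into_equivclp)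
  qed
qed

lemma glued_horizontal:
  assumes "on_horizontal_side p"
  shows "equivclp (glued_points (1/2) (1/2)) (c, p) (flip False True c, reflect False True p)"
proof -
  have *: "glued_points (1/2) (1/2) (c, p) (flip False True c, reflect False True p)"
    if v: "on_horizontal_side p" and c: "c = Copy_I \<or> c = Copy_II" for c p
  proof -
    obtain m n :: int where mn: "\<bar>snd p - n\<bar> = 1/4" "\<bar>fst p - m\<bar> \<le> 1/4"
      using v by (auto simp: on_horizontal_side_def)
    from mn(1) consider "snd p = n - 1/4" | "snd p = n + 1/4" by linarith
    then show ?thesis
    proof cases
      case 1
      have "glued_sides Bottom (m, n) c Top (m, -n) (flip False True c)"
        using c by (auto simp: flip_def copy_of_def xbit_def ybit_def intro: glued_sides.intros)
      then show ?thesis unfolding glued_points_def prod.case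
        by (intro exI[of _ Bottom] exI[of _ "(m,n)"] exI[of _ Top] exI[of _ "(m,-n)"])
          (use 1 mn in \<open>cases p; auto simp: side_seg_half reflect_def\<close>)
    next
      case 2
      have "glued_sides Top (m, n) c Bottom (m, -n) (flip False True c)"
        using c by (auto simp: flip_def copy_of_def xbit_def ybit_def intro: glued_sides.intros)
      then show ?thesis unfolding glued_points_def prod.case
        by (intro exI[of _ Top] exI[of _ "(m,n)"] exI[of _ Bottom] exI[of _ "(m,-n)"])
          (use 2 mn in \<open>cases p; auto simp: side_seg_half reflect_def\<close>)
    qed
  qed
  show ?thesis
  proof (cases "c = Copy_I \<or> c = Copy_II")
    case True
    then show ?thesis using *[OF assms] by (simp add: r_into_equivclp)
  next
    case False
    then have "flip False True c = Copy_I \<or> flip False True c = Copy_II"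
      by (cases c) (auto simp: flip_def copy_of_def xbit_def ybit_def)
    from *[OF _ this, of "reflect False True p"] assms
    have "glued_points (1/2) (1/2) (flip False True c, reflect False True p) (c, p)"
      by (simp add: flip_flip) (simp add: flip_def reflect_def copy_of_def xbit_def ybit_def split: copy.splits, cases c, auto)
    then show ?thesis by (simp add: equivclp_sym r_into_equivclp)
  qed
qed

text \<open>The gluing class in closed form. The two reflections commute and keep a point on the
  sides it lies on, so a class has one point off the sides, two inside a side, and four at a corner,
  which lies on both kinds of side.\<close>

definition point_class :: "copy \<times> pt \<Rightarrow> spt" where
  "point_class x = {(flip a b (fst x), reflect a b (snd x)) | a b.
     (a \<longrightarrow> on_vertical_side (snd x)) \<and> (b \<longrightarrow> on_horizontal_side (snd x))}"

lemma reflect_reflect: "reflect a b (reflect a' b' p) = reflect (a \<noteq> a') (b \<noteq> b') p"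
  by (auto simp: reflect_def)

lemma flip_False [simp]: "flip False False c = c" and reflect_False [simp]: "reflect False False p = p"
  by (auto simp: copy_eq_iff reflect_def)

lemma self_in_point_class: "x \<in> point_class x"
  unfolding point_class_def by (cases x) (auto intro!: exI[of _ False])

lemma point_class_eqI:
  assumes "y \<in> point_class x" shows "point_class y = point_class x"
proof -
  have sub: "point_class y \<subseteq> point_class x" if yx: "y \<in> point_class x" for x y
  proof
    fix w assume "w \<in> point_class y"
    then obtain a b where w: "w = (flip a b (fst y), reflect a b (snd y))"
      "a \<longrightarrow> on_vertical_side (snd y)" "b \<longrightarrow> on_horizontal_side (snd y)"
      unfolding point_class_def by blast
    obtain a' b' where y: "y = (flip a' b' (fst x), reflect a' b' (snd x))"
      "a' \<longrightarrow> on_vertical_side (snd x)" "b' \<longrightarrow> on_horizontal_side (snd x)"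
      using yx unfolding point_class_def by blast
    show "w \<in> point_class x"
      unfolding point_class_def mem_Collect_eq
      by (rule exI[of _ "a \<noteq> a'"], rule exI[of _ "b \<noteq> b'"]) (use w y in \<open>auto simp: flip_flip reflect_reflect\<close>)
  qed
  obtain a b where ab: "y = (flip a b (fst x), reflect a b (snd x))"
     "a \<longrightarrow> on_vertical_side (snd x)" "b \<longrightarrow> on_horizontal_side (snd x)"
    using assms unfolding point_class_def by blast
  then have "x \<in> point_class y"
    unfolding point_class_def mem_Collect_eq
    by (intro exI[of _ a] exI[of _ b]) (auto simp: flip_flip reflect_reflect)
  with sub assms show ?thesis by blast
qed

lemma half_proj_eq: "half_proj x = point_class x"
proof -
  have 1: "point_class x = point_class y" if "glued_points (1/2) (1/2) x y" for x y
  proof -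
    obtain c p c' p' where [simp]: "x = (c, p)" "y = (c', p')" by (cases x; cases y)
    from glued_pointsD[OF that[simplified]] have "y \<in> point_class x"
      by (auto simp: point_class_def)
    then show ?thesis by (simp add: point_class_eqI)
  qed
  have 2: "y \<in> point_class x" if "equivclp (glued_points (1/2) (1/2)) x y" for y
  proof -
    from that have "point_class x = point_class y"
      by (induction rule: equivclp_induct) (use 1 in \<open>auto\<close>)
    then show ?thesis using self_in_point_class by blast
  qed
  have 3: "equivclp (glued_points (1/2) (1/2)) x y" if y: "y \<in> point_class x" for y
  proof -
    obtain c p where x: "x = (c, p)" by (cases x)
    obtain a b where ab: "y = (flip a b c, reflect a b p)" "a \<longrightarrow> on_vertical_side p" "b \<longrightarrow> on_horizontal_side p"
      using y x unfolding point_class_def by auto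
    have s1: "equivclp (glued_points (1/2) (1/2)) (c, p) (flip a False c, reflect a False p)"
      using ab(2) glued_vertical[of p c] by (cases a) auto
    have "equivclp (glued_points (1/2) (1/2)) (flip a False c, reflect a False p)
        (flip False b (flip a False c), reflect False b (reflect a False p))"
      using ab(3) glued_horizontal[of "reflect a False p"] by (cases b) auto
    with s1 show ?thesis unfolding x ab(1) flip_flip reflect_reflect
      by (auto intro: equivclp_trans)
  qed
  show ?thesis unfolding proj_def using 2 3 by blast
qed

section \<open>Squares and their deck transformations\<close>

text \<open>\<open>(c, i, j)\<close> stands for the square of side \<open>1/2\<close> centred at \<open>(i/2, j/2)\<close> in copy \<open>c\<close>; the obstacles
  are the squares with \<open>i\<close> and \<open>j\<close> both even. The functions \<open>right\<close> and \<open>up\<close> give the neighbouring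
  square after gluing; their values on obstacles only serve to make them bijective.\<close>

type_synonym square = "copy \<times> int \<times> int"

definition free_square :: "square \<Rightarrow> bool" where
  "free_square s \<longleftrightarrow> odd (fst (snd s)) \<or> odd (snd (snd s))"

fun right :: "square \<Rightarrow> square" where
  "right (c, i, j) = (if odd j then (c, i + 1, j) else (flip True False c, - i, j))"

fun up :: "square \<Rightarrow> square" where
  "up (c, i, j) = (if odd i then (c, i, j + 1) else (flip False True c, i, - j))"

text \<open>The iterate of \<open>up\<close> for every integer \<open>l\<close>. On a column with
  even \<open>i\<close> the map \<open>up\<close> is an involution, hence only the parity of
  \<open>l\<close> enters there.\<close>

definition up_iter :: "int \<Rightarrow> square \<Rightarrow> square" where
  "up_iter l = (\<lambda>(c, i, j). if odd i then (c, i, j + l)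
     else if odd l then (flip False True c, i, - j) else (c, i, j))"

lemma inj_right: "right s = right s' \<longleftrightarrow> s = s'"
proof
  assume "right s = right s'"
  then show "s = s'"
    by (cases s; cases s') (auto split: if_splits simp: copy_eq_iff)
qed simp

lemma inj_up: "up s = up s' \<longleftrightarrow> s = s'"
proof
  assume "up s = up s'"
  then show "s = s'"
    by (cases s; cases s') (auto split: if_splits simp: copy_eq_iff)
qed simp

lemma surj_right: "\<exists>s. right s = s'"
proof (cases s')
  case (fields c i j)
  then show ?thesis
    by (intro exI[of _ "if odd j then (c, i - 1, j) else (flip True False c, - i, j)"])
      (auto simp: flip_flip)
qed

lemma up_iter_simps:
  "up_iter 0 s = s" "up_iter (l + 1) s = up (up_iter l s)"
  "up_iter (- l) (up_iter l s) = s" "up_iter l (up_iter (- l) s) = s"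
  by (cases s; auto simp: up_iter_def flip_flip)+

lemma free_right [simp]: "free_square (right s) = free_square s"
  and free_up [simp]: "free_square (up s) = free_square s"
  by (cases s; auto simp: free_square_def)+

section \<open>Developing the plane along a sequence of crossings\<close>

lemma int_step_const:
  fixes f :: "int \<Rightarrow> 'a"
  assumes "\<And>k. f (k + 1) = f k"
  shows "f k = f k'"
proof -
  have "f k = f 0" for k
  proof (induction k rule: int_induct[where k = 0])
    case (step2 i) with assms[of "i - 1"] show ?case by simp
  qed (use assms in auto)
  then show ?thesis by metis
qed

text \<open>Steps to the left choose preimages, which surjectivity provides, so the recursion runs
  both ways from \<open>k0\<close>.\<close>

lemma int_recursion:
  fixes f :: "int \<Rightarrow> 'a \<Rightarrow> 'a"
  assumes "\<And>k. surj (f k)"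
  shows "\<exists>S. S k0 = s0 \<and> (\<forall>k. S (k + 1) = f k (S k))"
proof -
  define F where "F = rec_nat s0 (\<lambda>n. f (k0 + int n))"
  define G where "G = rec_nat s0 (\<lambda>n. inv (f (k0 - int n - 1)))"
  define S where "S k = (if k \<ge> k0 then F (nat (k - k0)) else G (nat (k0 - k)))" for k
  have "S (k + 1) = f k (S k)" for k
  proof (cases "k \<ge> k0")
    case True
    define n where "n = nat (k - k0)"
    have n: "nat (k + 1 - k0) = Suc n" "nat (k - k0) = n" "k = k0 + int n" using True by (auto simp: n_def)
    have "S (k + 1) = F (Suc n)" "S k = F n" using True n by (simp_all add: S_def)
    then show ?thesis by (simp add: F_def n(3))
  next
    case False
    define n where "n = nat (k0 - k - 1)"
    have n: "nat (k0 - k) = Suc n" "k = k0 - int n - 1" using False by (auto simp: n_def)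
    have "S (k + 1) = G n"
    proof (cases "n = 0")
      case True
      then show ?thesis using n by (simp add: S_def F_def G_def)
    next
      case False
      then have "\<not> k0 \<le> k + 1" "nat (k0 - (k + 1)) = n" using n by auto
      then show ?thesis by (simp only: S_def if_False)
    qed
    moreover have "f k (S k) = G n"
      using False n(1) surj_f_inv_f[OF assms[of k], of "G n"]
      by (simp add: S_def G_def n(2)[symmetric])
    ultimately show ?thesis by simp
  qed
  moreover have "S k0 = s0" by (simp add: S_def F_def)
  ultimately show ?thesis by blast
qed

text \<open>\<open>E k l\<close> is the square of the surface over the cell \<open>(k, l)\<close> of the plane, when the plane is developed
  along a line (or strip) that passes from column \<open>k\<close> to column \<open>k + 1\<close> in row \<open>a k\<close>. Vertical moves
  are unrestricted, so each column is determined by any one of its squares.\<close>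

definition coherent :: "(int \<Rightarrow> int) \<Rightarrow> (int \<Rightarrow> int \<Rightarrow> square) \<Rightarrow> bool" where
  "coherent a E \<longleftrightarrow> (\<forall>k l. E k (l + 1) = up (E k l)) \<and> (\<forall>k. E (k + 1) (a k) = right (E k (a k)))"

text \<open>The recursion carries the square of row 0 from column to column: climb to row
  \<open>a k\<close>, cross to the right, climb back down.\<close>

lemma coherent_exists: "\<exists>E. coherent a E \<and> E k0 l0 = s0"
proof -
  have "surj (\<lambda>s. up_iter (- a k) (right (up_iter (a k) s)))" for k
    unfolding surj_def by (metis surj_right up_iter_simps(3,4))
  from int_recursion[of "\<lambda>k s. up_iter (- a k) (right (up_iter (a k) s))", OF this, of k0 "up_iter (- l0) s0"]
  obtain S where S: "S k0 = up_iter (- l0) s0"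
    "\<And>k. S (k + 1) = up_iter (- a k) (right (up_iter (a k) (S k)))" by blast
  show ?thesis
    by (rule exI[of _ "\<lambda>k l. up_iter l (S k)"]) (simp add: coherent_def S up_iter_simps)
qed

text \<open>Any two cells are joined by vertical moves and the crossings in rows \<open>a k\<close>,
  so whatever these moves preserve is a global invariant.\<close>

lemma grid_const:
  fixes Q :: "int \<Rightarrow> int \<Rightarrow> 'a"
  assumes "\<And>k l. Q k (l + 1) = Q k l" "\<And>k. Q (k + 1) (a k) = Q k (a k)"
  shows "Q k l = Q k' l'"
proof -
  have row: "Q k l = Q k l'" for k l l' using int_step_const[of "Q k"] assms(1) by blast
  have "Q (k + 1) 0 = Q k 0" for k using assms(2)[of k] row by metis
  then have "Q k 0 = Q k' 0" for k k' using int_step_const[of "\<lambda>k. Q k 0"] by blast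
  then show ?thesis using row by metis
qed

text \<open>Agreement at a cell is the invariant: \<open>up\<close> and \<open>right\<close> are
  injective, so it spreads in all directions.\<close>

lemma coherent_unique:
  assumes "coherent a E" "coherent a E'" "E k0 l0 = E' k0 l0"
  shows "E = E'"
proof -
  have "(E k l = E' k l) = (E k0 l0 = E' k0 l0)" for k l
    by (rule grid_const[where a = a]) (use assms(1,2) in \<open>auto simp: coherent_def inj_up inj_right\<close>)
  then show ?thesis using assms(3) by blast
qed

lemma coherent_free:
  assumes "coherent a E" "free_square (E k0 l0)"
  shows "free_square (E k l)"
proof -
  have "free_square (E k l) = free_square (E k0 l0)"
    by (rule grid_const[where a = a]) (use assms(1) in \<open>auto simp: coherent_def\<close>)
  then show ?thesis using assms(2) by blast
qed

lemma coherent_shift: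
  assumes "coherent a E" "\<And>k. a (k + v) = a k + u"
  shows "coherent a (\<lambda>k l. E (k + v) (l + u))"
  unfolding coherent_def
proof (intro conjI allI)
  show "E (k + v) (l + 1 + u) = up (E (k + v) (l + u))" for k l
    using assms(1) unfolding coherent_def by (metis add.commute add.left_commute)
  show "E (k + 1 + v) (a k + u) = right (E (k + v) (a k + u))" for k
    using assms unfolding coherent_def by (metis add.commute add.left_commute)
qed

lemma coherent_map:
  assumes "coherent a E" "\<And>s. f (right s) = right (f s)" "\<And>s. f (up s) = up (f s)"
  shows "coherent a (\<lambda>k l. f (E k l))"
  using assms by (simp add: coherent_def)

section \<open>Deck transformations, types and parities\<close>

definition sgn_x :: "copy \<Rightarrow> int" where "sgn_x c = (if xbit c then - 1 else 1)"
definition sgn_y :: "copy \<Rightarrow> int" where "sgn_y c = (if ybit c then - 1 else 1)"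

text \<open>\<open>right\<close> negates \<open>i\<close> exactly when it changes the first bit of
  the copy, so only a shift signed by that bit commutes with it; likewise \<open>up\<close>. Folding
  the four copies back to one table, a set \<open>fx\<close> gives a reflection in the first
  coordinate and an unset one a translation. The factor 2 keeps obstacles on obstacles.\<close>

definition deck :: "bool \<Rightarrow> bool \<Rightarrow> int \<Rightarrow> int \<Rightarrow> square \<Rightarrow> square" where
  "deck fx fy A B = (\<lambda>(c, i, j). (flip fx fy c, i + 2 * A * sgn_x c, j + 2 * B * sgn_y c))"

lemma flip_commute: "flip a b (flip a' b' c) = flip a' b' (flip a b c)"
  by (auto simp: flip_flip copy_eq_iff)

lemma sgn_flip [simp]:
  "sgn_x (flip a b c) = (if a then - sgn_x c else sgn_x c)"
  "sgn_y (flip a b c) = (if b then - sgn_y c else sgn_y c)"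
  by (auto simp: sgn_x_def sgn_y_def)

lemma deck_right: "deck fx fy A B (right s) = right (deck fx fy A B s)"
  and deck_up: "deck fx fy A B (up s) = up (deck fx fy A B s)"
  by (cases s; auto simp: deck_def flip_commute)+

lemma free_deck [simp]: "free_square (deck fx fy A B s) = free_square s"
  by (cases s) (auto simp: deck_def free_square_def)

definition sq_type :: "square \<Rightarrow> int" where
  "sq_type s = (if even (fst (snd s)) then 1 else if even (snd (snd s)) then 2 else 0)"

lemma sq_type_right: "free_square s \<Longrightarrow> sq_type (right s) = (1 - sq_type s) mod 3"
  and sq_type_up: "free_square s \<Longrightarrow> sq_type (up s) = (2 - sq_type s) mod 3"
  by (cases s; auto simp: sq_type_def free_square_def)+

lemma sq_type_mod: "sq_type s mod 3 = sq_type s" "sq_type s = 0 \<or> sq_type s = 1 \<or> sq_type s = 2"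
  by (auto simp: sq_type_def)

lemma sq_type_parity:
  assumes "free_square s" "free_square s'"
  shows "sq_type s = sq_type s' \<longleftrightarrow> even (fst (snd s)) = even (fst (snd s')) \<and> even (snd (snd s)) = even (snd (snd s'))"
  using assms by (auto simp: sq_type_def free_square_def)

lemma deck_transitive:
  assumes "free_square s" "free_square s'" "sq_type s = sq_type s'"
  shows "\<exists>A B. deck (xbit (fst s) \<noteq> xbit (fst s')) (ybit (fst s) \<noteq> ybit (fst s')) A B s = s'"
proof -
  obtain c i j c' i' j' where s: "s = (c, i, j)" "s' = (c', i', j')" by (cases s; cases s')
  have ev: "even (i' - i)" "even (j' - j)" using sq_type_parity[of s s'] assms s by auto
  have i: "2 * (sgn_x c * ((i' - i) div 2)) * sgn_x c = i' - i" for c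
    using ev(1) by (auto simp: sgn_x_def)
  have j: "2 * (sgn_y c * ((j' - j) div 2)) * sgn_y c = j' - j" for c
    using ev(2) by (auto simp: sgn_y_def)
  show ?thesis
    by (rule exI[of _ "sgn_x c * ((i' - i) div 2)"], rule exI[of _ "sgn_y c * ((j' - j) div 2)"])
      (simp add: s deck_def i j, auto simp: copy_eq_iff)
qed

text \<open>Replacing \<open>t\<close> by \<open>2 - t\<close> on cells with \<open>k + l\<close>
  odd absorbs the vertical reflections and leaves one value \<open>Z k\<close> per column. A
  horizontal crossing then rotates this value: by 1 from an even cell, since
  \<open>2 - (1 - t) = t + 1\<close>, and by 2 from an odd one, since
  \<open>1 - (2 - t) = t - 1\<close>.\<close>

lemma coherent_types:
  assumes coh: "coherent a E" and free: "\<And>k l. free_square (E k l)"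
  shows "\<exists>Z. (\<forall>k l. sq_type (E k l) = (if even (k + l) then Z k else (2 - Z k) mod 3)) \<and>
     (\<forall>k. Z k mod 3 = Z k) \<and> (\<forall>k. Z (k + 1) = (Z k + 1 + of_bool (odd (k + a k))) mod 3)"
proof -
  define Y where "Y k l = (if even (k + l) then sq_type (E k l) else (2 - sq_type (E k l)) mod 3)" for k l
  have Ystep: "Y k (l + 1) = Y k l" for k l
    using coh sq_type_up[OF free[of k l]] sq_type_mod(2)[of "E k l"]
    by (auto simp: Y_def coherent_def)
  define Z where "Z k = Y k 0" for k
  have YZ: "Y k l = Z k" for k l unfolding Z_def by (rule int_step_const[of "Y k"]) (rule Ystep)
  have T: "sq_type (E k l) = (if even (k + l) then Z k else (2 - Z k) mod 3)" for k l
    using YZ[of k l] sq_type_mod(2)[of "E k l"] by (auto simp: Y_def)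
  have Zm: "Z k mod 3 = Z k" for k 
    using sq_type_mod(1)[of "E k 0"] by (auto simp: Y_def Z_def)
  have "Z (k + 1) = (Z k + 1 + of_bool (odd (k + a k))) mod 3" for k
  proof -
    have "sq_type (E (k + 1) (a k)) = (1 - sq_type (E k (a k))) mod 3"
      using coh sq_type_right[OF free[of k "a k"]] by (auto simp: coherent_def)
    moreover have "Z k = 0 \<or> Z k = 1 \<or> Z k = 2" "Z (k+1) = 0 \<or> Z (k+1) = 1 \<or> Z (k+1) = 2"
      using Zm[of k] Zm[of "k + 1"] by presburger+
    ultimately show ?thesis unfolding T by (auto split: if_splits)
  qed
  with T Zm show ?thesis by blast
qed

lemma sum_window_shift:
  fixes f :: "int \<Rightarrow> int"
  assumes per: "\<And>k. f (k + int n) = f k"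
  shows "sum f {k..<k + int n} = sum f {0..<int n}"
proof -
  have "sum f {k + 1..<k + 1 + int n} = sum f {k..<k + int n}" for k
  proof (cases n)
    case 0
    then show ?thesis by simp
  next
    case (Suc m)
    have "{k..<k + int n} = insert k {k + 1..<k + int n}"
         "{k + 1..<k + 1 + int n} = insert (k + int n) {k + 1..<k + int n}" using Suc by auto
    then show ?thesis using per[of k] by simp
  qed
  from int_step_const[of "\<lambda>k. sum f {k..<k + int n}", OF this, of k 0] show ?thesis by simp
qed

lemma mod_step_sum:
  fixes Z f :: "int \<Rightarrow> int"
  assumes "\<And>k. Z k mod 3 = Z k" "\<And>k. Z (k + 1) = (Z k + f k) mod 3"
  shows "Z (k + int n) = (Z k + sum f {k..<k + int n}) mod 3"
proof (induction n)
  case (Suc n)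
  have "{k..<k + int (Suc n)} = insert (k + int n) {k..<k + int n}" by auto
  moreover have "Z (k + int (Suc n)) = (Z (k + int n) + f (k + int n)) mod 3"
    using assms(2)[of "k + int n"] by (simp add: algebra_simps)
  ultimately show ?case using Suc by (simp add: mod_simps algebra_simps)
qed (simp add: assms)

text \<open>A column crossing changes exactly one of the parity of \<open>i\<close> and the first
  bit of the copy, and vertical moves change neither. So the bit is determined by the parities of
  \<open>i\<close> and \<open>k\<close> up to a global constant. Rows behave in the same
  way.\<close>

lemma coherent_parity:
  assumes "coherent a E" "\<And>k l. free_square (E k l)"
  shows "xbit (fst (E k l)) = xbit (fst (E k' l')) \<longleftrightarrow> even (fst (snd (E k l)) + fst (snd (E k' l')) + k + k')"
    "ybit (fst (E k l)) = ybit (fst (E k' l')) \<longleftrightarrow> even (snd (snd (E k l)) + snd (snd (E k' l')) + l + l')"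
proof -
  define X where "X k l = (xbit (fst (E k l)) = even (fst (snd (E k l)) + k))" for k l
  define Y where "Y k l = (ybit (fst (E k l)) = even (snd (snd (E k l)) + l))" for k l
  have "X k (l + 1) = X k l" "Y k (l + 1) = Y k l" for k l
    using assms(1) by (cases "E k l"; auto simp: coherent_def X_def Y_def)+
  moreover have "X (k + 1) (a k) = X k (a k)" "Y (k + 1) (a k) = Y k (a k)" for k
    using assms(1) by (cases "E k (a k)"; auto simp: coherent_def X_def Y_def)+
  ultimately have X: "X k l = X k' l'" and Y: "Y k l = Y k' l'"
    using grid_const[of X a] grid_const[of Y a] by blast+
  show "xbit (fst (E k l)) = xbit (fst (E k' l')) \<longleftrightarrow> even (fst (snd (E k l)) + fst (snd (E k' l')) + k + k')"
    using X by (auto simp: X_def)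
  show "ybit (fst (E k l)) = ybit (fst (E k' l')) \<longleftrightarrow> even (snd (snd (E k l)) + snd (snd (E k' l')) + l + l')"
    using Y by (auto simp: Y_def)
qed

section \<open>Orbits of squares along rational directions\<close>

lemma div_minus_div_pred:
  fixes x v :: int
  assumes "v > 0"
  shows "(x - 1) div v = x div v - of_bool (v dvd x)"
proof (cases "v dvd x")
  case True
  then obtain q where x: "x = v * q" by blast
  have "(x - 1) div v = q - 1"
    by (rule int_div_pos_eq[of _ _ _ "v - 1"]) (use assms in \<open>auto simp: x algebra_simps\<close>)
  then show ?thesis using assms x by simp
next
  case False
  then have "x mod v \<noteq> 0" by (simp add: dvd_eq_mod_eq_0)
  then have r: "0 < x mod v" "x mod v < v" using assms pos_mod_bound[of v x] pos_mod_sign[of v x] by linarith+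
  have "(x - 1) div v = x div v"
    by (rule int_div_pos_eq[of _ _ _ "x mod v - 1"]) (use r in \<open>auto simp: algebra_simps\<close>)
  then show ?thesis using False by simp
qed

lemma div_period:
  fixes u v c k :: int
  assumes "v > 0"
  shows "(u * (k + v) + c) div v = (u * k + c) div v + u"
proof -
  have "u * (k + v) + c = (u * k + c) + u * v" by (simp add: algebra_simps)
  then have "(u * (k + v) + c) div v = ((u * k + c) + u * v) div v" by (rule arg_cong)
  also have "\<dots> = (u * k + c) div v + u" using assms by (simp del: mult.commute)
  finally show ?thesis .
qed

lemma periodic_multiple:
  fixes a :: "int \<Rightarrow> int"
  assumes "\<And>k. a (k + v) = a k + u"
  shows "a (k + N * v) = a k + N * u"
proof -
  have "a (k + (N + 1) * v) - (N + 1) * u = a (k + N * v) - N * u" for N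
    using assms[of "k + N * v"] by (simp add: algebra_simps)
  from int_step_const[of "\<lambda>N. a (k + N * v) - N * u", OF this, of N 0] show ?thesis by simp
qed

text \<open>Translating the sequence by a lattice vector that moves the line \<open>u x = v y\<close> to the next lattice
  line changes exactly one crossing per period and flips all parities; so the number of odd
  crossings differs from its complement by one.\<close>

lemma odd_crossings:
  fixes u v c :: int
  assumes v: "v > 0" "odd v" and u: "odd u" and cop: "coprime u v"
  defines "ev k \<equiv> (of_bool (odd (k + (u * k + c) div v)) :: int)"
  shows "(\<Sum>k\<in>{0..<v}. 1 + ev k) mod 3 \<noteq> 0"
proof -
  obtain x y where "x * u + y * v = 1" using bezout_int[of u v] cop by auto
  then obtain k' l' where kl: "u * k' - v * l' = 1"
    by (metis diff_minus_eq_add minus_mult_right mult.commute)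
  have par: "odd (k' + l')"
  proof -
    have "odd (u * k' - v * l')" using kl by simp
    then show ?thesis using u v by simp
  qed
  define n where "n = sum ev {0..<v}"
  define b where "b k = (u * k + c - 1) div v" for k
  define pb where "pb k = (of_bool (odd (k + b k)) :: int)" for k
  have bsh: "b k = (u * (k - k') + c) div v + l'" for k
  proof -
    have "u * k + c - 1 = (u * (k - k') + c) + l' * v" using kl by (simp add: algebra_simps)
    then have "b k = ((u * (k - k') + c) + l' * v) div v" unfolding b_def by (rule arg_cong)
    also have "\<dots> = (u * (k - k') + c) div v + l'" using v by (simp del: mult.commute)
    finally show ?thesis .
  qed
  have pb: "pb k = 1 - ev (k - k')" for k
    unfolding pb_def bsh ev_def using par by auto
  have per: "ev (k + v) = ev k" for k
    using div_period[OF v(1), of u k c] u v by (simp add: ev_def)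
  have "(\<Sum>k\<in>{0..<v}. ev (k - k')) = sum ev {- k'..<- k' + v}"
    by (rule sum.reindex_bij_witness[of _ "\<lambda>k. k + k'" "\<lambda>k. k - k'"]) auto
  also have "\<dots> = n"
    using sum_window_shift[of ev "nat v" "- k'"] v per by (simp add: n_def)
  finally have sum_pb: "sum pb {0..<v} = v - n"
    using v by (simp add: pb sum_subtractf)
  \<comment> \<open>\<open>k'\<close> inverts \<open>u\<close> mod \<open>v\<close>, so
    \<open>k0\<close> is the only column of the period in which \<open>v\<close> divides
    \<open>u * k + c\<close>, that is, in which lowering \<open>c\<close> by one changes the
    row.\<close>
  define k0 where "k0 = (- c * k') mod v"
  have k0: "k0 \<in> {0..<v}" using v by (simp add: k0_def)
  have dvd: "v dvd u * k + c \<longleftrightarrow> k = k0" if "k \<in> {0..<v}" for k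
  proof
    have "v dvd (- c * k') - k0" unfolding k0_def using minus_mod_eq_mult_div by (metis dvd_triv_left)
    then have "v dvd u * ((- c * k') - k0)" by simp
    moreover have "u * ((- c * k') - k0) = - (u * k0 + c) - c * l' * v"
    proof -
      have "u * k' = 1 + v * l'" using kl by simp
      then have "c * (u * k') = c * (1 + v * l')" by simp
      then show ?thesis by (simp add: algebra_simps)
    qed
    ultimately have "v dvd - (u * k0 + c) - c * l' * v" by simp
    then have "v dvd - (u * k0 + c)" by (metis dvd_triv_right dvd_diff_commute dvd_add_left_iff diff_add_cancel)
    then have d0: "v dvd u * k0 + c" by (simp only: dvd_minus_iff)
    show "v dvd u * k + c" if "k = k0" using d0 that by simp
    assume "v dvd u * k + c"
    then have "v dvd (u * k + c) - (u * k0 + c)" using d0 by (rule dvd_diff)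
    then have "v dvd u * (k - k0)" by (simp add: algebra_simps)
    then have "v dvd k - k0" using cop by (simp add: coprime_commute coprime_dvd_mult_right_iff)
    moreover have "\<bar>k - k0\<bar> < v" using k0 that by auto
    ultimately show "k = k0" using zdvd_imp_le[of v "\<bar>k - k0\<bar>"] by fastforce
  qed
  have "ev k = pb k" if "k \<in> {0..<v}" "k \<noteq> k0" for k
    using dvd[OF that(1)] that(2) div_minus_div_pred[OF v(1), of "u * k + c"]
    by (simp add: ev_def pb_def b_def)
  then have "sum ev ({0..<v} - {k0}) = sum pb ({0..<v} - {k0})" by (intro sum.cong) auto
  moreover have "ev k0 + pb k0 = 1"
    using dvd[OF k0] div_minus_div_pred[OF v(1), of "u * k0 + c"]
    by (simp add: ev_def pb_def b_def)
  then have "(ev k0 = 1 \<and> pb k0 = 0) \<or> (ev k0 = 0 \<and> pb k0 = 1)"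
    by (auto simp: ev_def pb_def)
  ultimately have "n - (v - n) = 1 \<or> n - (v - n) = - 1"
    using sum.remove[OF _ k0, of ev] sum.remove[OF _ k0, of pb] sum_pb by (auto simp: n_def)
  moreover have "(\<Sum>k\<in>{0..<v}. 1 + ev k) = v + n" using v by (simp add: sum.distrib n_def)
  \<comment> \<open>From \<open>2 * n = v + 1\<close> or \<open>2 * n = v - 1\<close> it follows
    that \<open>2 * (v + n)\<close> is \<open>3 * v + 1\<close> or \<open>3 * v - 1\<close>, so 3
    does not divide \<open>v + n\<close>.\<close>
  ultimately show ?thesis by presburger
qed

text \<open>The cells \<open>(N * v, N * u)\<close> all have even index sum, so there the column
  values are the types themselves, and one period rotates them by the sum \<open>d\<close> of the
  rotations it crosses.\<close>

lemma odd_direction_types: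
  assumes v: "v > 0" "odd v" and u: "odd u" and cop: "coprime u v"
    and a: "\<And>k. a k = (u * k + c) div v"
    and coh: "coherent a E" and free: "\<And>k l. free_square (E k l)"
  shows "\<exists>d. d mod 3 \<noteq> 0 \<and> (\<forall>N. N \<ge> 0 \<longrightarrow> sq_type (E (N * v) (N * u)) = (sq_type (E 0 0) + N * d) mod 3)"
proof -
  obtain Z where Z: "\<And>k l. sq_type (E k l) = (if even (k + l) then Z k else (2 - Z k) mod 3)"
    "\<And>k. Z k mod 3 = Z k" "\<And>k. Z (k + 1) = (Z k + 1 + of_bool (odd (k + a k))) mod 3"
    using coherent_types[OF coh free] by blast
  define f where "f k = 1 + (of_bool (odd (k + a k)) :: int)" for k
  define d where "d = sum f {0..<v}"
  have av: "a (k + v) = a k + u" for k using div_period[OF v(1)] by (simp add: a)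
  have per: "f (k + v) = f k" for k using u v by (simp add: f_def av)
  have "Z (N * v) = (Z 0 + N * d) mod 3" if "N \<ge> 0" for N
    using that
  proof (induction N rule: int_ge_induct)
    case base then show ?case using Z(2)[of 0] by simp
  next
    case (step N)
    have "Z (k + v) = (Z k + d) mod 3" for k
      using mod_step_sum[of Z f k "nat v"] Z(2,3) sum_window_shift[of f "nat v" k] per v
      by (simp add: f_def d_def algebra_simps)
    from this[of "N * v"] step show ?case by (simp add: algebra_simps mod_simps)
  qed
  moreover have "even (N * v + N * u)" for N using u v by simp
  moreover have "d mod 3 \<noteq> 0"
    using odd_crossings[OF v u cop, of c] by (simp add: d_def f_def a)
  ultimately show ?thesis using Z(1) by (intro exI[of _ d]) simp
qed

lemma odd_direction_period:
  assumes v: "v > 0" "odd v" and u: "odd u" and cop: "coprime u v"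
    and a: "\<And>k. a k = (u * k + c) div v"
    and coh: "coherent a E" and free: "\<And>k l. free_square (E k l)"
  shows "E (k + 6 * N * v) (l + 6 * N * u) = E k l"
proof -
  have av: "a (k + v) = a k + u" for k using div_period[OF v(1)] by (simp add: a)
  have av3: "a (k + 3 * v) = a k + 3 * u" for k using periodic_multiple[of a v u k 3, OF av] by simp
  have "sq_type (E 0 0) = sq_type (E (3 * v) (3 * u))"
    using odd_direction_types[OF v u cop a coh free] sq_type_mod(1)[of "E 0 0"]
    by (auto simp: dest!: spec[of _ 3])
  note t = this sq_type_parity[OF free free, THEN iffD1, OF this]
  from deck_transitive[OF free free t(1)] obtain A B where
    AB: "deck (xbit (fst (E 0 0)) \<noteq> xbit (fst (E (3 * v) (3 * u)))) (ybit (fst (E 0 0)) \<noteq> ybit (fst (E (3 * v) (3 * u)))) A B (E 0 0) = E (3 * v) (3 * u)"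
    by blast
  \<comment> \<open>The type has returned, so both coordinates keep their parities; as
    \<open>3 * v\<close> and \<open>3 * u\<close> are odd, both bits of the copy must have
    changed.\<close>
  have "xbit (fst (E 0 0)) \<noteq> xbit (fst (E (3 * v) (3 * u)))" "ybit (fst (E 0 0)) \<noteq> ybit (fst (E (3 * v) (3 * u)))"
    using coherent_parity[OF coh free, of 0 0 "3 * v" "3 * u"] t(2) u v by auto
  with AB have AB: "deck True True A B (E 0 0) = E (3 * v) (3 * u)" by simp
  have "(\<lambda>k l. deck True True A B (E k l)) = (\<lambda>k l. E (k + 3 * v) (l + 3 * u))"
    by (rule coherent_unique[OF coherent_map[OF coh] coherent_shift[OF coh av3], of _ 0 0])
      (use AB in \<open>simp_all add: deck_right deck_up\<close>)
  then have D: "E (k + 3 * v) (l + 3 * u) = deck True True A B (E k l)" for k l by metis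
  \<comment> \<open>Flipping both bits reverses both signs, so the second shift undoes the
    first.\<close>
  have dd: "deck True True A B (deck True True A B s) = s" for s
    by (cases s) (auto simp: deck_def flip_flip)
  have "E (k + 6 * (N + 1) * v) (l + 6 * (N + 1) * u) = E (k + 6 * N * v) (l + 6 * N * u)" for N
    using D[of "k + 6 * N * v + 3 * v" "l + 6 * N * u + 3 * u"] D[of "k + 6 * N * v" "l + 6 * N * u"]
    by (simp add: dd algebra_simps)
  from int_step_const[of "\<lambda>N. E (k + 6 * N * v) (l + 6 * N * u)", OF this, of N 0]
  show ?thesis by simp
qed

text \<open>A return restores the copy, which forces \<open>N * v\<close> to be even, and the type,
  which forces 3 to divide \<open>N * d\<close>. Reducing mod 6 first makes the exponent
  nonnegative, as the formula for the types requires.\<close>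

lemma odd_direction_minimal_period:
  assumes v: "v > 0" "odd v" and u: "odd u" and cop: "coprime u v"
    and a: "\<And>k. a k = (u * k + c) div v"
    and coh: "coherent a E" and free: "\<And>k l. free_square (E k l)"
    and eq: "E (k + N * v) (l + N * u) = E k l"
  shows "6 dvd N"
proof -
  have av: "a (k + v) = a k + u" for k using div_period[OF v(1)] by (simp add: a)
  define M where "M = N mod 6"
  have NM: "N = M + 6 * (N div 6)" by (simp add: M_def)
  have eqM: "E (k + M * v) (l + M * u) = E k l"
    using eq odd_direction_period[OF v u cop a coh free, of "k + M * v" "N div 6" "l + M * u"] NM
    by (metis (no_types, lifting) add.assoc distrib_right)
  have "(\<lambda>k l. E (k + M * v) (l + M * u)) = E"
    by (rule coherent_unique[OF coherent_shift[OF coh periodic_multiple[of a v u _ M, OF av]] coh, of k l]) (rule eqM)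
  then have E0: "E (M * v) (M * u) = E 0 0" by (metis add_0)
  have M0: "M \<ge> 0" "M < 6" by (simp_all add: M_def)
  obtain d where d: "d mod 3 \<noteq> 0" "\<And>N. N \<ge> 0 \<Longrightarrow> sq_type (E (N * v) (N * u)) = (sq_type (E 0 0) + N * d) mod 3"
    using odd_direction_types[OF v u cop a coh free] by blast
  have "even (M * v)" using coherent_parity(1)[OF coh free, of 0 0 "M * v" "M * u"] E0 by simp
  then have "even M" using v by simp
  moreover have "(sq_type (E 0 0) + M * d) mod 3 = sq_type (E 0 0) mod 3"
    using d(2)[OF M0(1)] E0 sq_type_mod(1) by simp
  then have "3 dvd (sq_type (E 0 0) + M * d) - sq_type (E 0 0)" by (rule mod_eq_dvd_iff[THEN iffD1])
  then have "3 dvd M * d" by simp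
  then have "3 dvd M" using d(1) prime_dvd_mult_iff[of "3::int" M d] by (simp add: dvd_eq_mod_eq_0)
  ultimately have "M = 0" using M0 by presburger
  then show ?thesis by (simp add: M_def dvd_eq_mod_eq_0)
qed

text \<open>A nontrivial rotation generates \<int>/3. Together with \<open>deck_transitive\<close>
  this relates any two systems of squares by a shift and a deck transformation.\<close>

lemma odd_direction_all_types:
  assumes v: "v > 0" "odd v" and u: "odd u" and cop: "coprime u v"
    and a: "\<And>k. a k = (u * k + c) div v"
    and coh: "coherent a E" and free: "\<And>k l. free_square (E k l)"
  shows "\<exists>N. sq_type (E (N * v) (N * u)) = sq_type s"
proof -
  obtain d where d: "d mod 3 \<noteq> 0" "\<And>N. N \<ge> 0 \<Longrightarrow> sq_type (E (N * v) (N * u)) = (sq_type (E 0 0) + N * d) mod 3"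
    using odd_direction_types[OF v u cop a coh free] by blast
  have *: "(x + 0 * d) mod 3 = y \<or> (x + 1 * d) mod 3 = y \<or> (x + 2 * d) mod 3 = y"
    if "x = 0 \<or> x = 1 \<or> x = 2" "y = 0 \<or> y = 1 \<or> y = 2" for x y
  proof -
    have r: "(x + N * d) mod 3 = (x + N * (d mod 3)) mod 3" for N by (metis mod_add_right_eq mod_mult_right_eq)
    have "d mod 3 = 1 \<or> d mod 3 = 2" using d(1) by presburger
    then show ?thesis using that unfolding r by auto
  qed
  have "(sq_type (E 0 0) + 0 * d) mod 3 = sq_type s \<or> (sq_type (E 0 0) + 1 * d) mod 3 = sq_type s
      \<or> (sq_type (E 0 0) + 2 * d) mod 3 = sq_type s"
    by (rule *) (rule sq_type_mod(2))+
  then show ?thesis using d(2)[of 0, OF order_refl] d(2)[of 1, OF zero_le_one] d(2)[of 2, OF zero_le_numeral] by metis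
qed

text \<open>A half-turn of the surface about the centre of a square. It reverses directions,
  conjugating \<open>right\<close> and \<open>up\<close> to their inverses; the signs have the same
  reason as in \<open>deck\<close>.\<close>

definition point_reflection :: "int \<Rightarrow> int \<Rightarrow> square \<Rightarrow> square" where
  "point_reflection A B = (\<lambda>(c, i, j). (c, 2 * A * sgn_x c - i, 2 * B * sgn_y c - j))"

lemma point_reflection_up: "up (point_reflection A B (up s)) = point_reflection A B s"
  and point_reflection_right: "right (point_reflection A B (right s)) = point_reflection A B s"
  by (cases s; auto simp: point_reflection_def flip_flip)+

text \<open>The square at the origin is a centre of symmetry. If the trajectory through it closed up, then
  after two periods it would be back at the start, so after one period it would be
  at a fixed point of the symmetry, that is at a square of the initial type.\<close>

lemma mixed_direction_not_closed:
  assumes v: "v > 0" and uv: "odd (u + v)"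
    and av: "\<And>k. a (k + v) = a k + u" and sym: "\<And>k. a (- k - 1) = - a k"
  shows "\<exists>s. free_square s \<and> (\<forall>E N. coherent a E \<longrightarrow> E 0 0 = s \<longrightarrow> N \<ge> 1 \<longrightarrow> E (N * v) (N * u) \<noteq> s)"
proof -
  define f where "f k = 1 + (of_bool (odd (k + a k)) :: int)" for k
  define d where "d = sum f {0..<v}"
  \<comment> \<open>One period acts on the types by \<open>2 - t - d\<close>. Type 0 is taken if
    this moves it; otherwise type 0 is the unique fixed type and type 1 is moved.\<close>
  define s where "s = (if (2 - d) mod 3 \<noteq> 0 then (Copy_I, 1, 1) else (Copy_I, 0 :: int, 1 :: int))"
  have s: "free_square s" "(2 - sq_type s - d) mod 3 \<noteq> sq_type s"
    unfolding s_def free_square_def sq_type_def by (simp_all, presburger)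
  show ?thesis
  proof (intro exI[of _ s] conjI allI impI notI)
    show "free_square s" by (rule s)
    fix E N assume coh: "coherent a E" and E0: "E 0 0 = s" and N: "N \<ge> 1" and EN: "E (N * v) (N * u) = s"
    have free: "free_square (E k l)" for k l using coherent_free[OF coh, of 0 0] E0 s by simp
    obtain Z where Z: "\<And>k l. sq_type (E k l) = (if even (k + l) then Z k else (2 - Z k) mod 3)"
      "\<And>k. Z k mod 3 = Z k" "\<And>k. Z (k + 1) = (Z k + 1 + of_bool (odd (k + a k))) mod 3"
      using coherent_types[OF coh free] by blast
    have Zs: "Z (k + int n) = (Z k + sum f {k..<k + int n}) mod 3" for k n
      by (rule mod_step_sum) (use Z(2,3) in \<open>simp_all add: f_def algebra_simps\<close>)
    \<comment> \<open>A period changes the parity of \<open>k + a k\<close> and so exchanges the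
      rotations by 1 and by 2. Over two periods they add up to \<open>3 * v\<close> and vanish mod
      3.\<close>
    have alt: "f (k + v) = 3 - f k" for k using uv by (auto simp: f_def av)
    have Zv: "Z v = (Z 0 + d) mod 3" using Zs[of 0 "nat v"] v by (simp add: d_def)
    have "sum f {v..<v + v} = (\<Sum>k\<in>{0..<v}. f (k + v))"
      by (rule sum.reindex_bij_witness[of _ "\<lambda>k. k + v" "\<lambda>k. k - v"]) auto
    also have "\<dots> = 3 * v - d" using v by (simp add: alt sum_subtractf d_def)
    finally have "Z (v + v) = (Z v + (3 * v - d)) mod 3" using Zs[of v "nat v"] v by simp
    also have "\<dots> = (Z 0 + 3 * v) mod 3" unfolding Zv by (simp add: mod_simps)
    finally have Z2: "Z (2 * v) = Z 0" using Z(2)[of 0] by simp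
    have tv: "sq_type (E v u) \<noteq> sq_type (E 0 0)"
    proof -
      have "sq_type (E v u) = (2 - Z 0 - d) mod 3"
      proof -
        have "odd (v + u)" using uv by (simp add: add.commute)
        then have "sq_type (E v u) = (2 - (Z 0 + d) mod 3) mod 3" by (simp only: Z(1) Zv if_False)
        then show ?thesis by (simp add: mod_simps diff_diff_eq)
      qed
      moreover have "sq_type (E 0 0) = Z 0" by (simp add: Z(1))
      ultimately show ?thesis using s E0 by simp
    qed
    have t2: "sq_type (E 0 0) = sq_type (E (2 * v) (2 * u))" by (simp add: Z(1) Z2)
    have bits: "xbit (fst (E 0 0)) = xbit (fst (E (2 * v) (2 * u)))" "ybit (fst (E 0 0)) = ybit (fst (E (2 * v) (2 * u)))"
      using coherent_parity[OF coh free, of 0 0 "2 * v" "2 * u"] sq_type_parity[OF free free, THEN iffD1, OF t2] by auto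
    obtain A B where AB: "deck False False A B (E 0 0) = E (2 * v) (2 * u)"
      using deck_transitive[OF free free t2] bits by auto
    have av2: "a (k + 2 * v) = a k + 2 * u" for k using periodic_multiple[of a v u k 2, OF av] by simp
    have "(\<lambda>k l. deck False False A B (E k l)) = (\<lambda>k l. E (k + 2 * v) (l + 2 * u))"
      by (rule coherent_unique[OF coherent_map[OF coh] coherent_shift[OF coh av2], of _ 0 0])
        (use AB in \<open>simp_all add: deck_right deck_up\<close>)
    then have D: "E (k + 2 * v) (l + 2 * u) = deck False False A B (E k l)" for k l by metis
    have Dn: "E (2 * int n * v) (2 * int n * u) = deck False False (int n * A) (int n * B) (E 0 0)" for n
    proof (induction n)
      case 0 show ?case by (cases "E 0 0") (simp add: deck_def)
    next
      case (Suc n)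
      then show ?case using D[of "2 * int n * v" "2 * int n * u"]
        by (cases "E 0 0") (simp add: deck_def algebra_simps)
    qed
    have "(\<lambda>k l. E (k + N * v) (l + N * u)) = E"
      by (rule coherent_unique[OF coherent_shift[OF coh periodic_multiple[of a v u _ N, OF av]] coh, of 0 0])
        (use E0 EN in simp)
    \<comment> \<open>A return after \<open>N\<close> periods is repeated after
      \<open>2 * N\<close>, which is the \<open>N\<close>-th power of the translation found for two
      periods. A translation with such a power fixing a square is trivial.\<close>
    then have "E (N * v + N * v) (N * u + N * u) = E (N * v) (N * u)" by metis
    then have "deck False False (N * A) (N * B) (E 0 0) = E 0 0"
      using Dn[of "nat N"] N E0 EN by (simp add: algebra_simps)
    then have "A = 0 \<and> B = 0" using N
      by (cases "E 0 0") (auto simp: deck_def sgn_x_def sgn_y_def split: if_splits)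
    then have per: "E (k + 2 * v) (l + 2 * u) = E k l" for k l
      using D[of k l] by (cases "E k l") (simp add: deck_def)
    obtain c i j where c: "E 0 0 = (c, i, j)" by (cases "E 0 0")
    let ?K = "point_reflection (sgn_x c * i) (sgn_y c * j)"
    \<comment> \<open>Negating the plane takes the crossing between columns \<open>- k - 1\<close>
      and \<open>- k\<close> to the one between \<open>k\<close> and \<open>k + 1\<close>, and
      \<open>sym\<close> matches their rows. The half-turned system therefore develops the same line
      and has the same square at the origin.\<close>
    have "coherent a (\<lambda>k l. ?K (E (- k) (- l)))"
      unfolding coherent_def
    proof (intro conjI allI)
      fix k l
      have "E (- k) (- l) = up (E (- k) (- (l + 1)))" using coh unfolding coherent_def
        by (metis add_uminus_conv_diff diff_add_cancel minus_add_distrib)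
      then show "?K (E (- k) (- (l + 1))) = up (?K (E (- k) (- l)))" by (simp add: point_reflection_up)
    next
      fix k
      have "E ((- k - 1) + 1) (a (- k - 1)) = right (E (- k - 1) (a (- k - 1)))" using coh unfolding coherent_def by blast
      then have "E (- k) (- a k) = right (E (- (k + 1)) (- a k))" using sym[of k] by simp
      then show "?K (E (- (k + 1)) (- a k)) = right (?K (E (- k) (- a k)))" by (simp add: point_reflection_right)
    qed
    moreover have "?K (E 0 0) = E 0 0" by (auto simp: c point_reflection_def sgn_x_def sgn_y_def)
    ultimately have "(\<lambda>k l. ?K (E (- k) (- l))) = E"
      by (intro coherent_unique[OF _ coh, of _ 0 0]) simp_all
    then have "E v u = ?K (E (- v) (- u))" by metis
    also have "E (- v) (- u) = E v u" using per[of "- v" "- u"] by simp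
    finally have "E v u = ?K (E v u)" .
    \<comment> \<open>A square fixed by the half-turn has coordinates equal to \<open>i\<close> and
      \<open>j\<close> up to sign.\<close>
    then have "even (fst (snd (E v u))) = even i \<and> even (snd (snd (E v u))) = even j"
      by (cases "E v u") (auto simp: point_reflection_def sgn_x_def sgn_y_def split: if_splits)
    then have "sq_type (E v u) = sq_type (E 0 0)" using sq_type_parity[OF free[of v u] free[of 0 0]] by (simp add: c)
    with tv show False by contradiction
  qed
qed

section \<open>Developing lines onto the surface\<close>

definition cell :: "int \<Rightarrow> int \<Rightarrow> pt set" where
  "cell k l = {p. of_int k - 1/2 \<le> 2 * fst p \<and> 2 * fst p \<le> of_int k + 1/2 \<and>
    of_int l - 1/2 \<le> 2 * snd p \<and> 2 * snd p \<le> of_int l + 1/2}"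

definition place :: "int \<Rightarrow> int \<Rightarrow> square \<Rightarrow> pt \<Rightarrow> copy \<times> pt" where
  "place k l s p = (fst s, fst p + of_int (fst (snd s) - k) / 2, snd p + of_int (snd (snd s) - l) / 2)"

lemma fst_place [simp]: "fst (place k l s p) = fst s"
  by (simp add: place_def)

lemma place_in_cell: "p \<in> cell k l \<Longrightarrow> snd (place k l s p) \<in> cell (fst (snd s)) (snd (snd s))"
  by (simp add: cell_def place_def diff_divide_distrib)

lemma cell_subset_table:
  assumes "free_square (c, i, j)" "p \<in> cell i j"
  shows "p \<in> half_table"
proof (rule ccontr)
  assume "p \<notin> half_table"
  then obtain m n where "p \<in> obstacle_interior (1/2) (1/2) (m, n)" by (auto simp: table_def)
  then have "real_of_int (i - 2 * m) < 1" "real_of_int (i - 2 * m) > - 1"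
      "real_of_int (j - 2 * n) < 1" "real_of_int (j - 2 * n) > - 1"
    using assms(2) by (auto simp: obstacle_interior_def cell_def mem_Times_iff)
  then have "i = 2 * m" "j = 2 * n" by linarith+
  with assms(1) show False by (simp add: free_square_def)
qed

lemma table_in_cell:
  assumes "p \<in> half_table"
  obtains i j where "free_square (c, i, j)" "p \<in> cell i j"
proof -
  define i where "i = \<lfloor>2 * fst p + 1/2\<rfloor>"
  define j where "j = \<lfloor>2 * snd p + 1/2\<rfloor>"
  have fi: "of_int i \<le> 2 * fst p + 1/2" "2 * fst p + 1/2 < of_int i + 1" unfolding i_def by linarith+
  have fj: "of_int j \<le> 2 * snd p + 1/2" "2 * snd p + 1/2 < of_int j + 1" unfolding j_def by linarith+
  have c: "p \<in> cell i j" using fi fj by (auto simp: cell_def)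
  show thesis
  proof (cases "even i \<and> even j")
    case False
    then show ?thesis using that[of i j] c by (auto simp: free_square_def)
  next
    case True
    then obtain m n where mn: "i = 2 * m" "j = 2 * n" by (auto elim!: evenE)
    \<comment> \<open>Rounding can select an obstacle only if \<open>p\<close> is on its left or
      bottom side; the neighbour to the left or below is then free and contains
      \<open>p\<close>.\<close>
    have "p \<notin> obstacle_interior (1/2) (1/2) (m, n)" using assms by (auto simp: table_def)
    then have "2 * fst p + 1/2 = of_int i \<or> 2 * snd p + 1/2 = of_int j"
      using fi fj by (auto simp: obstacle_interior_def mem_Times_iff mn)
    then show ?thesis
    proof
      assume "2 * fst p + 1/2 = of_int i"
      then have "p \<in> cell (i - 1) j" using fj by (auto simp: cell_def)
      then show ?thesis using that[of "i - 1" j] True by (auto simp: free_square_def)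
    next
      assume "2 * snd p + 1/2 = of_int j"
      then have "p \<in> cell i (j - 1)" using fi by (auto simp: cell_def)
      then show ?thesis using that[of i "j - 1"] True by (auto simp: free_square_def)
    qed
  qed
qed

lemma half_abs_le:
  "of_int i - 1/2 \<le> 2 * x \<Longrightarrow> 2 * x \<le> of_int i + 1/2 \<Longrightarrow> even i \<Longrightarrow> \<exists>n. \<bar>x - of_int n\<bar> \<le> 1/4" for x :: real
  by (rule exI[of _ "i div 2"]) (auto elim!: evenE simp: abs_if)

text \<open>For odd \<open>j\<close> the two squares share an edge inside the table. For even
  \<open>j\<close> the edge is the left side of an obstacle, and the two placements differ by the
  reflection that describes the gluing.\<close>

lemma glue_right:
  assumes "free_square s" "p \<in> cell k l" "p \<in> cell (k + 1) l"
  shows "point_class (place (k + 1) l (right s) p) = point_class (place k l s p)"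
proof -
  obtain c i j where s: "s = (c, i, j)" by (cases s)
  have x: "2 * fst p = k + 1/2" using assms(2,3) by (auto simp: cell_def)
  show ?thesis
  proof (cases "odd j")
    case True
    then show ?thesis by (simp add: s place_def)
  next
    case False
    then have "odd i" using assms(1) by (simp add: s free_square_def)
    define m where "m = (i + 1) div 2"
    have m: "i = 2 * m - 1" using \<open>odd i\<close> unfolding m_def by presburger
    have 1: "fst (snd (place k l s p)) = of_int m - 1/4" using x by (simp add: place_def s m field_simps)
    have "of_int j - 1/2 \<le> 2 * snd (snd (place k l s p))" "2 * snd (snd (place k l s p)) \<le> of_int j + 1/2"
      using place_in_cell[OF assms(2), of s] by (simp_all add: cell_def s)
    from half_abs_le[OF this] False have "on_vertical_side (snd (place k l s p))"
      using 1 by (auto simp: on_vertical_side_def intro!: exI[of _ m])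
    moreover have "place (k + 1) l (right s) p = (flip True False (fst (place k l s p)), reflect True False (snd (place k l s p)))"
      using False x by (simp add: s place_def reflect_def field_simps)
    ultimately have "place (k + 1) l (right s) p \<in> point_class (place k l s p)"
      unfolding point_class_def by blast
    then show ?thesis by (rule point_class_eqI)
  qed
qed

lemma glue_up:
  assumes "free_square s" "p \<in> cell k l" "p \<in> cell k (l + 1)"
  shows "point_class (place k (l + 1) (up s) p) = point_class (place k l s p)"
proof -
  obtain c i j where s: "s = (c, i, j)" by (cases s)
  have x: "2 * snd p = l + 1/2" using assms(2,3) by (auto simp: cell_def)
  show ?thesis
  proof (cases "odd i")
    case True
    then show ?thesis by (simp add: s place_def)
  next
    case False
    then have "odd j" using assms(1) by (simp add: s free_square_def)
    define m where "m = (j + 1) div 2"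
    have m: "j = 2 * m - 1" using \<open>odd j\<close> unfolding m_def by presburger
    have 1: "snd (snd (place k l s p)) = of_int m - 1/4" using x by (simp add: place_def s m field_simps)
    have "of_int i - 1/2 \<le> 2 * fst (snd (place k l s p))" "2 * fst (snd (place k l s p)) \<le> of_int i + 1/2"
      using place_in_cell[OF assms(2), of s] by (simp_all add: cell_def s)
    from half_abs_le[OF this] False have "on_horizontal_side (snd (place k l s p))"
      using 1 by (auto simp: on_horizontal_side_def intro!: exI[of _ m])
    moreover have "place k (l + 1) (up s) p = (flip False True (fst (place k l s p)), reflect False True (snd (place k l s p)))"
      using False x by (simp add: s place_def reflect_def field_simps)
    ultimately have "place k (l + 1) (up s) p \<in> point_class (place k l s p)"
      unfolding point_class_def by blast
    then show ?thesis by (rule point_class_eqI)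
  qed
qed

section \<open>Developing points of the plane\<close>

definition grid_corner :: "pt \<Rightarrow> bool" where
  "grid_corner p \<longleftrightarrow> (\<exists>(k :: int) (l :: int). 2 * fst p = k + 1/2 \<and> 2 * snd p = l + 1/2)"

text \<open>The condition under which a coherent system has an unambiguous value at a point: the
  system is glued along vertical edges only in the rows \<open>a k\<close>, and around a corner not
  at all.\<close>

definition admissible :: "(int \<Rightarrow> int) \<Rightarrow> pt \<Rightarrow> bool" where
  "admissible a p \<longleftrightarrow> \<not> grid_corner p \<and> (\<forall>k l. p \<in> cell k l \<longrightarrow> p \<in> cell (k + 1) l \<longrightarrow> l = a k)"

definition dev :: "(int \<Rightarrow> int \<Rightarrow> square) \<Rightarrow> pt \<Rightarrow> spt" where
  "dev E p = (let k = \<lfloor>2 * fst p + 1/2\<rfloor>; l = \<lfloor>2 * snd p + 1/2\<rfloor> in point_class (place k l (E k l) p))"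

lemma cell_index: "of_int k - 1/2 \<le> 2 * x \<Longrightarrow> 2 * x \<le> of_int k + 1/2 \<Longrightarrow>
    \<lfloor>2 * x + 1/2\<rfloor> = k \<or> (\<lfloor>2 * x + 1/2\<rfloor> = k + 1 \<and> 2 * x = of_int k + 1/2)" for x :: real
  by (cases "2 * x + 1/2 = of_int (k + 1)") (simp, linarith)

text \<open>An admissible point lies in at most two cells, which share an edge. A horizontal edge is
  always glued, and a vertical one is in row \<open>a k\<close>, so the choice made by rounding is
  immaterial.\<close>

lemma dev_cell:
  assumes coh: "coherent a E" and free: "\<And>k l. free_square (E k l)"
    and adm: "admissible a p" and p: "p \<in> cell k l"
  shows "dev E p = point_class (place k l (E k l) p)"
proof -
  define k0 where "k0 = \<lfloor>2 * fst p + 1/2\<rfloor>"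
  define l0 where "l0 = \<lfloor>2 * snd p + 1/2\<rfloor>"
  have dev: "dev E p = point_class (place k0 l0 (E k0 l0) p)" by (simp add: dev_def Let_def k0_def l0_def)
  have k: "k0 = k \<or> (k0 = k + 1 \<and> 2 * fst p = k + 1/2)"
    using cell_index[of k "fst p"] p by (simp add: cell_def k0_def)
  have l: "l0 = l \<or> (l0 = l + 1 \<and> 2 * snd p = l + 1/2)"
    using cell_index[of l "snd p"] p by (simp add: cell_def l0_def)
  consider "k0 = k" "l0 = l" | "k0 = k + 1" "2 * fst p = k + 1/2" "l0 = l" | "k0 = k" "l0 = l + 1" "2 * snd p = l + 1/2"
    using k l adm by (auto simp: admissible_def grid_corner_def)
  then show ?thesis
  proof cases
    case 1 then show ?thesis by (simp add: dev)
  next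
    case 2
    then have p': "p \<in> cell (k + 1) l" using p by (simp add: cell_def)
    then have "l = a k" using adm p by (auto simp: admissible_def)
    then have "E (k + 1) l = right (E k l)" using coh by (simp add: coherent_def)
    then show ?thesis using glue_right[OF free p p'] 2 by (simp add: dev)
  next
    case 3
    then have p': "p \<in> cell k (l + 1)" using p by (simp add: cell_def)
    have "E k (l + 1) = up (E k l)" using coh by (simp add: coherent_def)
    then show ?thesis using glue_up[OF free p p'] 3 by (simp add: dev)
  qed
qed

text \<open>Congruence modulo this lattice is equality on the torus. Placements and gluings respect
  it, so it follows a trajectory without reference to squares.\<close>

definition half_lattice :: "pt \<Rightarrow> bool" where
  "half_lattice q \<longleftrightarrow> 2 * fst q \<in> \<int> \<and> 2 * snd q \<in> \<int>"

lemma half_lattice_diff: "half_lattice p \<Longrightarrow> half_lattice q \<Longrightarrow> half_lattice (p - q)"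
  and half_lattice_add: "half_lattice p \<Longrightarrow> half_lattice q \<Longrightarrow> half_lattice (p + q)"
  by (auto simp: half_lattice_def right_diff_distrib distrib_left)

lemma half_lattice_uminus: "half_lattice p \<Longrightarrow> half_lattice (- p)"
  by (auto simp: half_lattice_def)

lemma int_quarter: "\<bar>x - of_int m\<bar> = 1/4 \<Longrightarrow> 2 * x - 1/2 \<in> \<int>" for x :: real
proof -
  assume "\<bar>x - of_int m\<bar> = 1/4"
  then have "2 * x - 1/2 = of_int (2 * m) \<or> 2 * x - 1/2 = of_int (2 * m - 1)" unfolding of_int_diff of_int_mult of_int_numeral of_int_1 by linarith
  then show ?thesis by (metis Ints_of_int)
qed

lemma on_side_half_int:
  "on_vertical_side p \<Longrightarrow> 2 * fst p - 1/2 \<in> \<int>" "on_horizontal_side p \<Longrightarrow> 2 * snd p - 1/2 \<in> \<int>"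
  unfolding on_vertical_side_def on_horizontal_side_def using int_quarter by blast+

lemma half_int_double: "2 * x - 1/2 \<in> \<int> \<Longrightarrow> 4 * x \<in> \<int>" for x :: real
proof -
  assume "2 * x - 1/2 \<in> \<int>"
  then have "2 * (2 * x - 1/2) + 1 \<in> \<int>" by (intro Ints_add Ints_mult) auto
  then show ?thesis by (simp add: algebra_simps)
qed

text \<open>A reflection moves the point by twice a coordinate, and on the sides concerned that
  coordinate is a multiple of 1/4.\<close>

lemma point_class_lattice:
  assumes "y \<in> point_class x" shows "half_lattice (snd y - snd x)"
proof -
  obtain a b where ab: "y = (flip a b (fst x), reflect a b (snd x))"
    "a \<longrightarrow> on_vertical_side (snd x)" "b \<longrightarrow> on_horizontal_side (snd x)"
    using assms unfolding point_class_def by blast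
  have "a \<Longrightarrow> 4 * fst (snd x) \<in> \<int>" "b \<Longrightarrow> 4 * snd (snd x) \<in> \<int>"
    using ab on_side_half_int half_int_double by blast+
  then show ?thesis by (auto simp: half_lattice_def ab(1) reflect_def)
qed

lemma grid_corner_iff: "grid_corner p \<longleftrightarrow> 2 * fst p - 1/2 \<in> \<int> \<and> 2 * snd p - 1/2 \<in> \<int>"
proof
  assume "grid_corner p"
  then obtain k l :: int where "2 * fst p - 1/2 = of_int k" "2 * snd p - 1/2 = of_int l"
    by (auto simp: grid_corner_def)
  then show "2 * fst p - 1/2 \<in> \<int> \<and> 2 * snd p - 1/2 \<in> \<int>" by (metis Ints_of_int)
next
  assume "2 * fst p - 1/2 \<in> \<int> \<and> 2 * snd p - 1/2 \<in> \<int>"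
  then obtain k l where kl: "2 * fst p - 1/2 = of_int k" "2 * snd p - 1/2 = of_int l"
    by (metis Ints_cases)
  show "grid_corner p" unfolding grid_corner_def
    by (rule exI[of _ k], rule exI[of _ l]) (use kl in linarith)
qed

lemma grid_corner_lattice: "half_lattice (p - q) \<Longrightarrow> grid_corner p \<Longrightarrow> grid_corner q"
proof -
  assume "half_lattice (p - q)" "grid_corner p"
  then have "2 * fst p - 1/2 - 2 * fst (p - q) \<in> \<int>" "2 * snd p - 1/2 - 2 * snd (p - q) \<in> \<int>"
    unfolding grid_corner_iff half_lattice_def by (blast intro: Ints_diff)+
  then show ?thesis by (simp add: grid_corner_iff algebra_simps)
qed

text \<open>Among the four squares at a grid vertex exactly one has both indices even, so every
  vertex of the grid is a corner of an obstacle.\<close>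

lemma grid_corner_eq_corners: "grid_corner p \<longleftrightarrow> p \<in> corners (1/2) (1/2)"
proof
  assume "grid_corner p"
  then obtain k l :: int where kl: "2 * fst p = k + 1/2" "2 * snd p = l + 1/2" by (auto simp: grid_corner_def)
  have *: "\<exists>(m :: int) e. (e = -1 \<or> e = 1) \<and> x = m + e * (1/2) / 2" if "2 * x = of_int k + 1/2" for x :: real and k :: int
  proof (cases "even k")
    case True
    then show ?thesis using that by (intro exI[of _ "k div 2"] exI[of _ 1]) (auto elim!: evenE)
  next
    case False
    then show ?thesis using that by (intro exI[of _ "(k + 1) div 2"] exI[of _ "-1"]) (auto elim!: oddE)
  qed
  obtain m e where "(e = -1 \<or> e = 1) \<and> fst p = real_of_int m + e * (1/2) / 2" using *[OF kl(1)] by blast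
  moreover obtain n f where "(f = -1 \<or> f = 1) \<and> snd p = real_of_int n + f * (1/2) / 2" using *[OF kl(2)] by blast
  ultimately show "p \<in> corners (1/2) (1/2)" unfolding corners_def
    by (cases p) auto
next
  assume "p \<in> corners (1/2) (1/2)"
  then obtain m n :: int and e f where mn: "p = (of_int m + e * (1/2) / 2, of_int n + f * (1/2) / 2)" "e \<in> {-1, 1}" "f \<in> {-1, 1 :: real}"
    by (auto simp: corners_def)
  have *: "2 * (of_int m + e * (1/2) / 2) - 1/2 \<in> \<int>" if "e \<in> {-1, 1 :: real}" for e and m :: int
    by (rule int_quarter[of _ m]) (use that in auto)
  show "grid_corner p" unfolding grid_corner_iff using mn * by auto
qed

lemma singular_iff:
  assumes "x \<in> K" "K = point_class y"
  shows "K \<in> singularities (1/2) (1/2) \<longleftrightarrow> grid_corner (snd x)"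
proof
  assume "K \<in> singularities (1/2) (1/2)"
  then obtain c q where q: "q \<in> corners (1/2) (1/2)" "K = point_class (c, q)"
    by (auto simp: singularities_def half_proj_eq)
  from point_class_lattice[of x "(c, q)"] have "half_lattice (snd x - q)" using assms(1) q by simp
  then have "half_lattice (q - snd x)" using half_lattice_uminus by fastforce
  then show "grid_corner (snd x)" using q grid_corner_eq_corners grid_corner_lattice by blast
next
  assume "grid_corner (snd x)"
  then have "point_class x \<in> singularities (1/2) (1/2)"
    by (cases x) (auto simp: singularities_def half_proj_eq grid_corner_eq_corners)
  moreover have "K = point_class x" using assms point_class_eqI by blast
  ultimately show "K \<in> singularities (1/2) (1/2)" by simp
qed

text \<open>Rounding follows the motion: floor for \<open>e > 0\<close>, ceiling for
  \<open>e < 0\<close>, so a boundary point is assigned to the interval it is about to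
  enter.\<close>

lemma stay_in_interval:
  fixes x e :: real
  shows "\<exists>k::int. \<exists>\<epsilon>>0. \<forall>s\<in>{0..\<epsilon>}. of_int k - 1/2 \<le> 2 * (x + s * e) \<and> 2 * (x + s * e) \<le> of_int k + 1/2"
proof -
  consider "e = 0" | "e > 0" | "e < 0" by linarith
  then show ?thesis
  proof cases
    case 1
    show ?thesis
      by (rule exI[of _ "\<lfloor>2 * x + 1/2\<rfloor>"], rule exI[of _ 1]) (simp add: 1, linarith)
  next
    case 2
    define k where "k = \<lfloor>2 * x + 1/2\<rfloor>"
    have k: "of_int k \<le> 2 * x + 1/2" "2 * x + 1/2 < of_int k + 1" unfolding k_def by linarith+
    define \<epsilon> where "\<epsilon> = (of_int k + 1 - 1/2 - 2 * x) / (2 * e)"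
    have "of_int k - 1/2 \<le> 2 * (x + s * e) \<and> 2 * (x + s * e) \<le> of_int k + 1/2" if "s \<in> {0..\<epsilon>}" for s
    proof -
      have "s * (2 * e) \<le> of_int k + 1 - 1/2 - 2 * x" "0 \<le> s * e"
        using that 2 by (auto simp: \<epsilon>_def pos_le_divide_eq)
      then show ?thesis using k by (simp add: algebra_simps)
    qed
    moreover have "\<epsilon> > 0" using k 2 by (simp add: \<epsilon>_def)
    ultimately show ?thesis by blast
  next
    case 3
    define k where "k = \<lceil>2 * x - 1/2\<rceil>"
    have k: "of_int k \<ge> 2 * x - 1/2" "2 * x - 1/2 > of_int k - 1" unfolding k_def by linarith+
    define \<epsilon> where "\<epsilon> = (2 * x - 1/2 - of_int k + 1) / (2 * (- e))"
    have "of_int k - 1/2 \<le> 2 * (x + s * e) \<and> 2 * (x + s * e) \<le> of_int k + 1/2" if "s \<in> {0..\<epsilon>}" for s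
    proof -
      have "s * (2 * (- e)) \<le> \<epsilon> * (2 * (- e))" using that 3 by (intro mult_right_mono) auto
      also have "\<epsilon> * (2 * (- e)) = 2 * x - 1/2 - of_int k + 1" using 3 by (simp add: \<epsilon>_def)
      finally have "s * (2 * (- e)) \<le> 2 * x - 1/2 - of_int k + 1" .
      moreover have "0 \<le> s * (- e)" using that 3 by (simp add: mult_nonneg_nonpos)
      ultimately have "s * (2 * (- e)) \<le> 2 * x - 1/2 - of_int k + 1" "0 \<le> s * (- e)" by blast+
      then show ?thesis using k by (simp add: algebra_simps)
    qed
    moreover have "\<epsilon> > 0" unfolding \<epsilon>_def by (rule divide_pos_pos) (use k 3 in linarith)+
    ultimately show ?thesis by blast
  qed
qed

lemma stay_in_cell: "\<exists>k l. \<exists>\<epsilon>>0. \<forall>s\<in>{0..\<epsilon>}. z + s *\<^sub>R d \<in> cell k l"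
proof -
  obtain k e1 where 1: "e1 > 0" "\<forall>s\<in>{0..e1}. of_int k - 1/2 \<le> 2 * (fst z + s * fst d) \<and> 2 * (fst z + s * fst d) \<le> of_int k + 1/2"
    using stay_in_interval by blast
  obtain l e2 where 2: "e2 > 0" "\<forall>s\<in>{0..e2}. of_int l - 1/2 \<le> 2 * (snd z + s * snd d) \<and> 2 * (snd z + s * snd d) \<le> of_int l + 1/2"
    using stay_in_interval by blast
  show ?thesis
    by (rule exI[of _ k], rule exI[of _ l], rule exI[of _ "min e1 e2"]) (use 1 2 in \<open>auto simp: cell_def\<close>)
qed

section \<open>Developed lines as regular trajectories\<close>

lemma dev_local:
  assumes coh: "coherent a E" and free: "\<And>k l. free_square (E k l)"
    and adm: "\<And>s. s \<ge> 0 \<Longrightarrow> admissible a (z + s *\<^sub>R d)"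
  shows "\<exists>\<epsilon>>0. \<exists>(c, p) \<in> dev E z. \<forall>s\<in>{0..\<epsilon>}. p + s *\<^sub>R d \<in> half_table \<and>
           dev E (z + s *\<^sub>R d) = half_proj (c, p + s *\<^sub>R d)"
proof -
  obtain k l \<epsilon> where e: "\<epsilon> > 0" "\<forall>s\<in>{0..\<epsilon>}. z + s *\<^sub>R d \<in> cell k l" using stay_in_cell by blast
  obtain c p where cp: "place k l (E k l) z = (c, p)" by (cases "place k l (E k l) z")
  have pl: "place k l (E k l) (z + s *\<^sub>R d) = (c, p + s *\<^sub>R d)" for s
    using cp by (auto simp: place_def prod_eq_iff)
  have "dev E (z + s *\<^sub>R d) = point_class (c, p + s *\<^sub>R d)" "p + s *\<^sub>R d \<in> half_table" if s: "s \<in> {0..\<epsilon>}" for s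
  proof -
    have in_cell: "z + s *\<^sub>R d \<in> cell k l" using e s by blast
    show "dev E (z + s *\<^sub>R d) = point_class (c, p + s *\<^sub>R d)"
      using dev_cell[OF coh free adm in_cell] s by (simp add: pl)
    have "free_square (E k l)" by (rule free)
    then show "p + s *\<^sub>R d \<in> half_table"
      using place_in_cell[OF in_cell, of "E k l"] cell_subset_table[of "fst (E k l)" "fst (snd (E k l))" "snd (snd (E k l))"] by (simp add: pl)
  qed
  moreover from this[of 0] have "(c, p) \<in> dev E z" using e(1) self_in_point_class by simp
  ultimately show ?thesis unfolding half_proj_eq
    by (intro exI[of _ \<epsilon>] conjI bexI[of _ "(c, p)"]) (use e(1) in auto)
qed

lemma dev_in_surface:
  assumes coh: "coherent a E" and free: "\<And>k l. free_square (E k l)" and adm: "admissible a z"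
  obtains x where "dev E z = point_class x" "snd x \<in> half_table" "half_lattice (snd x - z)"
proof -
  obtain k l where c: "z \<in> cell k l" using stay_in_cell[of z 0] by auto
  have "dev E z = point_class (place k l (E k l) z)" by (rule dev_cell[OF coh free adm c])
  moreover have "snd (place k l (E k l) z) \<in> half_table"
    using place_in_cell[OF c, of "E k l"] cell_subset_table[of "fst (E k l)" "fst (snd (E k l))" "snd (snd (E k l))"] free[of k l] by simp
  moreover have "half_lattice (snd (place k l (E k l) z) - z)"
    by (simp add: half_lattice_def place_def diff_divide_distrib)
  ultimately show thesis by (rule that)
qed

lemma surface_eq: "surface (1/2) (1/2) = point_class ` (UNIV \<times> half_table)"
  by (auto simp: surface_def half_proj_eq)

lemma dev_regular:
  assumes coh: "coherent a E" and free: "\<And>k l. free_square (E k l)"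
    and adm: "\<And>t. admissible a (z + t *\<^sub>R unit_vec \<theta>)"
  shows "regular_trajectory (1/2) (1/2) \<theta> (\<lambda>t. dev E (z + t *\<^sub>R unit_vec \<theta>))"
proof -
  let ?d = "unit_vec \<theta>"
  let ?\<gamma> = "\<lambda>t. dev E (z + t *\<^sub>R unit_vec \<theta>)"
  have "straight_line (1/2) (1/2) \<theta> ?\<gamma>"
    unfolding straight_line_def
  proof (intro allI conjI)
    fix t
    obtain x where "?\<gamma> t = point_class x" "snd x \<in> half_table" using dev_in_surface[OF coh free adm] by blast
    then show "?\<gamma> t \<in> surface (1/2) (1/2)" by (cases x) (auto simp: surface_eq)
    have "\<exists>\<epsilon>>0. \<exists>(c, p) \<in> ?\<gamma> t. \<forall>s\<in>{0..\<epsilon>}. p + s *\<^sub>R ?d \<in> half_table \<and>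
           dev E (z + t *\<^sub>R ?d + s *\<^sub>R ?d) = half_proj (c, p + s *\<^sub>R ?d)"
      by (rule dev_local[OF coh free]) (use adm[of "t + _"] in \<open>simp add: scaleR_add_left add.assoc\<close>)
    then obtain e1 c1 p1 where 1: "e1 > 0" "(c1, p1) \<in> ?\<gamma> t" "\<forall>s\<in>{0..e1}. p1 + s *\<^sub>R ?d \<in> half_table \<and>
           ?\<gamma> (t + s) = half_proj (c1, p1 + s *\<^sub>R ?d)"
      by (auto simp: scaleR_add_left add.assoc)
    have "\<exists>\<epsilon>>0. \<exists>(c, p) \<in> ?\<gamma> t. \<forall>s\<in>{0..\<epsilon>}. p + s *\<^sub>R (- ?d) \<in> half_table \<and>
           dev E (z + t *\<^sub>R ?d + s *\<^sub>R (- ?d)) = half_proj (c, p + s *\<^sub>R (- ?d))"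
      by (rule dev_local[OF coh free]) (use adm[of "t - _"] in \<open>simp add: scaleR_diff_left add_diff_eq\<close>)
    then obtain e2 c2 p2 where 2: "e2 > 0" "(c2, p2) \<in> ?\<gamma> t" "\<forall>s\<in>{0..e2}. p2 - s *\<^sub>R ?d \<in> half_table \<and>
           ?\<gamma> (t - s) = half_proj (c2, p2 - s *\<^sub>R ?d)"
      by (auto simp: scaleR_diff_left add_diff_eq)
    show "\<exists>\<epsilon>>0. (\<exists>(c, p) \<in> ?\<gamma> t. \<forall>s\<in>{0..\<epsilon>}. p + s *\<^sub>R ?d \<in> half_table \<and> ?\<gamma> (t + s) = half_proj (c, p + s *\<^sub>R ?d)) \<and>
       (\<exists>(c, p) \<in> ?\<gamma> t. \<forall>s\<in>{0..\<epsilon>}. p - s *\<^sub>R ?d \<in> half_table \<and> ?\<gamma> (t - s) = half_proj (c, p - s *\<^sub>R ?d))"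
    proof (intro exI[of _ "min e1 e2"] conjI)
      show "min e1 e2 > 0" using 1 2 by simp
      show "\<exists>(c, p) \<in> ?\<gamma> t. \<forall>s\<in>{0..min e1 e2}. p + s *\<^sub>R ?d \<in> half_table \<and> ?\<gamma> (t + s) = half_proj (c, p + s *\<^sub>R ?d)"
        by (rule bexI[OF _ 1(2)]) (use 1(3) in auto)
      show "\<exists>(c, p) \<in> ?\<gamma> t. \<forall>s\<in>{0..min e1 e2}. p - s *\<^sub>R ?d \<in> half_table \<and> ?\<gamma> (t - s) = half_proj (c, p - s *\<^sub>R ?d)"
        by (rule bexI[OF _ 2(2)]) (use 2(3) in auto)
    qed
  qed
  moreover have "?\<gamma> t \<notin> singularities (1/2) (1/2)" for t
  proof -
    obtain x where x: "?\<gamma> t = point_class x" "half_lattice (snd x - (z + t *\<^sub>R ?d))"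
      using dev_in_surface[OF coh free adm] by blast
    then have "\<not> grid_corner (snd x)" using grid_corner_lattice[OF x(2)] adm[of t] by (auto simp: admissible_def)
    then show ?thesis using singular_iff[of x "?\<gamma> t" x] x self_in_point_class by simp
  qed
  ultimately show ?thesis by (auto simp: regular_trajectory_def)
qed

section \<open>Uniqueness of trajectories\<close>

text \<open>The germ of the motion just after time \<open>t\<close>. The germ before
  \<open>t\<close> is the same notion for reversed time and direction, so each local argument is
  made only once.\<close>

definition departs :: "(real \<Rightarrow> spt) \<Rightarrow> pt \<Rightarrow> real \<Rightarrow> bool" where
  "departs \<gamma> d t \<longleftrightarrow> (\<exists>c p. (c, p) \<in> \<gamma> t \<and>
     (\<forall>\<^sub>F s in at_right 0. p + s *\<^sub>R d \<in> half_table \<and> \<gamma> (t + s) = point_class (c, p + s *\<^sub>R d)))"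

lemma eventually_at_right_0: "\<epsilon> > 0 \<Longrightarrow> \<forall>s\<in>{0..\<epsilon>}. P s \<Longrightarrow> \<forall>\<^sub>F s in at_right (0 :: real). P s"
  unfolding eventually_at_right_field by (rule exI[of _ \<epsilon>]) auto

lemma straight_line_departs:
  assumes "straight_line (1/2) (1/2) \<theta> \<gamma>"
  shows "departs \<gamma> (unit_vec \<theta>) t" "departs (\<lambda>\<tau>. \<gamma> (- \<tau>)) (- unit_vec \<theta>) (- t)"
proof -
  let ?d = "unit_vec \<theta>"
  obtain \<epsilon> where "\<epsilon> > 0" "\<exists>(c, p) \<in> \<gamma> t. \<forall>s\<in>{0..\<epsilon>}. p + s *\<^sub>R ?d \<in> half_table \<and> \<gamma> (t + s) = half_proj (c, p + s *\<^sub>R ?d)"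
     "\<exists>(c, p) \<in> \<gamma> t. \<forall>s\<in>{0..\<epsilon>}. p - s *\<^sub>R ?d \<in> half_table \<and> \<gamma> (t - s) = half_proj (c, p - s *\<^sub>R ?d)"
    using assms unfolding straight_line_def by blast
  then obtain c p c' p' where e: "\<epsilon> > 0" and
    1: "(c, p) \<in> \<gamma> t" "\<forall>s\<in>{0..\<epsilon>}. p + s *\<^sub>R ?d \<in> half_table \<and> \<gamma> (t + s) = half_proj (c, p + s *\<^sub>R ?d)" and
    2: "(c', p') \<in> \<gamma> t" "\<forall>s\<in>{0..\<epsilon>}. p' - s *\<^sub>R ?d \<in> half_table \<and> \<gamma> (t - s) = half_proj (c', p' - s *\<^sub>R ?d)"
    by blast
  show "departs \<gamma> ?d t"
    using 1(1) eventually_at_right_0[OF e 1(2)] unfolding departs_def half_proj_eq by blast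
  show "departs (\<lambda>\<tau>. \<gamma> (- \<tau>)) (- ?d) (- t)"
    using 2(1) eventually_at_right_0[OF e 2(2)] unfolding departs_def half_proj_eq
    by (intro exI[of _ c'] exI[of _ p']) simp
qed

lemma locally_constant_real:
  fixes P :: "real \<Rightarrow> bool"
  assumes "\<And>t. \<forall>\<^sub>F s in at_right 0. P (t + s) = P t" "\<And>t. \<forall>\<^sub>F s in at_right 0. P (t - s) = P t"
  shows "P t = P t'"
proof -
  have op: "open {t. Q t}" if Q: "\<And>t. \<forall>\<^sub>F s in at_right 0. Q (t + s) = Q t" "\<And>t. \<forall>\<^sub>F s in at_right 0. Q (t - s) = Q t"
    for Q :: "real \<Rightarrow> bool"
  proof (rule open_subopen[THEN iffD2], rule ballI)
    fix t assume t: "t \<in> {t. Q t}"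
    obtain b1 where b1: "b1 > 0" "\<And>s. s > 0 \<Longrightarrow> s < b1 \<Longrightarrow> Q (t + s) = Q t"
      using Q(1)[of t] unfolding eventually_at_right_field by blast
    obtain b2 where b2: "b2 > 0" "\<And>s. s > 0 \<Longrightarrow> s < b2 \<Longrightarrow> Q (t - s) = Q t"
      using Q(2)[of t] unfolding eventually_at_right_field by blast
    have "Q s" if "s \<in> {t - b2 <..< t + b1}" for s
    proof -
      consider "s = t" | "s > t" | "s < t" by linarith
      then show ?thesis
      proof cases
        case 2 then show ?thesis using b1(2)[of "s - t"] that t by simp
      next
        case 3 then show ?thesis using b2(2)[of "t - s"] that t by simp
      qed (use t in simp)
    qed
    then show "\<exists>T. open T \<and> t \<in> T \<and> T \<subseteq> {t. Q t}"
      using b1(1) b2(1) by (intro exI[of _ "{t - b2 <..< t + b1}"]) auto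
  qed
  have "open {t. P t}" "open {t. \<not> P t}" using op[of P] op[of "\<lambda>t. \<not> P t"] assms by simp_all
  then have "open {t. P t}" "closed {t. P t}" by (simp_all add: closed_def Collect_neg_eq)
  then have "{t. P t} = {} \<or> {t. P t} = UNIV" by (intro clopen[THEN iffD1] conjI)
  then show ?thesis by blast
qed

lemma eventually_abs_less:
  fixes x e r :: real
  assumes "\<bar>x\<bar> < r \<or> (\<bar>x\<bar> = r \<and> x * e < 0)"
  shows "\<forall>\<^sub>F s in at_right 0. \<bar>x + s * e\<bar> < r"
  using assms
proof
  assume "\<bar>x\<bar> < r"
  moreover have "((\<lambda>s. \<bar>x + s * e\<bar>) \<longlongrightarrow> \<bar>x + 0 * e\<bar>) (at_right 0)"
    by (intro tendsto_intros)
  ultimately show ?thesis using order_tendstoD(2) by fastforce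
next
  assume r: "\<bar>x\<bar> = r \<and> x * e < 0"
  then have ne: "e \<noteq> 0" "x \<noteq> 0" by auto
  have "\<bar>x + s * e\<bar> < r" if s: "s > 0" "s < \<bar>x\<bar> / \<bar>e\<bar>" for s
  proof -
    have b: "s * \<bar>e\<bar> < \<bar>x\<bar>" "0 < s * \<bar>e\<bar>" using s ne by (simp_all add: pos_less_divide_eq)
    show ?thesis
    proof (cases "x > 0")
      case True
      then have "e < 0" using r by (simp add: mult_less_0_iff)
      then show ?thesis using b True r by auto
    next
      case False
      then have "x < 0" "e > 0" using r ne by (auto simp: mult_less_0_iff)
      then show ?thesis using b r by auto
    qed
  qed
  then show ?thesis unfolding eventually_at_right_field using ne by (intro exI[of _ "\<bar>x\<bar> / \<bar>e\<bar>"]) auto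
qed

lemma eventually_off_grid:
  fixes x e :: real
  assumes "e \<noteq> 0"
  shows "\<forall>\<^sub>F s in at_right 0. 2 * (x + s * e) - 1/2 \<notin> \<int>"
proof -
  define w where "w = 2 * x - 1/2"
  \<comment> \<open>The open unit interval from \<open>n\<close> to \<open>n + 1\<close> contains
    \<open>w\<close>, or has \<open>w\<close> as an end and is entered at once.\<close>
  define n where "n = (if e > 0 then \<lfloor>w\<rfloor> else \<lceil>w\<rceil> - 1)"
  have *: "y \<notin> \<int>" if "of_int n < y" "y < of_int n + 1" for y :: real
    using that by (auto elim!: Ints_cases)
  define y where "y = w - of_int n - 1/2"
  have "\<bar>y\<bar> < 1/2 \<or> (\<bar>y\<bar> = 1/2 \<and> y * (2 * e) < 0)"
  proof (cases "e > 0")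
    case True
    then have "of_int n \<le> w" "w < of_int n + 1" unfolding n_def by (simp_all, linarith?)
    then show ?thesis using True unfolding y_def by (cases "w = of_int n") (auto simp: abs_if)
  next
    case False
    then have "e < 0" using assms by simp
    moreover have "of_int n < w" "w \<le> of_int n + 1" using False unfolding n_def by (simp_all, linarith?)
    ultimately show ?thesis unfolding y_def by (cases "w = of_int n + 1") (auto simp: abs_if)
  qed
  from eventually_abs_less[OF this] show ?thesis
  proof (rule eventually_mono)
    fix s assume "\<bar>y + s * (2 * e)\<bar> < 1/2"
    then have "of_int n < 2 * (x + s * e) - 1/2" "2 * (x + s * e) - 1/2 < of_int n + 1"
      unfolding y_def w_def abs_less_iff by (simp_all add: algebra_simps)
    then show "2 * (x + s * e) - 1/2 \<notin> \<int>" by (rule *)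
  qed
qed

lemma point_class_single:
  assumes "2 * fst p - 1/2 \<notin> \<int>" "2 * snd p - 1/2 \<notin> \<int>"
  shows "point_class (c, p) = {(c, p)}"
  using assms on_side_half_int[of p] by (auto simp: point_class_def intro!: exI[of _ False])

lemma into_obstacle:
  fixes m n :: int and p d :: pt
  assumes "\<bar>fst p - m\<bar> < 1/4 \<or> (\<bar>fst p - m\<bar> = 1/4 \<and> (fst p - m) * fst d < 0)"
    and "\<bar>snd p - n\<bar> < 1/4 \<or> (\<bar>snd p - n\<bar> = 1/4 \<and> (snd p - n) * snd d < 0)"
  shows "\<forall>\<^sub>F s in at_right 0. p + s *\<^sub>R d \<notin> half_table"
  using eventually_abs_less[OF assms(1)] eventually_abs_less[OF assms(2)]
proof eventually_elim
  case (elim s)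
  have "fst p + s * fst d < of_int m + 1/4 \<and> of_int m - 1/4 < fst p + s * fst d" using elim(1) by linarith
  moreover have "snd p + s * snd d < of_int n + 1/4 \<and> of_int n - 1/4 < snd p + s * snd d" using elim(2) by linarith
  ultimately have "p + s *\<^sub>R d \<in> obstacle_interior (1/2) (1/2) (m, n)"
    by (simp add: obstacle_interior_def mem_Times_iff)
  then show ?case by (auto simp: table_def)
qed

text \<open>The two representatives of a point inside a side lie on opposite sides of two
  mirror-image obstacles. A direction transverse to the side leads one of them into its obstacle, so
  only the other can depart.\<close>

lemma departing_representative_unique:
  assumes x: "(c', p') \<in> point_class (c, p)" and nc: "\<not> grid_corner p"
    and d: "fst d \<noteq> 0" "snd d \<noteq> 0"
    and dep: "\<forall>\<^sub>F s in at_right 0. p + s *\<^sub>R d \<in> half_table" "\<forall>\<^sub>F s in at_right 0. p' + s *\<^sub>R d \<in> half_table"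
  shows "(c', p') = (c, p)"
proof -
  have no: "\<not> (\<forall>\<^sub>F s in at_right 0. p + s *\<^sub>R d \<notin> half_table)" "\<not> (\<forall>\<^sub>F s in at_right 0. p' + s *\<^sub>R d \<notin> half_table)"
  proof -
    have "\<not> (\<forall>\<^sub>F s in at_right 0. \<not> P s)" if P: "\<forall>\<^sub>F s in at_right (0 :: real). P s" for P
    proof
      assume "\<forall>\<^sub>F s in at_right 0. \<not> P s"
      with P have "\<forall>\<^sub>F s in at_right (0 :: real). False" by eventually_elim simp
      then show False by simp
    qed
    from this[OF dep(1)] this[OF dep(2)] show "\<not> (\<forall>\<^sub>F s in at_right 0. p + s *\<^sub>R d \<notin> half_table)"
      "\<not> (\<forall>\<^sub>F s in at_right 0. p' + s *\<^sub>R d \<notin> half_table)" .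
  qed
  obtain a b where ab: "c' = flip a b c" "p' = reflect a b p" "a \<longrightarrow> on_vertical_side p" "b \<longrightarrow> on_horizontal_side p"
    using x by (auto simp: point_class_def)
  have quarter: "2 * y - 1/2 \<in> \<int>" if "\<bar>y - of_int n\<bar> \<le> 1/4" "\<not> \<bar>y - of_int n\<bar> < 1/4" for y :: real and n
    using that by (intro int_quarter[of _ n]) simp
  consider "\<not> a" "\<not> b" | "a" "\<not> b" | "\<not> a" "b" | "a" "b" by blast
  then show ?thesis
  proof cases
    case 1 then show ?thesis using ab by simp
  next
    case 2
    then obtain m n :: int where mn: "\<bar>fst p - m\<bar> = 1/4" "\<bar>snd p - n\<bar> \<le> 1/4" using ab by (auto simp: on_vertical_side_def)
    have n: "\<bar>snd p - n\<bar> < 1/4" using quarter[OF mn(2)] int_quarter[OF mn(1)] nc by (auto simp: grid_corner_iff)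
    have "(fst p - m) * fst d < 0 \<or> (fst p - m) * fst d > 0" using mn d by (auto simp: mult_less_0_iff zero_less_mult_iff)
    then show ?thesis
    proof
      assume "(fst p - m) * fst d < 0"
      with into_obstacle[of p m d n] mn n no show ?thesis by blast
    next
      assume "(fst p - m) * fst d > 0"
      then have "(fst p' - of_int (- m)) * fst d < 0" "\<bar>fst p' - of_int (- m)\<bar> = 1/4" "\<bar>snd p' - n\<bar> < 1/4"
        using ab 2 mn n by (auto simp: reflect_def algebra_simps abs_minus_commute)
      with into_obstacle[of p' "- m" d n] no show ?thesis by blast
    qed
  next
    case 3
    then obtain m n :: int where mn: "\<bar>snd p - n\<bar> = 1/4" "\<bar>fst p - m\<bar> \<le> 1/4" using ab by (auto simp: on_horizontal_side_def)
    have n: "\<bar>fst p - m\<bar> < 1/4" using quarter[OF mn(2)] int_quarter[OF mn(1)] nc by (auto simp: grid_corner_iff)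
    have "(snd p - n) * snd d < 0 \<or> (snd p - n) * snd d > 0" using mn d by (auto simp: mult_less_0_iff zero_less_mult_iff)
    then show ?thesis
    proof
      assume "(snd p - n) * snd d < 0"
      with into_obstacle[of p m d n] mn n no show ?thesis by blast
    next
      assume "(snd p - n) * snd d > 0"
      then have "(snd p' - of_int (- n)) * snd d < 0" "\<bar>snd p' - of_int (- n)\<bar> = 1/4" "\<bar>fst p' - m\<bar> < 1/4"
        using ab 3 mn n by (auto simp: reflect_def algebra_simps abs_minus_commute)
      with into_obstacle[of p' m d "- n"] no show ?thesis by blast
    qed
  next
    case 4
    then show ?thesis using ab nc on_side_half_int[of p] by (auto simp: grid_corner_iff)
  qed
qed

text \<open>Equal classes have the same departing representative, hence equal futures. Conversely,
  just after \<open>t\<close> both motions are off the grid, where classes are singletons, so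
  equality there returns the representatives. The equivalence is what makes agreement locally
  constant.\<close>

lemma departs_agree:
  assumes dep: "departs \<gamma> d t" "departs \<gamma>' d t" and d: "fst d \<noteq> 0" "snd d \<noteq> 0"
    and cls: "\<gamma> t \<in> range point_class" "\<gamma>' t \<in> range point_class"
    and reg: "\<gamma> t \<notin> singularities (1/2) (1/2)"
  shows "\<forall>\<^sub>F s in at_right 0. (\<gamma> (t + s) = \<gamma>' (t + s)) = (\<gamma> t = \<gamma>' t)"
proof -
  obtain c p where 1: "(c, p) \<in> \<gamma> t"
    "\<forall>\<^sub>F s in at_right 0. p + s *\<^sub>R d \<in> half_table \<and> \<gamma> (t + s) = point_class (c, p + s *\<^sub>R d)"
    using dep(1) by (auto simp: departs_def)
  obtain c' p' where 2: "(c', p') \<in> \<gamma>' t"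
    "\<forall>\<^sub>F s in at_right 0. p' + s *\<^sub>R d \<in> half_table \<and> \<gamma>' (t + s) = point_class (c', p' + s *\<^sub>R d)"
    using dep(2) by (auto simp: departs_def)
  have g: "\<gamma> t = point_class (c, p)" "\<gamma>' t = point_class (c', p')"
    using cls 1(1) 2(1) by (metis point_class_eqI rangeE)+
  have nc: "\<not> grid_corner p" using singular_iff[OF 1(1) g(1)] reg by simp
  have iff: "\<gamma> t = \<gamma>' t \<longleftrightarrow> (c', p') = (c, p)"
  proof
    assume "\<gamma> t = \<gamma>' t"
    then have "(c', p') \<in> point_class (c, p)" using 2(1) g(1) by simp
    then show "(c', p') = (c, p)"
      by (rule departing_representative_unique[OF _ nc d])
        (use 1(2) 2(2) in \<open>auto elim: eventually_mono\<close>)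
  qed (simp add: g)
  show ?thesis
    using 1(2) 2(2) eventually_off_grid[OF d(1), of "fst p"] eventually_off_grid[OF d(2), of "snd p"]
      eventually_off_grid[OF d(1), of "fst p'"] eventually_off_grid[OF d(2), of "snd p'"]
  proof eventually_elim
    case (elim s)
    have off: "2 * fst (p + s *\<^sub>R d) - 1/2 \<notin> \<int>" "2 * snd (p + s *\<^sub>R d) - 1/2 \<notin> \<int>"
      "2 * fst (p' + s *\<^sub>R d) - 1/2 \<notin> \<int>" "2 * snd (p' + s *\<^sub>R d) - 1/2 \<notin> \<int>"
      unfolding fst_add snd_add fst_scaleR snd_scaleR real_scaleR_def using elim by blast+
    have "\<gamma> (t + s) = {(c, p + s *\<^sub>R d)}" "\<gamma>' (t + s) = {(c', p' + s *\<^sub>R d)}"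
      using elim(1,2) point_class_single[OF off(1,2), of c] point_class_single[OF off(3,4), of c']
      by (simp_all only:)
    then have "(\<gamma> (t + s) = \<gamma>' (t + s)) = ((c, p + s *\<^sub>R d) = (c', p' + s *\<^sub>R d))"
      by (metis singleton_inject)
    then show ?case unfolding iff by (simp only: prod.inject add_right_cancel) blast
  qed
qed

lemma regular_in_classes:
  assumes "regular_trajectory (1/2) (1/2) \<theta> \<gamma>"
  shows "\<gamma> t \<in> range point_class" "\<gamma> t \<notin> singularities (1/2) (1/2)"
proof -
  have "\<gamma> t \<in> surface (1/2) (1/2)" "range \<gamma> \<inter> singularities (1/2) (1/2) = {}"
    using assms unfolding regular_trajectory_def straight_line_def by blast+
  then show "\<gamma> t \<in> range point_class" "\<gamma> t \<notin> singularities (1/2) (1/2)" by (auto simp: surface_eq)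
qed

lemma trajectory_unique:
  assumes r: "regular_trajectory (1/2) (1/2) \<theta> \<gamma>" "regular_trajectory (1/2) (1/2) \<theta> \<gamma>'"
    and d: "fst (unit_vec \<theta>) \<noteq> 0" "snd (unit_vec \<theta>) \<noteq> 0" and eq: "\<gamma> t0 = \<gamma>' t0"
  shows "\<gamma> = \<gamma>'"
proof
  fix t
  note s = r[THEN regular_trajectory_def[THEN iffD1], THEN conjunct1]
  have "(\<gamma> t = \<gamma>' t) = (\<gamma> t0 = \<gamma>' t0)"
  proof (rule locally_constant_real[of "\<lambda>t. \<gamma> t = \<gamma>' t"])
    show "\<forall>\<^sub>F s in at_right 0. (\<gamma> (t + s) = \<gamma>' (t + s)) = (\<gamma> t = \<gamma>' t)" for t
      by (rule departs_agree[OF straight_line_departs(1)[OF s(1)] straight_line_departs(1)[OF s(2)] d])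
        (use regular_in_classes r in blast)+
    have "\<forall>\<^sub>F s in at_right 0. (\<gamma> (- (- t + s)) = \<gamma>' (- (- t + s))) = (\<gamma> (- (- t)) = \<gamma>' (- (- t)))" for t
      by (rule departs_agree[OF straight_line_departs(2)[OF s(1)] straight_line_departs(2)[OF s(2)]])
        (use d regular_in_classes r in auto)
    then show "\<forall>\<^sub>F s in at_right 0. (\<gamma> (t - s) = \<gamma>' (t - s)) = (\<gamma> t = \<gamma>' t)" for t by simp
  qed
  then show "\<gamma> t = \<gamma>' t" using eq by simp
qed

lemma class_lattice_iff:
  assumes "K = point_class y" "x \<in> K"
  shows "(\<forall>z\<in>K. half_lattice (snd z - w)) \<longleftrightarrow> half_lattice (snd x - w)"
proof
  assume x: "half_lattice (snd x - w)"
  show "\<forall>z\<in>K. half_lattice (snd z - w)"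
  proof
    fix z assume z: "z \<in> K"
    have "K = point_class x" using assms point_class_eqI by blast
    then have "half_lattice (snd z - snd x)" using z point_class_lattice by blast
    from half_lattice_add[OF this x] show "half_lattice (snd z - w)" by simp
  qed
qed (use assms in auto)

text \<open>On the torus the motion is the linear flow. This locates a trajectory at every time up
  to the half lattice, which suffices to show that it meets a corner.\<close>

lemma straight_line_lattice:
  assumes s: "straight_line (1/2) (1/2) \<theta> \<gamma>" and x: "x \<in> \<gamma> 0" and y: "y \<in> \<gamma> t"
  shows "half_lattice (snd y - (snd x + t *\<^sub>R unit_vec \<theta>))"
proof -
  let ?d = "unit_vec \<theta>"
  define P where "P \<tau> = (\<forall>z\<in>\<gamma> \<tau>. half_lattice (snd z - (snd x + \<tau> *\<^sub>R ?d)))" for \<tau>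
  have cls: "\<exists>y. \<gamma> \<tau> = point_class y" for \<tau>
  proof -
    have "\<gamma> \<tau> \<in> surface (1/2) (1/2)" using s unfolding straight_line_def by blast
    then show ?thesis by (auto simp: surface_eq)
  qed
  have step: "\<forall>\<^sub>F s in at_right 0. (\<forall>z\<in>\<gamma>' (t + s). half_lattice (snd z - (w + s *\<^sub>R d))) = (\<forall>z\<in>\<gamma>' t. half_lattice (snd z - w))"
    if dep: "departs \<gamma>' d t" and cl: "\<exists>y. \<gamma>' t = point_class y" for \<gamma>' d t w
  proof -
    obtain c p where 1: "(c, p) \<in> \<gamma>' t"
      "\<forall>\<^sub>F s in at_right 0. p + s *\<^sub>R d \<in> half_table \<and> \<gamma>' (t + s) = point_class (c, p + s *\<^sub>R d)"
      using dep by (auto simp: departs_def)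
    obtain y where y: "\<gamma>' t = point_class y" using cl by blast
    from 1(2) show ?thesis
    proof eventually_elim
      case (elim s)
      have "(\<forall>z\<in>\<gamma>' (t + s). half_lattice (snd z - (w + s *\<^sub>R d))) = half_lattice (p + s *\<^sub>R d - (w + s *\<^sub>R d))"
        using class_lattice_iff[of "\<gamma>' (t + s)" "(c, p + s *\<^sub>R d)" "(c, p + s *\<^sub>R d)"] elim self_in_point_class by simp
      also have "\<dots> = (\<forall>z\<in>\<gamma>' t. half_lattice (snd z - w))"
        using class_lattice_iff[OF y 1(1), of w] by simp
      finally show ?case .
    qed
  qed
  have "P t = P 0"
  proof (rule locally_constant_real)
    show "\<forall>\<^sub>F s in at_right 0. P (t + s) = P t" for t
      using step[OF straight_line_departs(1)[OF s] cls, of t "snd x + t *\<^sub>R ?d"]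
      by (simp add: P_def scaleR_add_left add.assoc)
    have "\<exists>y. \<gamma> (- (- t)) = point_class y" for t using cls by blast
    from step[OF straight_line_departs(2)[OF s] this]
    show "\<forall>\<^sub>F s in at_right 0. P (t - s) = P t" for t
      by (simp add: P_def scaleR_diff_left add_diff_eq)
  qed
  moreover have "P 0"
  proof -
    obtain z where "\<gamma> 0 = point_class z" using cls by blast
    from class_lattice_iff[OF this x, of "snd x"] show ?thesis by (simp add: P_def half_lattice_def)
  qed
  ultimately show ?thesis using y by (simp add: P_def)
qed

section \<open>Directions that are not completely periodic\<close>

lemma half_notin_Ints: "of_int k - 1/2 \<notin> (\<int> :: real set)"
proof
  assume "of_int k - 1/2 \<in> (\<int> :: real set)"
  then obtain l where "of_int k - 1/2 = (of_int l :: real)" by (auto elim: Ints_cases)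
  then have "(of_int (2 * k - 1) :: real) = of_int (2 * l)" by simp
  then have "2 * k - 1 = 2 * l" by (simp only: of_int_eq_iff)
  then show False by presburger
qed

lemma not_completely_periodic_vertical: "\<not> completely_periodic (1/2) (1/2) Vertical"
proof
  assume cp: "completely_periodic (1/2) (1/2) Vertical"
  \<comment> \<open>The vertical line midway between two columns of obstacles stays in
    \<open>Copy_I\<close> forever.\<close>
  define \<gamma> where "\<gamma> t = half_proj (Copy_I, (1/2, t))" for t
  have tab: "(1/2, t) \<in> half_table" for t
  proof (rule ccontr)
    assume "(1/2, t) \<notin> half_table"
    then obtain m n where "(1/2, t) \<in> obstacle_interior (1/2) (1/2) (m, n)" by (auto simp: table_def)
    then have "real_of_int m < 1" "real_of_int m > 0" by (auto simp: obstacle_interior_def)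
    then have "m < 1 \<and> m > 0" by simp
    then show False by linarith
  qed
  have nv: "\<not> on_vertical_side (1/2, t)" for t
    using on_side_half_int(1)[of "(1/2, t)"] half_notin_Ints[of 1] by auto
  have nh: "\<not> on_horizontal_side (1/2, t)" for t
  proof
    assume "on_horizontal_side (1/2, t)"
    then obtain m :: int where "\<bar>1/2 - real_of_int m\<bar> \<le> 1/4" by (auto simp: on_horizontal_side_def)
    then have "real_of_int m < 1" "real_of_int m > 0" by linarith+
    then have "m < 1 \<and> m > 0" by simp
    then show False by linarith
  qed
  have single: "\<gamma> t = {(Copy_I, (1/2, t))}" for t
    using nv[of t] nh[of t] by (auto simp: \<gamma>_def half_proj_eq point_class_def intro!: exI[of _ False])
  have "straight_line (1/2) (1/2) Vertical \<gamma>"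
    unfolding straight_line_def
  proof (intro allI conjI exI[of _ 1])
    fix t
    show "\<gamma> t \<in> surface (1/2) (1/2)" using tab[of t] by (auto simp: \<gamma>_def surface_def)
    have mem: "(Copy_I, (1/2, t)) \<in> \<gamma> t" by (simp add: single)
    show "\<exists>(c, p)\<in>\<gamma> t. \<forall>s\<in>{0..1}. p + s *\<^sub>R unit_vec Vertical \<in> half_table \<and>
        \<gamma> (t + s) = half_proj (c, p + s *\<^sub>R unit_vec Vertical)"
      by (rule bexI[OF _ mem]) (simp add: tab, simp add: \<gamma>_def)
    show "\<exists>(c, p)\<in>\<gamma> t. \<forall>s\<in>{0..1}. p - s *\<^sub>R unit_vec Vertical \<in> half_table \<and>
        \<gamma> (t - s) = half_proj (c, p - s *\<^sub>R unit_vec Vertical)"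
      by (rule bexI[OF _ mem]) (simp add: tab, simp add: \<gamma>_def)
  qed simp
  moreover have "\<gamma> t \<notin> singularities (1/2) (1/2)" for t
    using singular_iff[of "(Copy_I, (1/2, t))" "\<gamma> t" "(Copy_I, (1/2, t))"] half_notin_Ints[of 1]
    by (auto simp: single grid_corner_iff) (auto simp: \<gamma>_def half_proj_eq single[symmetric])
  ultimately have "regular_trajectory (1/2) (1/2) Vertical \<gamma>" by (auto simp: regular_trajectory_def)
  then obtain L where "L > 0" "\<gamma> (0 + L) = \<gamma> 0" using cp unfolding completely_periodic_def by blast
  then show False by (simp add: single)
qed

definition odd_slope :: "real \<Rightarrow> bool" where
  "odd_slope s \<longleftrightarrow> (\<exists>u v. odd u \<and> odd v \<and> s = real_of_int u / real_of_int v)"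

text \<open>On a line through the origin a grid corner has coordinates in the ratio of two odd
  numbers. Off this case the floor is the row in which the line meets
  \<open>2 * x = k + 1/2\<close>.\<close>

lemma central_line_admissible:
  assumes s: "\<not> odd_slope s"
  shows "admissible (\<lambda>k. \<lfloor>s * (of_int k + 1/2) + 1/2\<rfloor>) (x, s * x)"
proof -
  have nc: False if "2 * x = of_int k + 1/2" "2 * (s * x) = of_int l + 1/2" for k l :: int
  proof -
    have "s * of_int (2 * k + 1) = of_int (2 * l + 1)"
    proof -
      have "s * (2 * x) = 2 * (s * x)" by simp
      then show ?thesis unfolding that by (simp add: algebra_simps)
    qed
    moreover have "real_of_int (2 * k + 1) \<noteq> 0" by (simp only: of_int_eq_0_iff) presburger
    ultimately have "s = of_int (2 * l + 1) / of_int (2 * k + 1)" by (metis nonzero_eq_divide_eq)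
    then have "odd_slope s" unfolding odd_slope_def
      by (intro exI[of _ "2 * l + 1"] exI[of _ "2 * k + 1"]) simp
    then show False using s by blast
  qed
  have "l = \<lfloor>s * (of_int k + 1/2) + 1/2\<rfloor>" if "(x, s * x) \<in> cell k l" "(x, s * x) \<in> cell (k + 1) l" for k l
  proof -
    have x: "2 * x = of_int k + 1/2" using that by (auto simp: cell_def)
    have "s * (of_int k + 1/2) = 2 * (s * x)" unfolding x[symmetric] by simp
    moreover have "of_int l - 1/2 \<le> 2 * (s * x)" "2 * (s * x) < of_int l + 1/2"
      using that nc[OF x, of l] by (auto simp: cell_def order_less_le)
    ultimately have "of_int l \<le> s * (of_int k + 1/2) + 1/2" "s * (of_int k + 1/2) + 1/2 < of_int l + 1" by linarith+
    then show ?thesis by linarith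
  qed
  then show ?thesis using nc by (auto simp: admissible_def grid_corner_def)
qed

text \<open>\<open>l = s * k\<close> says that the line passes through the centre of cell
  \<open>(k, l)\<close>. If this never happens for \<open>k \<ge> 1\<close>, the slope is irrational
  and any free square serves; otherwise the slope is a reduced fraction of mixed parity.\<close>

lemma open_orbit_start:
  assumes s: "\<not> odd_slope s"
  shows "\<exists>q. free_square q \<and> (\<forall>E k l. coherent (\<lambda>k. \<lfloor>s * (of_int k + 1/2) + 1/2\<rfloor>) E \<longrightarrow> E 0 0 = q \<longrightarrow>
    k \<ge> 1 \<longrightarrow> of_int l = s * of_int k \<longrightarrow> E k l \<noteq> q)"
proof (cases "\<exists>k l :: int. k \<ge> 1 \<and> of_int l = s * of_int k")
  case False
  then show ?thesis by (intro exI[of _ "(Copy_I, 1, 1)"]) (auto simp: free_square_def)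
next
  case True
  then obtain k0 l0 :: int where kl0: "k0 \<ge> 1" "of_int l0 = s * of_int k0" by blast
  define g where "g = gcd l0 k0"
  obtain u v where uv: "l0 = u * g" "k0 = v * g" "coprime u v"
    using gcd_coprime_exists[of l0 k0] kl0 unfolding g_def by auto
  have g: "g > 0" using kl0 by (simp add: g_def)
  have "v * g > 0" using uv(2) kl0(1) by simp
  then have v: "v > 0" using g by (simp add: zero_less_mult_iff)
  have "of_int u * of_int g = (s * of_int v) * real_of_int g" using kl0(2) uv by simp
  then have us: "of_int u = s * of_int v" using g by simp
  then have s_eq: "s = of_int u / of_int v" using v by simp
  have "\<not> (odd u \<and> odd v)" using s s_eq by (auto simp: odd_slope_def)
  moreover have "\<not> (even u \<and> even v)" using uv(3) by (metis coprime_common_divisor odd_one)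
  ultimately have odd: "odd (u + v)" by auto
  define a where "a k = \<lfloor>s * (of_int k + 1/2) + 1/2\<rfloor>" for k
  have "s * (of_int (k + v) + 1/2) + 1/2 = (s * (of_int k + 1/2) + 1/2) + of_int u" for k
    by (simp add: us algebra_simps)
  then have av: "a (k + v) = a k + u" for k unfolding a_def by (metis floor_add_int)
  have sym: "a (- k - 1) = - a k" for k
  proof -
    define z where "z = s * (of_int k + 1/2)"
    \<comment> \<open>Rounding commutes with negation except at half-integers; such a
      \<open>z\<close> would make \<open>u * (2 * k + 1) + v\<close> even.\<close>
    have z: "z + 1/2 \<noteq> of_int j" for j
    proof
      assume j: "z + 1/2 = of_int j"
      have "2 * v * z = u * (2 * k + 1)" using v by (simp add: z_def s_eq field_simps)
      then have "of_int (u * (2 * k + 1) + v) = real_of_int (2 * v * j)" unfolding of_int_mult of_int_add j[symmetric]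
        by (simp add: algebra_simps)
      then have "u * (2 * k + 1) + v = 2 * v * j" by (simp only: of_int_eq_iff)
      then have "even (u * (2 * k + 1) + v)" by simp
      then show False using odd by simp
    qed
    have "s * (of_int (- k - 1) + 1/2) + 1/2 = - z + 1/2" by (simp add: z_def algebra_simps)
    then have "a (- k - 1) = \<lfloor>- z + 1/2\<rfloor>" by (simp add: a_def)
    moreover have "a k = \<lfloor>z + 1/2\<rfloor>" by (simp add: a_def z_def)
    moreover have "\<lfloor>- z + 1/2\<rfloor> = - \<lfloor>z + 1/2\<rfloor>"
      using z[of "\<lfloor>z + 1/2\<rfloor>"] by linarith
    ultimately show ?thesis by simp
  qed
  obtain q where q: "free_square q" "\<And>E N. coherent a E \<Longrightarrow> E 0 0 = q \<Longrightarrow> N \<ge> 1 \<Longrightarrow> E (N * v) (N * u) \<noteq> q"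
    using mixed_direction_not_closed[OF v odd av sym] by blast
  have "E k l \<noteq> q" if "coherent a E" "E 0 0 = q" "k \<ge> 1" "of_int l = s * of_int k" for E k l
  proof -
    have "real_of_int (l * v) = of_int (k * u)" using that(4) us by simp
    then have lv: "l * v = k * u" by (simp only: of_int_eq_iff)
    then have "v dvd k * u" by (metis dvd_triv_right)
    then have "v dvd k" using uv(3) by (simp add: coprime_commute coprime_dvd_mult_left_iff)
    then obtain N where N: "k = N * v" by (metis dvdE mult.commute)
    then have "l = N * u" using lv v by simp
    moreover have "N \<ge> 1" using N that(3) v by (metis int_one_le_iff_zero_less zero_less_mult_pos2 less_le_trans zero_less_one)
    ultimately show ?thesis using q(2)[OF that(1,2)] N by simp
  qed
  then show ?thesis using q(1) unfolding a_def by blast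
qed

lemma not_completely_periodic_slope:
  assumes s: "\<not> odd_slope s"
  shows "\<not> completely_periodic (1/2) (1/2) (Slope s)"
proof
  assume cp: "completely_periodic (1/2) (1/2) (Slope s)"
  define a where "a k = \<lfloor>s * (of_int k + 1/2) + 1/2\<rfloor>" for k :: int
  obtain q where q: "free_square q" "\<And>E k l. coherent a E \<Longrightarrow> E 0 0 = q \<Longrightarrow>
    k \<ge> 1 \<Longrightarrow> of_int l = s * of_int k \<Longrightarrow> E k l \<noteq> q"
    using open_orbit_start[OF s] unfolding a_def[symmetric] by blast
  obtain E where coh: "coherent a E" and E0: "E 0 0 = q" using coherent_exists by blast
  have free: "free_square (E k l)" for k l using coherent_free[OF coh, of 0 0] E0 q(1) by simp
  define e where "e = 1 / sqrt (1 + s\<^sup>2)"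
  have e: "e > 0" by (simp add: e_def add_pos_nonneg)
  have d: "unit_vec (Slope s) = (e, s * e)" by (simp add: e_def)
  have line: "0 + t *\<^sub>R unit_vec (Slope s) = (t * e, s * (t * e))" for t unfolding d by simp
  have adm: "admissible a (0 + t *\<^sub>R unit_vec (Slope s))" for t
    unfolding line a_def by (rule central_line_admissible[OF s])
  have "regular_trajectory (1/2) (1/2) (Slope s) (\<lambda>t. dev E (0 + t *\<^sub>R unit_vec (Slope s)))"
    by (rule dev_regular[OF coh free adm])
  then obtain L where L: "L > 0" "dev E (0 + (0 + L) *\<^sub>R unit_vec (Slope s)) = dev E (0 + 0 *\<^sub>R unit_vec (Slope s))"
    using cp unfolding completely_periodic_def by blast
  obtain c i j where cij: "E 0 0 = (c, i, j)" by (cases "E 0 0")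
  let ?z = "0 + L *\<^sub>R unit_vec (Slope s)"
  have "(0 :: pt) \<in> cell 0 0" by (simp add: cell_def)
  moreover have "admissible a (0 + 0 *\<^sub>R unit_vec (Slope s))" by (rule adm)
  then have "admissible a 0" by (simp only: scaleR_zero_left add_0_right)
  ultimately have "dev E 0 = point_class (place 0 0 (c, i, j) 0)"
    using dev_cell[OF coh free, of 0 0 0] by (simp add: cij)
  \<comment> \<open>The start is the centre of a square and has one representative, so a return must
    reach the same point of the same copy.\<close>
  also have "\<dots> = {(c, (of_int i / 2, of_int j / 2))}"
    using point_class_single[of "(of_int i / 2, of_int j / 2)" c] half_notin_Ints by (simp add: place_def)
  finally have dev0: "dev E 0 = {(c, (of_int i / 2, of_int j / 2))}" .
  obtain k l where kl: "?z \<in> cell k l" using stay_in_cell[of ?z 0] by auto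
  obtain c' i' j' where cij': "E k l = (c', i', j')" by (cases "E k l")
  have "place k l (E k l) ?z \<in> dev E ?z" using dev_cell[OF coh free adm kl] self_in_point_class by simp
  moreover have "dev E ?z = dev E 0" using L(2) by (simp del: unit_vec.simps)
  ultimately have "place k l (c', i', j') ?z = (c, (of_int i / 2, of_int j / 2))" by (simp only: dev0 cij' singleton_iff)
  then have c: "c' = c" and x: "2 * (L * e) = of_int (i - i' + k)" and y: "2 * (s * (L * e)) = of_int (j - j' + l)"
    unfolding line place_def by (auto simp: field_simps)
  have xk: "of_int k - 1/2 \<le> 2 * (L * e)" "2 * (L * e) \<le> of_int k + 1/2"
     "of_int l - 1/2 \<le> 2 * (s * (L * e))" "2 * (s * (L * e)) \<le> of_int l + 1/2"
    using kl unfolding line by (auto simp: cell_def)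
  \<comment> \<open>The integer \<open>i - i' + k\<close> is within 1/2 of \<open>k\<close>, hence
    equal to it: the line is at the centre of a cell again.\<close>
  have i: "i = i'" using xk(1,2) unfolding x by linarith
  have j: "j = j'" using xk(3,4) unfolding y by linarith
  have "E k l = q" using cij cij' c i j E0 by simp
  moreover have "real_of_int k > 0" using x i mult_pos_pos[OF L(1) e] by simp
  then have "k \<ge> 1" by linarith
  moreover have "s * (2 * (L * e)) = 2 * (s * (L * e))" by simp
  then have "of_int l = s * of_int k" unfolding x y using i j by simp
  ultimately show False using q(2)[OF coh E0] by blast
qed

section \<open>Directions with odd numerator and denominator\<close>

locale odd_direction =
  fixes u v :: int
  assumes v: "v > 0" "odd v" and u: "odd u" and cop: "coprime u v"
begin

text \<open>The corners of the grid lie on the lines whose height is a multiple of \<open>1/2\<close>,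
  so the strip below is a maximal one without corners.\<close>

definition height :: "pt \<Rightarrow> real" where "height p = of_int u * fst p - of_int v * snd p"

text \<open>With \<open>m = (u + v) div 2\<close>, a point of the strip on
  \<open>2 * x = k + 1/2\<close> satisfies
  \<open>v * (2 * y + 1/2) = u * k + m - 2 * height\<close>. As \<open>2 * height\<close> is
  strictly between 0 and 1, the row is \<open>(u * k + m - 1) div v\<close> for all lines of the
  strip at once.\<close>

definition crossing :: "int \<Rightarrow> int" where "crossing k = (u * k + ((u + v) div 2 - 1)) div v"

definition strip :: "pt set" where "strip = {p. 0 < height p \<and> height p < 1/2}"

definition dir :: direction where "dir = Slope (real_of_int u / real_of_int v)"

definition period_vec :: pt where "period_vec = (of_int v / 2, of_int u / 2)"

definition period :: real where "period = of_int v / 2 * sqrt (1 + (real_of_int u / real_of_int v)\<^sup>2)"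

definition system :: "(int \<Rightarrow> int \<Rightarrow> square) \<Rightarrow> bool" where
  "system E \<longleftrightarrow> coherent crossing E \<and> (\<forall>k l. free_square (E k l))"

definition cyl :: "(int \<Rightarrow> int \<Rightarrow> square) \<Rightarrow> spt set" where "cyl E = dev E ` strip"

section \<open>The standard strip and its systems of squares\<close>

lemma period_pos: "period > 0"
  unfolding period_def using v by (intro mult_pos_pos) (auto intro!: add_pos_nonneg)

lemma period_vec: "period_vec = period *\<^sub>R unit_vec dir"
proof -
  have "sqrt (1 + (real_of_int u / real_of_int v)\<^sup>2) \<noteq> 0"
    using add_pos_nonneg[of "1::real" "(real_of_int u / real_of_int v)\<^sup>2"] by (simp del: power_divide)
  then show ?thesis using v by (simp add: period_vec_def period_def dir_def del: power_divide)
qed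

lemma dir_transversal: "fst (unit_vec dir) \<noteq> 0" "snd (unit_vec dir) \<noteq> 0"
proof -
  have "fst period_vec \<noteq> 0 \<and> snd period_vec \<noteq> 0" using v u by (auto simp: period_vec_def)
  then show "fst (unit_vec dir) \<noteq> 0" "snd (unit_vec dir) \<noteq> 0" unfolding period_vec by auto
qed

lemma height_linear: "height (p + q) = height p + height q" "height (p - q) = height p - height q"
  "height (r *\<^sub>R p) = r * height p"
  by (simp_all add: height_def algebra_simps)

lemma height_period_vec: "height period_vec = 0"
  by (simp add: height_def period_vec_def)

lemma height_dir: "height (unit_vec dir) = 0"
  using height_period_vec period_pos unfolding period_vec height_linear by simp

lemma strip_flow: "p + t *\<^sub>R unit_vec dir \<in> strip \<longleftrightarrow> p \<in> strip"
  by (simp add: strip_def height_linear height_dir)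

lemma strip_admissible:
  assumes "p \<in> strip" shows "admissible crossing p"
  unfolding admissible_def
proof (intro conjI allI impI)
  define m where "m = (u + v) div 2"
  have m: "2 * m = u + v" using u v by (simp add: m_def)
  have h: "0 < 2 * height p" "2 * height p < 1" using assms by (auto simp: strip_def)
  \<comment> \<open>Since \<open>u - v\<close> is even, \<open>2 * height\<close> is an integer at
    corners, while in the strip it is strictly between 0 and 1.\<close>
  show "\<not> grid_corner p"
  proof
    assume "grid_corner p"
    then obtain k l :: int where kl: "2 * fst p = of_int k + 1/2" "2 * snd p = of_int l + 1/2"
      by (auto simp: grid_corner_def)
    have "2 * height p = of_int u * (2 * fst p) - of_int v * (2 * snd p)" by (simp add: height_def)
    also have "\<dots> = of_int (u * k - v * l) + (of_int u - of_int v) / 2" unfolding kl by (simp add: algebra_simps diff_divide_distrib)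
    also have "real_of_int u - of_int v = of_int (2 * (m - v))" using m by simp
    finally have "2 * height p = of_int (u * k - v * l + (m - v))" by simp
    with h have "0 < real_of_int (u * k - v * l + (m - v))" "real_of_int (u * k - v * l + (m - v)) < 1" by linarith+
    then have "0 < u * k - v * l + (m - v)" "u * k - v * l + (m - v) < 1"
      by (simp_all only: of_int_0_less_iff of_int_less_1_iff)
    then show False by linarith
  qed
  fix k l assume "p \<in> cell k l" "p \<in> cell (k + 1) l"
  then have x: "2 * fst p = of_int k + 1/2" and y: "of_int l - 1/2 \<le> 2 * snd p" "2 * snd p \<le> of_int l + 1/2"
    by (auto simp: cell_def)
  have "2 * height p = of_int u * (2 * fst p) - of_int v * (2 * snd p)" by (simp add: height_def)
  then have "of_int v * (2 * snd p) = of_int u * (of_int k + 1/2) - 2 * height p" unfolding x by linarith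
  then have e: "of_int v * (2 * snd p + 1/2) = of_int (u * k + m) - 2 * height p"
    using arg_cong[OF m, of real_of_int] by (simp add: algebra_simps)
  have "of_int v * real_of_int l \<le> of_int v * (2 * snd p + 1/2)" using v y by (intro mult_left_mono) auto
  then have "real_of_int (v * l) < of_int (u * k + m)" unfolding e using h by simp
  then have 1: "v * l < u * k + m" by (simp only: of_int_less_iff)
  have "of_int v * (2 * snd p + 1/2) \<le> of_int v * real_of_int (l + 1)" using v y by (intro mult_left_mono) auto
  then have "real_of_int (u * k + m - 1) < of_int (v * (l + 1))" unfolding e using h by simp
  then have 2: "u * k + m - 1 < v * (l + 1)" by (simp only: of_int_less_iff)
  have "(u * k + (m - 1)) div v = l"
    by (rule int_div_pos_eq[of _ _ _ "u * k + m - 1 - v * l"]) (use 1 2 in \<open>auto simp: algebra_simps\<close>)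
  then show "l = crossing k" by (simp add: crossing_def m_def)
qed

lemma crossing_period: "crossing (k + v) = crossing k + u"
  unfolding crossing_def by (rule div_period[OF v(1)])

lemma systemD:
  assumes "system E" shows "coherent crossing E" "\<And>k l. free_square (E k l)"
  using assms by (auto simp: system_def)

lemma system_exists:
  assumes "free_square s" obtains E where "system E" "E k l = s"
proof -
  obtain E where "coherent crossing E" "E k l = s" using coherent_exists by blast
  then show thesis using that coherent_free assms by (metis system_def)
qed

lemma system_shift:
  assumes "system E" shows "system (\<lambda>k l. E (k + N * v) (l + N * u))"
proof -
  have "coherent crossing (\<lambda>k l. E (k + N * v) (l + N * u))"
    by (rule coherent_shift[OF systemD(1)[OF assms]]) (rule periodic_multiple, rule crossing_period)
  then show ?thesis using assms by (simp add: system_def)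
qed

lemma system_eqI: "system E \<Longrightarrow> system E' \<Longrightarrow> E k l = E' k l \<Longrightarrow> E = E'"
  by (rule coherent_unique[of crossing]) (auto simp: system_def)

lemma system_period:
  assumes "system E" shows "E (k + N * v) (l + N * u) = E k l \<longleftrightarrow> 6 dvd N"
proof
  assume "E (k + N * v) (l + N * u) = E k l"
  then show "6 dvd N"
    by (rule odd_direction_minimal_period[OF v u cop crossing_def systemD[OF assms]])
next
  assume "6 dvd N"
  then obtain M where "N = 6 * M" by blast
  then show "E (k + N * v) (l + N * u) = E k l"
    using odd_direction_period[OF v u cop crossing_def systemD[OF assms], of k M l] by simp
qed

lemma dev_shift: "dev E (p + of_int N *\<^sub>R period_vec) = dev (\<lambda>k l. E (k + N * v) (l + N * u)) p"
proof -
  have k: "\<lfloor>2 * fst (p + of_int N *\<^sub>R period_vec) + 1/2\<rfloor> = \<lfloor>2 * fst p + 1/2\<rfloor> + N * v"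
  proof -
    have "2 * fst (p + of_int N *\<^sub>R period_vec) + 1/2 = (2 * fst p + 1/2) + of_int (N * v)" by (simp add: period_vec_def)
    then show ?thesis by (metis floor_add_int)
  qed
  have l: "\<lfloor>2 * snd (p + of_int N *\<^sub>R period_vec) + 1/2\<rfloor> = \<lfloor>2 * snd p + 1/2\<rfloor> + N * u"
  proof -
    have "2 * snd (p + of_int N *\<^sub>R period_vec) + 1/2 = (2 * snd p + 1/2) + of_int (N * u)" by (simp add: period_vec_def)
    then show ?thesis by (metis floor_add_int)
  qed
  have "place (k + N * v) (l + N * u) s (p + of_int N *\<^sub>R period_vec) = place k l s p" for k l s
    by (simp add: place_def period_vec_def diff_divide_distrib add_divide_distrib)
  then show ?thesis unfolding dev_def Let_def k l by simp
qed

lemma dev_periodic: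
  assumes "system E" shows "dev E (p + (6 * period) *\<^sub>R unit_vec dir) = dev E p"
proof -
  have "(6 * period) *\<^sub>R unit_vec dir = of_int 6 *\<^sub>R period_vec" by (simp add: period_vec)
  moreover have "(\<lambda>k l. E (k + 6 * v) (l + 6 * u)) = E"
    using system_period[OF assms, of _ 6] by (intro ext) simp
  ultimately show ?thesis using dev_shift[of E p 6] by simp
qed

lemma cyl_trajectory:
  assumes "system E" "z \<in> strip"
  shows "regular_trajectory (1/2) (1/2) dir (\<lambda>t. dev E (z + t *\<^sub>R unit_vec dir))"
  by (rule dev_regular[OF systemD[OF assms(1)]]) (simp add: strip_admissible strip_flow assms(2))

lemma bezout_multiple: "\<exists>k l. u * k - v * l = m"
proof -
  obtain x y where "x * u + y * v = 1" using bezout_int[of u v] cop by auto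
  then have "m * (x * u + y * v) = m" by simp
  then show ?thesis by (intro exI[of _ "m * x"] exI[of _ "- (m * y)"]) (simp add: algebra_simps)
qed

text \<open>Bezout gives a half-lattice vector \<open>q\<close> with
  \<open>2 * height q = m\<close>. Subtracting it brings the band number \<open>m\<close> to the
  standard strip, and the system is chosen to have the given square over the shifted cell.\<close>

lemma local_chart:
  fixes m :: int
  assumes "free_square (c, i, j)"
  shows "\<exists>E q. system E \<and> (\<forall>p \<in> cell i j. of_int m < 2 * height p \<longrightarrow> 2 * height p < of_int m + 1 \<longrightarrow>
    p - q \<in> strip \<and> dev E (p - q) = point_class (c, p))"
proof -
  obtain n1 n2 where n: "u * n1 - v * n2 = m" using bezout_multiple by blast
  define q :: pt where "q = (of_int n1 / 2, of_int n2 / 2)"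
  obtain E where E: "system E" "E (i - n1) (j - n2) = (c, i, j)" using system_exists[OF assms] by blast
  have hq: "2 * height q = of_int m" by (simp add: height_def q_def flip: n)
  have "p - q \<in> strip \<and> dev E (p - q) = point_class (c, p)"
    if p: "p \<in> cell i j" "of_int m < 2 * height p" "2 * height p < of_int m + 1" for p
  proof
    show st: "p - q \<in> strip" using p hq by (simp add: strip_def height_linear)
    have "p - q \<in> cell (i - n1) (j - n2)" using p(1) by (auto simp: cell_def q_def)
    from dev_cell[OF systemD[OF E(1)] strip_admissible[OF st] this]
    have "dev E (p - q) = point_class (place (i - n1) (j - n2) (c, i, j) (p - q))" by (simp add: E(2))
    also have "place (i - n1) (j - n2) (c, i, j) (p - q) = (c, p)" by (simp add: place_def q_def)
    finally show "dev E (p - q) = point_class (c, p)" .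
  qed
  then show ?thesis using E(1) by blast
qed

text \<open>If \<open>2 * height p\<close> were an integer, the line through \<open>p\<close> would
  contain a grid corner; the trajectory follows this line on the torus and would be singular. So
  \<open>p\<close> lies in a chart, and uniqueness identifies the trajectory with the developed
  line.\<close>

lemma regular_is_developed:
  assumes "regular_trajectory (1/2) (1/2) dir \<gamma>"
  shows "\<exists>E z. system E \<and> z \<in> strip \<and> \<gamma> = (\<lambda>t. dev E (z + t *\<^sub>R unit_vec dir))"
proof -
  have sl: "straight_line (1/2) (1/2) dir \<gamma>" using assms by (simp add: regular_trajectory_def)
  have "\<gamma> 0 \<in> surface (1/2) (1/2)" using sl unfolding straight_line_def by blast
  then obtain c p where p: "\<gamma> 0 = point_class (c, p)" "p \<in> half_table" by (auto simp: surface_eq)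
  have nonint: "2 * height p \<noteq> of_int m" for m
  proof
    assume m: "2 * height p = of_int m"
    define r where "r = (u - v) div 2"
    have r: "u - v = 2 * r" using u v by (simp add: r_def)
    obtain k l where kl: "u * k - v * l = m - r" using bezout_multiple by blast
    define q :: pt where "q = (1/4 + of_int k / 2, 1/4 + of_int l / 2)"
    have "2 * height q = of_int (u - v) / 2 + of_int (u * k - v * l)" by (simp add: height_def q_def algebra_simps diff_divide_distrib)
    also have "\<dots> = of_int m" unfolding r kl by simp
    finally have "height (q - p) = 0" using m by (simp add: height_linear)
    define t where "t = (fst q - fst p) / fst (unit_vec dir)"
    have "q - p = t *\<^sub>R unit_vec dir"
    proof -
      have f: "fst (q - p) = fst (t *\<^sub>R unit_vec dir)" using dir_transversal by (simp add: t_def)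
      have "height (q - p) = height (t *\<^sub>R unit_vec dir)" using \<open>height (q - p) = 0\<close> by (simp add: height_linear height_dir)
      then have "snd (q - p) = snd (t *\<^sub>R unit_vec dir)" unfolding height_def f using v by simp
      with f show ?thesis by (simp add: prod_eq_iff)
    qed
    then have q: "p + t *\<^sub>R unit_vec dir = q" by (simp add: algebra_simps)
    have "\<gamma> t \<in> surface (1/2) (1/2)" using sl unfolding straight_line_def by blast
    then obtain y where y: "\<gamma> t = point_class y" by (auto simp: surface_eq)
    have "half_lattice (snd y - q)"
      using straight_line_lattice[OF sl, of "(c, p)" y t] p(1) y self_in_point_class by (simp add: q)
    moreover have "grid_corner q"
      unfolding grid_corner_def q_def by (intro exI[of _ k] exI[of _ l]) simp
    ultimately have "grid_corner (snd y)" using grid_corner_lattice[of q "snd y"] half_lattice_uminus[of "snd y - q"] by simp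
    then have "\<gamma> t \<in> singularities (1/2) (1/2)" using singular_iff[of y "\<gamma> t" y] y self_in_point_class by simp
    then show False using assms by (auto simp: regular_trajectory_def)
  qed
  define m where "m = \<lfloor>2 * height p\<rfloor>"
  have m: "of_int m < 2 * height p" "2 * height p < of_int m + 1"
    using nonint[of m] unfolding m_def by linarith+
  obtain i j where ij: "free_square (c, i, j)" "p \<in> cell i j" using table_in_cell[OF p(2)] by blast
  obtain E q where E: "system E" "p - q \<in> strip" "dev E (p - q) = point_class (c, p)"
    using local_chart[OF ij(1), of m] ij(2) m by blast
  have "\<gamma> = (\<lambda>t. dev E ((p - q) + t *\<^sub>R unit_vec dir))"
    by (rule trajectory_unique[OF assms cyl_trajectory[OF E(1,2)] dir_transversal, of 0]) (simp add: E p)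
  then show ?thesis using E by blast
qed

lemma completely_periodic_dir: "completely_periodic (1/2) (1/2) dir"
  unfolding completely_periodic_def
proof (intro allI impI)
  fix \<gamma> assume "regular_trajectory (1/2) (1/2) dir \<gamma>"
  then obtain E z where E: "system E" "\<gamma> = (\<lambda>t. dev E (z + t *\<^sub>R unit_vec dir))" using regular_is_developed by blast
  have "\<gamma> (t + 6 * period) = \<gamma> t" for t
    using dev_periodic[OF E(1), of "z + t *\<^sub>R unit_vec dir"] by (simp add: E(2) scaleR_add_left add.assoc)
  then show "\<exists>L>0. \<forall>t. \<gamma> (t + L) = \<gamma> t" using period_pos by (intro exI[of _ "6 * period"]) auto
qed

lemma place_inject: "place k l s p = place k l s' p \<Longrightarrow> s = s'"
  by (cases s; cases s') (simp add: place_def)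

lemma place_off_grid:
  assumes "2 * fst p - 1/2 \<notin> \<int>" "2 * snd p - 1/2 \<notin> \<int>"
  shows "point_class (place k l s p) = {place k l s p}"
proof -
  have *: "2 * (x + of_int n / 2) - 1/2 \<in> \<int> \<longleftrightarrow> 2 * x - 1/2 \<in> \<int>" for x :: real and n
  proof -
    have "2 * (x + of_int n / 2) - 1/2 = (2 * x - 1/2) + of_int n" by simp
    then show ?thesis by (metis Ints_add Ints_diff Ints_of_int add_diff_cancel_right')
  qed
  show ?thesis unfolding place_def
    by (rule point_class_single) (use assms in \<open>simp_all only: fst_conv snd_conv * not_False_eq_True\<close>)
qed

text \<open>Equality on the torus together with heights in the same strip makes
  \<open>z' - z\<close> a multiple of the period vector. To compare the squares, the common
  trajectory is followed to a point off the grid, where the class is a singleton and reveals its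
  square.\<close>

lemma dev_eq_dev:
  assumes E: "system E" and E': "system E'" and z: "z \<in> strip" and z': "z' \<in> strip"
    and eq: "dev E z = dev E' z'"
  shows "\<exists>N. z' = z + of_int N *\<^sub>R period_vec \<and> E = (\<lambda>k l. E' (k + N * v) (l + N * u))"
proof -
  obtain x where x: "dev E z = point_class x" "half_lattice (snd x - z)"
    using dev_in_surface[OF systemD[OF E] strip_admissible[OF z]] by blast
  obtain x' where x': "dev E' z' = point_class x'" "half_lattice (snd x' - z')"
    using dev_in_surface[OF systemD[OF E'] strip_admissible[OF z']] by blast
  have "half_lattice (snd x - snd x')" using eq x(1) x'(1) self_in_point_class point_class_lattice by metis
  from half_lattice_diff[OF half_lattice_add[OF this x'(2)] x(2)] have "half_lattice (z - z')" by (simp add: algebra_simps)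
  then have "half_lattice (z' - z)" using half_lattice_uminus by fastforce
  then obtain a b where ab: "2 * (fst z' - fst z) = of_int a" "2 * (snd z' - snd z) = of_int b"
    by (auto simp: half_lattice_def elim!: Ints_cases)
  have "of_int (u * a - v * b) = 2 * (height z' - height z)" by (simp add: height_def algebra_simps flip: ab)
  then have "real_of_int (u * a - v * b) < 1" "real_of_int (u * a - v * b) > - 1" using z z' unfolding strip_def by auto
  then have "u * a = v * b" by linarith
  then have "v dvd u * a" by simp
  then have "v dvd a" using cop by (simp add: coprime_commute coprime_dvd_mult_right_iff)
  then obtain N where N: "a = N * v" by (metis dvdE mult.commute)
  then have "b = N * u" using \<open>u * a = v * b\<close> v by (auto simp: mult.commute)
  with N ab have z'_eq: "z' = z + of_int N *\<^sub>R period_vec"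
    by (auto simp: prod_eq_iff period_vec_def)
  define F where "F = (\<lambda>k l. E' (k + N * v) (l + N * u))"
  have F: "system F" unfolding F_def by (rule system_shift[OF E'])
  have eqF: "dev E z = dev F z" using eq unfolding z'_eq dev_shift F_def .
  have traj: "(\<lambda>t. dev E (z + t *\<^sub>R unit_vec dir)) = (\<lambda>t. dev F (z + t *\<^sub>R unit_vec dir))"
    by (rule trajectory_unique[OF cyl_trajectory[OF E z] cyl_trajectory[OF F z] dir_transversal, of 0]) (simp add: eqF)
  obtain t where t: "2 * (fst z + t * fst (unit_vec dir)) - 1/2 \<notin> \<int>" "2 * (snd z + t * snd (unit_vec dir)) - 1/2 \<notin> \<int>"
    using eventually_happens[OF eventually_conj[OF eventually_off_grid[OF dir_transversal(1), of "fst z"] eventually_off_grid[OF dir_transversal(2), of "snd z"]]]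
    by auto
  define y where "y = z + t *\<^sub>R unit_vec dir"
  have y: "y \<in> strip" using z by (simp add: y_def strip_flow)
  obtain k l where kl: "y \<in> cell k l" using stay_in_cell[of y 0] by auto
  have "dev E y = dev F y" unfolding y_def using fun_cong[OF traj, of t] by simp
  then have "point_class (place k l (E k l) y) = point_class (place k l (F k l) y)"
    using dev_cell[OF systemD[OF E] strip_admissible[OF y] kl] dev_cell[OF systemD[OF F] strip_admissible[OF y] kl] by simp
  moreover have "point_class (place k l s y) = {place k l s y}" for s
    by (rule place_off_grid) (use t in \<open>simp_all add: y_def\<close>)
  ultimately have "{place k l (E k l) y} = {place k l (F k l) y}" by (simp only:)
  then have "E k l = F k l" by (intro place_inject) (rule singleton_inject)
  then have "E = F" by (rule system_eqI[OF E F])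
  then show ?thesis using z'_eq unfolding F_def by blast
qed

lemma cyl_shift: "cyl (\<lambda>k l. E (k + N * v) (l + N * u)) = cyl E"
proof -
  have st: "p + of_int N *\<^sub>R period_vec \<in> strip \<longleftrightarrow> p \<in> strip" for p N
    by (simp add: strip_def height_linear height_period_vec)
  have "dev (\<lambda>k l. E (k + N * v) (l + N * u)) p \<in> cyl E" if "p \<in> strip" for p
    unfolding cyl_def dev_shift[symmetric] using st that by blast
  moreover have "dev E p \<in> cyl (\<lambda>k l. E (k + N * v) (l + N * u))" if "p \<in> strip" for p
  proof -
    have "dev E p = dev E ((p + of_int (- N) *\<^sub>R period_vec) + of_int N *\<^sub>R period_vec)" by simp
    also have "\<dots> = dev (\<lambda>k l. E (k + N * v) (l + N * u)) (p + of_int (- N) *\<^sub>R period_vec)" by (rule dev_shift)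
    finally show ?thesis unfolding cyl_def using st that by blast
  qed
  ultimately show ?thesis by (auto simp: cyl_def)
qed

lemma cyl_overlap:
  assumes "system E" "system E'" "cyl E \<inter> cyl E' \<noteq> {}"
  shows "cyl E = cyl E'" "\<exists>N. E = (\<lambda>k l. E' (k + N * v) (l + N * u))"
proof -
  obtain z z' where "z \<in> strip" "z' \<in> strip" "dev E z = dev E' z'" using assms(3) by (auto simp: cyl_def)
  from dev_eq_dev[OF assms(1,2) this] show "\<exists>N. E = (\<lambda>k l. E' (k + N * v) (l + N * u))" by blast
  then show "cyl E = cyl E'" using cyl_shift by blast
qed

lemma trajectory_simple:
  assumes E: "system E" and z: "z \<in> strip"
  shows "inj_on (\<lambda>t. dev E (z + t *\<^sub>R unit_vec dir)) {0..<6 * period}"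
proof (rule inj_onI)
  fix s t assume st: "s \<in> {0..<6 * period}" "t \<in> {0..<6 * period}"
    and eq: "dev E (z + s *\<^sub>R unit_vec dir) = dev E (z + t *\<^sub>R unit_vec dir)"
  obtain N where N: "z + t *\<^sub>R unit_vec dir = z + s *\<^sub>R unit_vec dir + of_int N *\<^sub>R period_vec"
    "E = (\<lambda>k l. E (k + N * v) (l + N * u))"
    using dev_eq_dev[OF E E _ _ eq] z strip_flow by blast
  have "6 dvd N" using system_period[OF E, of 0 N 0] fun_cong[OF fun_cong[OF N(2), of 0], of 0] by simp
  then obtain M where M: "N = 6 * M" by blast
  have "t *\<^sub>R unit_vec dir = (s + of_int N * period) *\<^sub>R unit_vec dir"
    using N(1) by (simp add: period_vec scaleR_add_left add.assoc)
  moreover have "unit_vec dir \<noteq> 0" using dir_transversal by auto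
  ultimately have t: "t = s + of_int M * (6 * period)" by (simp add: M del: unit_vec.simps)
  have "of_int M * (6 * period) < 1 * (6 * period)" "(- 1) * (6 * period) < of_int M * (6 * period)"
    using st unfolding t by (simp_all only: atLeastLessThan_iff) linarith+
  from this[THEN mult_right_less_imp_less] have "real_of_int M < 1" "- 1 < real_of_int M" using period_pos by simp_all
  then have "M = 0" by linarith
  then show "s = t" by (simp add: t)
qed

end

section \<open>The topology of the surface\<close>

abbreviation (input) half_topology :: "spt topology" where
  "half_topology \<equiv> surface_topology (1/2) (1/2)"

lemma openin_half_topology:
  "openin half_topology U \<longleftrightarrow> U \<subseteq> surface (1/2) (1/2) \<and>
     (\<forall>c. openin (top_of_set half_table) {p \<in> half_table. point_class (c, p) \<in> U})"
proof -
  have "{p. (c, p) \<in> {x \<in> topspace (four_tables (1/2) (1/2)). half_proj x \<in> U}} = {p \<in> half_table. point_class (c, p) \<in> U}" for c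
    by (auto simp: topspace_four_tables half_proj_eq)
  then show ?thesis
    unfolding openin_surface_topology unfolding four_tables_def openin_sum_topology
    by (auto simp: four_tables_def)
qed

lemma chart_continuous:
  assumes "S \<subseteq> half_table"
  shows "continuous_map (top_of_set S) half_topology (\<lambda>p. point_class (c, p))"
proof -
  have "continuous_map (top_of_set half_table) (four_tables (1/2) (1/2)) (\<lambda>p. (c, p))"
    unfolding four_tables_def by (rule continuous_map_component_injection) simp
  then have "continuous_map (top_of_set half_table) half_topology (half_proj \<circ> (\<lambda>p. (c, p)))"
    using quotient_imp_continuous_map[OF quotient_map_proj] by (rule continuous_map_compose)
  then have "continuous_map (top_of_set half_table) half_topology (\<lambda>p. point_class (c, p))"
    by (simp add: o_def half_proj_eq)
  from continuous_map_from_subtopology[OF this, of S] show ?thesis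
    using assms by (simp add: subtopology_subtopology Int_absorb1)
qed

lemma closed_cell: "closed (cell k l)"
proof -
  have "cell k l = {p. of_int k - 1/2 \<le> 2 * fst p} \<inter> {p. 2 * fst p \<le> of_int k + 1/2} \<inter>
    {p. of_int l - 1/2 \<le> 2 * snd p} \<inter> {p. 2 * snd p \<le> of_int l + 1/2}" by (auto simp: cell_def)
  also have "closed \<dots>" by (intro closed_Int closed_Collect_le continuous_intros)
  finally show ?thesis .
qed

lemma finite_near_cells: "finite {(k, l). cell k l \<inter> ball x 1 \<noteq> {}}"
proof (rule finite_subset)
  show "{(k, l). cell k l \<inter> ball x 1 \<noteq> {}} \<subseteq>
    {\<lfloor>2 * fst x\<rfloor> - 4..\<lfloor>2 * fst x\<rfloor> + 4} \<times> {\<lfloor>2 * snd x\<rfloor> - 4..\<lfloor>2 * snd x\<rfloor> + 4}"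
  proof (rule subsetI)
    fix i assume "i \<in> {(k, l). cell k l \<inter> ball x 1 \<noteq> {}}"
    then obtain k l y where i: "i = (k, l)" and y: "y \<in> cell k l" "y \<in> ball x 1" by blast
    have "\<bar>fst x - fst y\<bar> < 1" "\<bar>snd x - snd y\<bar> < 1"
      using y(2) dist_fst_le[of x y] dist_snd_le[of x y] by (auto simp: dist_real_def)
    then show "i \<in> {\<lfloor>2 * fst x\<rfloor> - 4..\<lfloor>2 * fst x\<rfloor> + 4} \<times> {\<lfloor>2 * snd x\<rfloor> - 4..\<lfloor>2 * snd x\<rfloor> + 4}"
      using y(1) unfolding i cell_def mem_Collect_eq fst_conv snd_conv mem_Times_iff atLeastAtMost_iff
      by (intro conjI; linarith)
  qed
qed simp

lemma int_gap:
  fixes w :: real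
  shows "\<exists>\<delta>>0. \<forall>n::int. of_int n \<noteq> w \<longrightarrow> \<delta> \<le> \<bar>w - of_int n\<bar>"
proof (cases "w \<in> \<int>")
  case True
  then obtain m where w: "w = of_int m" by (auto elim: Ints_cases)
  have "1 \<le> \<bar>w - of_int n\<bar>" if "of_int n \<noteq> w" for n
  proof -
    have "1 \<le> \<bar>m - n\<bar>" using that w by auto
    then show ?thesis unfolding w by (simp flip: of_int_diff of_int_abs)
  qed
  then show ?thesis by (intro exI[of _ 1]) auto
next
  case False
  have f: "of_int \<lfloor>w\<rfloor> \<noteq> w" using False by (metis Ints_of_int)
  have d: "w - of_int \<lfloor>w\<rfloor> > 0" "of_int \<lfloor>w\<rfloor> + 1 - w > 0" using f by linarith+
  have "min (w - of_int \<lfloor>w\<rfloor>) (of_int \<lfloor>w\<rfloor> + 1 - w) \<le> \<bar>w - of_int n\<bar>" for n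
  proof (cases "n \<le> \<lfloor>w\<rfloor>")
    case True
    then have "real_of_int n \<le> of_int \<lfloor>w\<rfloor>" by simp
    then show ?thesis using d by linarith
  next
    case False
    then have "real_of_int n \<ge> of_int \<lfloor>w\<rfloor> + 1" by linarith
    then show ?thesis using d by linarith
  qed
  then show ?thesis using d by (intro exI[of _ "min (w - of_int \<lfloor>w\<rfloor>) (of_int \<lfloor>w\<rfloor> + 1 - w)"]) auto
qed

text \<open>Grid lines do not accumulate, so a small disc about \<open>p\<close> meets only cells
  that contain \<open>p\<close>. Thus \<open>p\<close> and a nearby point can be compared in a
  common cell.\<close>

lemma near_points_share_cells:
  "\<exists>\<delta>>0. \<forall>p'. dist p p' < \<delta> \<longrightarrow> (\<forall>i j. p' \<in> cell i j \<longrightarrow> p \<in> cell i j)"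
proof -
  have one: "\<exists>\<delta>>0. \<forall>x'. \<bar>x - x'\<bar> < \<delta> \<longrightarrow> (\<forall>i::int. of_int i - 1/2 \<le> 2 * x' \<and> 2 * x' \<le> of_int i + 1/2 \<longrightarrow>
      of_int i - 1/2 \<le> 2 * x \<and> 2 * x \<le> of_int i + 1/2)" for x :: real
  proof -
    obtain \<delta> where d: "\<delta> > 0" "\<And>n::int. of_int n \<noteq> 2 * x + 1/2 \<Longrightarrow> \<delta> \<le> \<bar>2 * x + 1/2 - of_int n\<bar>"
      using int_gap[of "2 * x + 1/2"] by blast
    have "of_int i - 1/2 \<le> 2 * x \<and> 2 * x \<le> of_int i + 1/2"
      if x': "\<bar>x - x'\<bar> < \<delta> / 2" "of_int i - 1/2 \<le> 2 * x'" "2 * x' \<le> of_int i + 1/2" for x' and i :: int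
    proof (rule ccontr)
      assume "\<not> (of_int i - 1/2 \<le> 2 * x \<and> 2 * x \<le> of_int i + 1/2)"
      then consider "2 * x + 1/2 < of_int i" | "2 * x + 1/2 > of_int (i + 1)" by fastforce
      then show False
      proof cases
        case 1
        then have "\<delta> \<le> \<bar>2 * x + 1/2 - of_int i\<bar>" by (intro d(2)) simp
        then show False using 1 x' by linarith
      next
        case 2
        then have "\<delta> \<le> \<bar>2 * x + 1/2 - of_int (i + 1)\<bar>" by (intro d(2)) simp
        then show False using 2 x' unfolding of_int_add of_int_1 by linarith
      qed
    qed
    then show ?thesis using d(1) by (intro exI[of _ "\<delta> / 2"]) auto
  qed
  obtain d1 where d1: "d1 > 0" "\<And>x' i. \<bar>fst p - x'\<bar> < d1 \<Longrightarrow> of_int i - 1/2 \<le> 2 * x' \<and> 2 * x' \<le> of_int i + 1/2 \<Longrightarrow>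
      of_int i - 1/2 \<le> 2 * fst p \<and> 2 * fst p \<le> of_int i + 1/2" for i :: int using one[of "fst p"] by metis
  obtain d2 where d2: "d2 > 0" "\<And>x' i. \<bar>snd p - x'\<bar> < d2 \<Longrightarrow> of_int i - 1/2 \<le> 2 * x' \<and> 2 * x' \<le> of_int i + 1/2 \<Longrightarrow>
      of_int i - 1/2 \<le> 2 * snd p \<and> 2 * snd p \<le> of_int i + 1/2" for i :: int using one[of "snd p"] by metis
  have "p \<in> cell i j" if p': "dist p p' < min d1 d2" "p' \<in> cell i j" for p' i j
  proof -
    have "\<bar>fst p - fst p'\<bar> < d1" "\<bar>snd p - snd p'\<bar> < d2"
      using p'(1) dist_fst_le[of p p'] dist_snd_le[of p p'] by (auto simp: dist_real_def)
    then show ?thesis using d1(2)[of "fst p'" i] d2(2)[of "snd p'" j] p'(2) by (auto simp: cell_def)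
  qed
  then show ?thesis using d1(1) d2(1) by (intro exI[of _ "min d1 d2"]) auto
qed

section \<open>Deck transformations of the surface\<close>

definition deck_pt :: "bool \<Rightarrow> bool \<Rightarrow> int \<Rightarrow> int \<Rightarrow> copy \<times> pt \<Rightarrow> copy \<times> pt" where
  "deck_pt fx fy A B = (\<lambda>(c, p). (flip fx fy c, p + (of_int (A * sgn_x c), of_int (B * sgn_y c))))"

lemma ex_int_shift: "(\<exists>m :: int. P (x + of_int A - of_int m)) \<longleftrightarrow> (\<exists>m :: int. P (x - of_int m))" for x :: real
proof
  assume "\<exists>m :: int. P (x + of_int A - of_int m)"
  then obtain m where "P (x + of_int A - of_int m)" by blast
  then have "P (x - of_int (m - A))" by (simp add: algebra_simps)
  then show "\<exists>m :: int. P (x - of_int m)" by blast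
next
  assume "\<exists>m :: int. P (x - of_int m)"
  then obtain m where "P (x - of_int m)" by blast
  then have "P (x + of_int A - of_int (m + A))" by (simp add: algebra_simps)
  then show "\<exists>m :: int. P (x + of_int A - of_int m)" by blast
qed

lemma on_side_shift:
  "on_vertical_side (p + (of_int A, of_int B)) = on_vertical_side p"
  "on_horizontal_side (p + (of_int A, of_int B)) = on_horizontal_side p"
  unfolding on_vertical_side_def on_horizontal_side_def fst_add snd_add fst_conv snd_conv
  using ex_int_shift[of "\<lambda>t. \<bar>t\<bar> = 1/4"] ex_int_shift[of "\<lambda>t. \<bar>t\<bar> \<le> 1/4"] by simp_all

lemma table_shift: "p + (of_int A, of_int B) \<in> half_table \<longleftrightarrow> p \<in> half_table"
proof -
  have sub: "p + (of_int A, of_int B) \<in> half_table" if "p \<in> half_table" for p A B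
  proof (rule ccontr)
    assume "p + (of_int A, of_int B) \<notin> half_table"
    then obtain m n where "p + (of_int A, of_int B) \<in> obstacle_interior (1/2) (1/2) (m, n)" by (auto simp: table_def)
    then have "p \<in> obstacle_interior (1/2) (1/2) (m - A, n - B)" by (simp add: obstacle_interior_def mem_Times_iff algebra_simps)
    then show False using that by (auto simp: table_def)
  qed
  have "p + (of_int A, of_int B) + (of_int (- A), of_int (- B)) = p" by (simp add: prod_eq_iff)
  then show ?thesis using sub[of p A B] sub[of "p + (of_int A, of_int B)" "- A" "- B"] by metis
qed

lemma point_class_deck: "point_class (deck_pt fx fy A B x) = deck_pt fx fy A B ` point_class x"
proof -
  obtain c p where x: "x = (c, p)" by (cases x)
  have "deck_pt fx fy A B (flip a b c, reflect a b p) =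
      (flip a b (fst (deck_pt fx fy A B x)), reflect a b (snd (deck_pt fx fy A B x)))" for a b
    by (auto simp: x deck_pt_def reflect_def flip_commute prod_eq_iff)
  moreover have "on_vertical_side (snd (deck_pt fx fy A B x)) = on_vertical_side p"
    "on_horizontal_side (snd (deck_pt fx fy A B x)) = on_horizontal_side p"
    by (simp_all only: x deck_pt_def prod.case snd_conv on_side_shift)
  ultimately have "point_class (deck_pt fx fy A B x) = {deck_pt fx fy A B (flip a b c, reflect a b p) | a b.
      (a \<longrightarrow> on_vertical_side p) \<and> (b \<longrightarrow> on_horizontal_side p)}"
    unfolding point_class_def by (simp only:)
  also have "\<dots> = deck_pt fx fy A B ` point_class x"
  proof -
    have "f ` {h a b | a b. P a b} = {f (h a b) | a b. P a b}" for f :: "copy \<times> pt \<Rightarrow> copy \<times> pt" and h P by blast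
    from this[symmetric] show ?thesis unfolding x point_class_def fst_conv snd_conv .
  qed
  finally show ?thesis .
qed

lemma dev_deck: "dev (\<lambda>k l. deck fx fy A B (E k l)) p = deck_pt fx fy A B ` dev E p"
proof -
  have "place k l (deck fx fy A B s) p = deck_pt fx fy A B (place k l s p)" for k l s
    by (cases s) (simp add: place_def deck_def deck_pt_def algebra_simps add_divide_distrib diff_divide_distrib)
  then show ?thesis by (simp add: dev_def Let_def point_class_deck)
qed

text \<open>If the bit is flipped, the second shift sees the opposite sign and the same number
  cancels; otherwise the number must be negated.\<close>

lemma deck_inverse: "\<exists>A' B'. \<forall>x. deck_pt fx fy A' B' (deck_pt fx fy A B x) = x"
  by (rule exI[of _ "if fx then A else - A"], rule exI[of _ "if fy then B else - B"])
    (auto simp: deck_pt_def flip_flip prod_eq_iff)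

text \<open>Each copy is translated as a whole, so legs stay straight, in one copy, and of the same
  length.\<close>

lemma polygonal_path_deck:
  assumes "polygonal_path (1/2) (1/2) S x y l"
  shows "polygonal_path (1/2) (1/2) ((`) (deck_pt fx fy A B) ` S) (deck_pt fx fy A B ` x) (deck_pt fx fy A B ` y) l"
  using assms
proof (induction rule: polygonal_path.induct)
  case refl
  then show ?case by (intro polygonal_path.refl) blast
next
  case (leg y l c p q)
  define w :: pt where "w = (of_int (A * sgn_x c), of_int (B * sgn_y c))"
  have g: "deck_pt fx fy A B (c, r) = (flip fx fy c, r + w)" for r by (simp add: deck_pt_def w_def)
  have seg: "closed_segment (p + w) (q + w) = (\<lambda>r. r + w) ` closed_segment p q"
    using closed_segment_translation[of w p q] by (simp add: add.commute)
  have "polygonal_path (1/2) (1/2) ((`) (deck_pt fx fy A B) ` S) (deck_pt fx fy A B ` x)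
      (half_proj (flip fx fy c, q + w)) (l + dist (p + w) (q + w))"
  proof (rule polygonal_path.leg[OF leg.IH])
    show "(flip fx fy c, p + w) \<in> deck_pt fx fy A B ` y" using leg.hyps(2) g by (metis image_eqI)
    show "closed_segment (p + w) (q + w) \<subseteq> half_table"
    proof -
      have "r + w \<in> half_table" if "r \<in> closed_segment p q" for r
        using subsetD[OF leg.hyps(3) that] unfolding w_def by (simp only: table_shift)
      then show ?thesis unfolding seg by (rule image_subsetI)
    qed
    have "half_proj (flip fx fy c, r + w) = deck_pt fx fy A B ` half_proj (c, r)" for r
      unfolding half_proj_eq g[symmetric] by (rule point_class_deck)
    then show "half_proj ` ({flip fx fy c} \<times> closed_segment (p + w) (q + w)) \<subseteq> (`) (deck_pt fx fy A B) ` S"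
      unfolding seg using leg.hyps(4) by (auto simp: image_subset_iff)
  qed
  moreover have "half_proj (flip fx fy c, q + w) = deck_pt fx fy A B ` half_proj (c, q)"
    unfolding half_proj_eq g[symmetric] by (rule point_class_deck)
  moreover have "dist (p + w) (q + w) = dist p q" by simp
  ultimately show ?case by simp
qed

lemma isometric_deck: "isometric (1/2) (1/2) S ((`) (deck_pt fx fy A B) ` S)"
proof -
  let ?g = "deck_pt fx fy A B"
  obtain A' B' where inv: "\<And>x. deck_pt fx fy A' B' (?g x) = x" using deck_inverse by blast
  let ?h = "deck_pt fx fy A' B'"
  have inv_img: "?h ` ?g ` K = K" for K by (simp add: image_image inv)
  have "inj_on ((`) ?g) S" by (rule inj_on_inverseI[of _ "(`) ?h"]) (rule inv_img)
  moreover have "intrinsic_dist (1/2) (1/2) ((`) ?g ` S) (?g ` x) (?g ` y) = intrinsic_dist (1/2) (1/2) S x y" for x y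
  proof -
    have "polygonal_path (1/2) (1/2) S x y l" if "polygonal_path (1/2) (1/2) ((`) ?g ` S) (?g ` x) (?g ` y) l" for l
    proof -
      have "(`) ?h ` (`) ?g ` S = S" by (simp add: image_image inv)
      with polygonal_path_deck[OF that, of fx fy A' B'] show ?thesis by (simp only: inv_img)
    qed
    then have "polygonal_path (1/2) (1/2) ((`) ?g ` S) (?g ` x) (?g ` y) = polygonal_path (1/2) (1/2) S x y"
      by (intro ext iffI) (auto intro: polygonal_path_deck)
    then show ?thesis unfolding intrinsic_dist_def by simp
  qed
  ultimately show ?thesis unfolding isometric_def
    by (intro exI[of _ "(`) ?g"]) (simp add: bij_betw_def)
qed

context odd_direction
begin

section \<open>Cylinders\<close>

lemma convex_strip: "convex strip"
proof -
  have "strip = {p. (of_int u, - of_int v) \<bullet> p > 0} \<inter> {p. (of_int u, - of_int v) \<bullet> p < 1/2}"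
    by (auto simp: strip_def height_def inner_prod_def)
  then show ?thesis by (simp only: convex_Int convex_halfspace_gt convex_halfspace_lt)
qed

lemma strip_nonempty: "strip \<noteq> {}"
proof -
  have "(0, - 1 / (4 * of_int v)) \<in> strip" using v by (simp add: strip_def height_def)
  then show ?thesis by blast
qed

text \<open>On each closed cell \<open>dev E\<close> is a translation followed by the projection.
  The cells are locally finite, and \<open>dev_cell\<close> gives agreement on overlaps, so the
  pieces can be pasted.\<close>

lemma dev_continuous:
  assumes "system E"
  shows "continuous_map (top_of_set strip) half_topology (dev E)"
proof (rule pasting_lemma_locally_finite[where I = UNIV and T = "\<lambda>(k, l). strip \<inter> cell k l"
      and f = "\<lambda>(k, l) p. point_class (place k l (E k l) p)"])
  fix x :: pt assume x: "x \<in> topspace (top_of_set strip)"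
  have "{i \<in> UNIV. (case i of (k, l) \<Rightarrow> strip \<inter> cell k l) \<inter> (strip \<inter> ball x 1) \<noteq> {}} \<subseteq> {(k, l). cell k l \<inter> ball x 1 \<noteq> {}}"
    by auto
  then have "finite {i \<in> UNIV. (case i of (k, l) \<Rightarrow> strip \<inter> cell k l) \<inter> (strip \<inter> ball x 1) \<noteq> {}}"
    using finite_near_cells finite_subset by blast
  then show "\<exists>V. openin (top_of_set strip) V \<and> x \<in> V \<and>
      finite {i \<in> UNIV. (case i of (k, l) \<Rightarrow> strip \<inter> cell k l) \<inter> V \<noteq> {}}"
    using x by (intro exI[of _ "strip \<inter> ball x 1"]) (auto intro: openin_open_Int)
  obtain k l where "x \<in> cell k l" using stay_in_cell[of x 0] by auto
  then show "\<exists>j. j \<in> UNIV \<and> x \<in> (case j of (k, l) \<Rightarrow> strip \<inter> cell k l) \<and>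
      dev E x = (case j of (k, l) \<Rightarrow> \<lambda>p. point_class (place k l (E k l) p)) x"
    using x dev_cell[OF systemD[OF assms] strip_admissible] by (intro exI[of _ "(k, l)"]) auto
next
  fix i :: "int \<times> int"
  obtain k l where i: "i = (k, l)" by (cases i)
  show "closedin (top_of_set strip) (case i of (k, l) \<Rightarrow> strip \<inter> cell k l)"
    unfolding i prod.case by (rule closedin_closed_Int[OF closed_cell])
  define s where "s = E k l"
  define w :: pt where "w = (of_int (fst (snd s) - k) / 2, of_int (snd (snd s) - l) / 2)"
  have pl: "place k l s p = (fst s, p + w)" for p by (simp add: place_def w_def prod_eq_iff)
  have free: "free_square (fst s, fst (snd s), snd (snd s))" using systemD(2)[OF assms, of k l] by (simp add: s_def)
  have "continuous_map (top_of_set (strip \<inter> cell k l)) (top_of_set ((\<lambda>p. p + w) ` (strip \<inter> cell k l))) (\<lambda>p. p + w)"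
    by (auto intro!: continuous_intros)
  moreover have "(\<lambda>p. p + w) ` (strip \<inter> cell k l) \<subseteq> half_table"
  proof (rule image_subsetI)
    fix p assume "p \<in> strip \<inter> cell k l"
    then have "p \<in> cell k l" by blast
    from place_in_cell[OF this, of s] have "p + w \<in> cell (fst (snd s)) (snd (snd s))" unfolding pl by simp
    then show "p + w \<in> half_table" by (rule cell_subset_table[OF free])
  qed
  ultimately have "continuous_map (top_of_set (strip \<inter> cell k l)) half_topology ((\<lambda>p. point_class (fst s, p)) \<circ> (\<lambda>p. p + w))"
    using chart_continuous continuous_map_compose by blast
  then show "continuous_map (subtopology (top_of_set strip) (case i of (k, l) \<Rightarrow> strip \<inter> cell k l)) half_topology
      (case i of (k, l) \<Rightarrow> \<lambda>p. point_class (place k l (E k l) p))"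
    unfolding i prod.case by (simp add: subtopology_subtopology o_def pl flip: s_def)
next
  fix i j x assume "x \<in> topspace (top_of_set strip) \<inter> (case i of (k, l) \<Rightarrow> strip \<inter> cell k l) \<inter> (case j of (k, l) \<Rightarrow> strip \<inter> cell k l)"
  then show "(case i of (k, l) \<Rightarrow> \<lambda>p. point_class (place k l (E k l) p)) x = (case j of (k, l) \<Rightarrow> \<lambda>p. point_class (place k l (E k l) p)) x"
    using dev_cell[OF systemD[OF assms] strip_admissible, of x "fst i" "snd i"]
      dev_cell[OF systemD[OF assms] strip_admissible, of x "fst j" "snd j"] by (simp add: split_beta)
qed

lemma cyl_subset_surface:
  assumes "system E" shows "cyl E \<subseteq> surface (1/2) (1/2)"
  using continuous_map_image_subset_topspace[OF dev_continuous[OF assms]]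
  by (auto simp: cyl_def topspace_surface_topology)

lemma cyl_point:
  assumes "system E" "point_class (c, p) \<in> cyl E"
  shows "\<exists>m :: int. of_int m < 2 * height p \<and> 2 * height p < of_int m + 1"
proof -
  obtain z where z: "z \<in> strip" "point_class (c, p) = dev E z" using assms(2) by (auto simp: cyl_def)
  obtain x where x: "dev E z = point_class x" "half_lattice (snd x - z)"
    using dev_in_surface[OF systemD[OF assms(1)] strip_admissible[OF z(1)]] by blast
  have "half_lattice (p - snd x)" using z(2) x(1) self_in_point_class[of "(c, p)"] point_class_lattice[of "(c, p)" x] by simp
  from half_lattice_add[OF this x(2)] have "half_lattice (p - z)" by simp
  then obtain a b where ab: "2 * (fst p - fst z) = of_int a" "2 * (snd p - snd z) = of_int b"
    by (auto simp: half_lattice_def elim!: Ints_cases)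
  have "of_int (u * a - v * b) = 2 * (height p - height z)" by (simp add: height_def algebra_simps flip: ab)
  then show ?thesis using z(1) unfolding strip_def by (intro exI[of _ "u * a - v * b"]) auto
qed

text \<open>A cell and a band have a common chart, whose cylinder contains both points; it meets
  \<open>cyl E\<close> and therefore equals it.\<close>

lemma cyl_local:
  assumes E: "system E" and p: "point_class (c, p) \<in> cyl E" "p \<in> cell i j" "of_int m < 2 * height p" "2 * height p < of_int m + 1"
    and p': "p' \<in> cell i j" "of_int m < 2 * height p'" "2 * height p' < of_int m + 1"
    and free: "free_square (c, i, j)"
  shows "point_class (c, p') \<in> cyl E"
proof -
  obtain E' q where E': "system E'" "\<And>p. p \<in> cell i j \<Longrightarrow> of_int m < 2 * height p \<Longrightarrow> 2 * height p < of_int m + 1 \<Longrightarrow>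
    p - q \<in> strip \<and> dev E' (p - q) = point_class (c, p)"
    using local_chart[OF free, of m] by blast
  have "point_class (c, p) \<in> cyl E'" "point_class (c, p') \<in> cyl E'"
    unfolding cyl_def using E'(2) p p' by (metis image_eqI)+
  then show ?thesis using cyl_overlap(1)[OF E E'(1)] p(1) by blast
qed

lemma continuous_height: "continuous_on UNIV height"
  unfolding height_def by (intro continuous_intros)

lemma cyl_open:
  assumes E: "system E"
  shows "openin half_topology (cyl E)"
  unfolding openin_half_topology
proof (intro conjI allI cyl_subset_surface E)
  fix c
  show "openin (top_of_set half_table) {p \<in> half_table. point_class (c, p) \<in> cyl E}"
    unfolding openin_contains_ball
  proof (intro conjI ballI)
    fix p assume p: "p \<in> {p \<in> half_table. point_class (c, p) \<in> cyl E}"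
    then obtain m :: int where m: "of_int m < 2 * height p" "2 * height p < of_int m + 1" using cyl_point[OF E] by blast
    have "open {q. of_int m < 2 * height q \<and> 2 * height q < of_int m + 1}"
      unfolding Collect_conj_eq by (intro open_Int open_Collect_less continuous_intros continuous_height)
    then obtain e1 where e1: "e1 > 0" "\<And>q. q \<in> ball p e1 \<Longrightarrow> of_int m < 2 * height q \<and> 2 * height q < of_int m + 1"
      using m by (metis (mono_tags, lifting) mem_Collect_eq open_contains_ball subsetD)
    obtain e2 where e2: "e2 > 0" "\<And>p' i j. dist p p' < e2 \<Longrightarrow> p' \<in> cell i j \<Longrightarrow> p \<in> cell i j"
      using near_points_share_cells[of p] by blast
    have "point_class (c, p') \<in> cyl E" if p': "p' \<in> half_table" "p' \<in> ball p (min e1 e2)" for p'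
    proof -
      obtain i j where ij: "free_square (c, i, j)" "p' \<in> cell i j" using table_in_cell[OF p'(1)] by blast
      show ?thesis
        by (rule cyl_local[OF E _ e2(2)[OF _ ij(2)] m ij(2) _ _ ij(1)]) (use p p' e1 in auto)
    qed
    then show "\<exists>e>0. ball p e \<inter> half_table \<subseteq> {p \<in> half_table. point_class (c, p) \<in> cyl E}"
      using e1(1) e2(1) by (intro exI[of _ "min e1 e2"]) auto
  qed auto
qed

lemma cyl_connected:
  assumes "system E" shows "connectedin half_topology (cyl E)"
proof -
  have "connectedin euclidean strip" using convex_connected[OF convex_strip] by simp
  then have "connectedin (top_of_set strip) strip" by (rule connectedin_absolute[THEN iffD2])
  then show ?thesis unfolding cyl_def by (rule connectedin_continuous_map_image[OF dev_continuous[OF assms]])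
qed

text \<open>The strip is convex, so the straight-line homotopy between the starting points stays in
  it, and every intermediate loop closes after six periods.\<close>

lemma loops_homotopic:
  assumes E: "system E" and z: "z \<in> strip" "z' \<in> strip"
  shows "freely_homotopic (1/2) (1/2) (\<lambda>t. dev E (z + (6 * period * t) *\<^sub>R unit_vec dir))
    (\<lambda>t. dev E (z' + (6 * period * t) *\<^sub>R unit_vec dir))"
proof -
  define f where "f x = ((1 - fst x) *\<^sub>R z + fst x *\<^sub>R z') + (6 * period * snd x) *\<^sub>R unit_vec dir" for x :: "real \<times> real"
  have cont: "continuous_on S f" for S unfolding f_def by (intro continuous_intros)
  have seg: "(1 - t) *\<^sub>R z + t *\<^sub>R z' \<in> strip" if "t \<in> {0..1}" for t
    using convexD_alt[OF convex_strip z, of t] that by simp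
  have "continuous_map (top_of_set ({0..1} \<times> {0..1})) (top_of_set strip) f"
    using cont seg by (auto simp: f_def strip_flow image_subset_iff)
  from continuous_map_compose[OF this dev_continuous[OF E]]
  have "continuous_map (prod_topology (top_of_set {0..1}) (top_of_set {0..1})) half_topology (dev E \<circ> f)"
    by simp
  moreover have "(dev E \<circ> f) (t, 1) = (dev E \<circ> f) (t, 0)" for t
    using dev_periodic[OF E] by (simp add: f_def)
  ultimately show ?thesis unfolding freely_homotopic_def homotopic_with_def
    by (intro exI[of _ "dev E \<circ> f"]) (auto simp: f_def)
qed

lemma cyl_geodesic_union:
  assumes E: "system E"
  shows "connected_geodesic_union (1/2) (1/2) dir (cyl E)"
proof -
  define g where "g z = (\<lambda>t. dev E (z + (6 * period * t) *\<^sub>R unit_vec dir))" for z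
  have "g z \<in> geodesic_loops (1/2) (1/2) dir" if z: "z \<in> strip" for z
    unfolding geodesic_loops_def mem_Collect_eq
  proof (intro exI[of _ "\<lambda>t. dev E (z + t *\<^sub>R unit_vec dir)"] exI[of _ "6 * period"] conjI allI)
    show "dev E (z + (t + 6 * period) *\<^sub>R unit_vec dir) = dev E (z + t *\<^sub>R unit_vec dir)" for t
      using dev_periodic[OF E, of "z + t *\<^sub>R unit_vec dir"] by (simp only: scaleR_add_left add.assoc)
  qed (use period_pos cyl_trajectory[OF E z] trajectory_simple[OF E z] in \<open>simp_all add: g_def\<close>)
  moreover have "cyl E = (\<Union>h\<in>g ` strip. h ` {0..1})"
  proof
    have "dev E z = g z 0" for z by (simp add: g_def)
    then show "cyl E \<subseteq> (\<Union>h\<in>g ` strip. h ` {0..1})" unfolding cyl_def by fastforce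
    show "(\<Union>h\<in>g ` strip. h ` {0..1}) \<subseteq> cyl E" by (auto simp: g_def cyl_def strip_flow)
  qed
  ultimately show ?thesis unfolding connected_geodesic_union_def
    using loops_homotopic[OF E] cyl_connected[OF E] strip_nonempty
    by (intro exI[of _ "g ` strip"]) (auto simp: g_def)
qed

text \<open>Every regular trajectory lies in some \<open>cyl E'\<close>, and distinct ones are
  disjoint and open. A connected union of geodesics that contains \<open>cyl E\<close> therefore
  cannot extend beyond it.\<close>

lemma cyl_cylinder:
  assumes E: "system E"
  shows "cylinder (1/2) (1/2) dir (cyl E)"
  unfolding cylinder_def
proof (intro conjI allI impI cyl_geodesic_union E)
  fix C' assume C': "connected_geodesic_union (1/2) (1/2) dir C' \<and> cyl E \<subseteq> C'"
  then obtain G where G: "G \<subseteq> geodesic_loops (1/2) (1/2) dir" "C' = (\<Union>g\<in>G. g ` {0..1})"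
    and conn: "connectedin half_topology C'" by (auto simp: connected_geodesic_union_def)
  define W where "W = \<Union>{cyl E' | E'. system E' \<and> cyl E' \<noteq> cyl E}"
  have open_W: "openin half_topology W" unfolding W_def by (rule openin_Union) (auto simp: cyl_open)
  have "x \<in> cyl E \<union> W" if x: "x \<in> C'" for x
  proof -
    obtain \<gamma> s where g: "regular_trajectory (1/2) (1/2) dir \<gamma>" "x = \<gamma> s"
    proof -
      from x G obtain g t where "g \<in> geodesic_loops (1/2) (1/2) dir" "x = g t" by blast
      then show thesis using that unfolding geodesic_loops_def by blast
    qed
    obtain E' z where E': "system E'" "z \<in> strip" "\<gamma> = (\<lambda>t. dev E' (z + t *\<^sub>R unit_vec dir))"
      using regular_is_developed[OF g(1)] by blast
    then have "x \<in> cyl E'" using g(2) by (simp add: cyl_def strip_flow)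
    then show ?thesis using E'(1) by (auto simp: W_def)
  qed
  then have cover: "C' \<subseteq> cyl E \<union> W" by blast
  have disj: "cyl E \<inter> W = {}" using cyl_overlap(1)[OF E] by (fastforce simp: W_def)
  have "cyl E \<inter> C' \<noteq> {}" using C' strip_nonempty by (auto simp: cyl_def)
  then have "W \<inter> C' = {}" using conn cover disj cyl_open[OF E] open_W unfolding connectedin by blast
  then show "C' = cyl E" using cover C' by blast
qed

text \<open>A shift by periods adjusts the type of the square at the origin without changing the
  cylinder; a deck transformation then carries one system to the other.\<close>

lemma cyl_isometric:
  assumes E: "system E" and E': "system E'"
  shows "isometric (1/2) (1/2) (cyl E) (cyl E')"
proof -
  obtain N where N: "sq_type (E (N * v) (N * u)) = sq_type (E' 0 0)"
    using odd_direction_all_types[OF v u cop crossing_def systemD[OF E]] by blast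
  obtain fx fy A B where D: "deck fx fy A B (E (N * v) (N * u)) = E' 0 0"
    using deck_transitive[OF systemD(2)[OF E] systemD(2)[OF E'] N] by blast
  define F where "F = (\<lambda>k l. E (k + N * v) (l + N * u))"
  have F: "system F" unfolding F_def by (rule system_shift[OF E])
  have "system (\<lambda>k l. deck fx fy A B (F k l))"
    using F coherent_map[of crossing F "deck fx fy A B"] by (simp add: system_def deck_right deck_up)
  from system_eqI[OF this E', of 0 0] D have "(\<lambda>k l. deck fx fy A B (F k l)) = E'" by (simp add: F_def)
  then have "cyl E' = cyl (\<lambda>k l. deck fx fy A B (F k l))" by simp
  also have "\<dots> = (`) (deck_pt fx fy A B) ` cyl F" by (simp add: cyl_def dev_deck image_image)
  also have "cyl F = cyl E" unfolding F_def by (rule cyl_shift)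
  finally show ?thesis using isometric_deck[of "cyl E" fx fy A B] by simp
qed

text \<open>Translating one system by deck transformations gives infinitely many systems. Those with
  the same cylinder differ by period shifts, of which only six are distinct, so finitely many
  cylinders would contradict the pigeonhole principle.\<close>

lemma infinitely_many_cyls: "infinite {cyl E | E. system E}"
proof
  assume fin: "finite {cyl E | E. system E}"
  obtain E0 where E0: "system E0" "E0 0 0 = (Copy_I, 1, 1)"
    using system_exists[of "(Copy_I, 1, 1)" 0 0] by (auto simp: free_square_def)
  define F where "F n = (\<lambda>k l. deck False False (int n) 0 (E0 k l))" for n :: nat
  have F: "system (F n)" for n
    using E0(1) coherent_map[of crossing E0 "deck False False (int n) 0"] by (simp add: F_def system_def deck_right deck_up)
  have "range (\<lambda>n. cyl (F n)) \<subseteq> {cyl E | E. system E}" using F by blast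
  then have "finite (range (\<lambda>n. cyl (F n)))" using fin finite_subset by blast
  then obtain n0 where n0: "infinite {n \<in> UNIV. cyl (F n) = cyl (F n0)}"
    using pigeonhole_infinite[of "UNIV :: nat set" "\<lambda>n. cyl (F n)"] by auto
  have "F n 0 0 \<in> (\<lambda>N. F n0 (N * v) (N * u)) ` {0..5}" if "cyl (F n) = cyl (F n0)" for n
  proof -
    have "cyl (F n) \<inter> cyl (F n0) \<noteq> {}" using that strip_nonempty by (simp add: cyl_def)
    then obtain N where "F n = (\<lambda>k l. F n0 (k + N * v) (l + N * u))" using cyl_overlap(2)[OF F F] by blast
    then have "F n 0 0 = F n0 (N * v) (N * u)" by simp
    also have "\<dots> = F n0 ((N mod 6) * v + (6 * (N div 6)) * v) ((N mod 6) * u + (6 * (N div 6)) * u)"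
      by (simp add: flip: distrib_right)
    also have "\<dots> = F n0 ((N mod 6) * v) ((N mod 6) * u)" using system_period[OF F] by simp
    finally show ?thesis by (intro image_eqI[of _ _ "N mod 6"]) (auto simp: pos_mod_bound less_imp_le)
  qed
  then have "(\<lambda>n. F n 0 0) ` {n \<in> UNIV. cyl (F n) = cyl (F n0)} \<subseteq> (\<lambda>N. F n0 (N * v) (N * u)) ` {0..5}" by blast
  then have "finite ((\<lambda>n. F n 0 0) ` {n \<in> UNIV. cyl (F n) = cyl (F n0)})" by (rule finite_subset) simp
  moreover have "inj (\<lambda>n. F n 0 0)" by (auto simp: inj_def F_def E0(2) deck_def sgn_x_def xbit_def)
  ultimately show False using n0 finite_imageD inj_on_subset by blast
qed

lemma closures_cover:
  assumes x: "x \<in> surface (1/2) (1/2)"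
  shows "\<exists>E. system E \<and> x \<in> half_topology closure_of cyl E"
proof -
  obtain c p where p: "x = point_class (c, p)" "p \<in> half_table" using x by (auto simp: surface_eq)
  obtain i j where ij: "free_square (c, i, j)" "p \<in> cell i j" using table_in_cell[OF p(2)] by blast
  \<comment> \<open>Two points of the cell at different heights: at least one of them differs in
    height from \<open>p\<close>.\<close>
  have "height (of_int i / 2 + 1/4, of_int j / 2) \<noteq> height (of_int i / 2, of_int j / 2)"
    using u by (auto simp: height_def)
  moreover have "(of_int i / 2 + 1/4, of_int j / 2) \<in> cell i j" "(of_int i / 2, of_int j / 2) \<in> cell i j"
    by (auto simp: cell_def)
  ultimately obtain r where r: "r \<in> cell i j" "height r \<noteq> height p" by metis
  define f where "f s = p + s *\<^sub>R (r - p)" for s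
  define e where "e = 2 * (height r - height p)"
  have hf: "2 * height (f s) = 2 * height p + s * e" for s by (simp add: f_def height_linear e_def algebra_simps)
  have e: "e \<noteq> 0" using r(2) by (simp add: e_def)
  \<comment> \<open>The band that the segment from \<open>p\<close> towards \<open>r\<close> enters,
    also when \<open>p\<close> itself lies on the boundary between two bands.\<close>
  define m where "m = (if e > 0 then \<lfloor>2 * height p\<rfloor> else \<lceil>2 * height p\<rceil> - 1)"
  define y where "y = 2 * height p - of_int m - 1/2"
  have "\<bar>y\<bar> < 1/2 \<or> (\<bar>y\<bar> = 1/2 \<and> y * e < 0)"
  proof (cases "e > 0")
    case True
    then have "of_int m \<le> 2 * height p" "2 * height p < of_int m + 1" unfolding m_def by (simp_all, linarith?)
    then show ?thesis using True unfolding y_def by (cases "2 * height p = of_int m") (auto simp: abs_if)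
  next
    case False
    then have "e < 0" using e by simp
    moreover have "of_int m < 2 * height p" "2 * height p \<le> of_int m + 1" using False unfolding m_def by (simp_all, linarith?)
    ultimately show ?thesis unfolding y_def by (cases "2 * height p = of_int m + 1") (auto simp: abs_if)
  qed
  note ev = eventually_abs_less[OF this]
  have good: "of_int m < 2 * height (f s) \<and> 2 * height (f s) < of_int m + 1" if "\<bar>y + s * e\<bar> < 1/2" for s
    using that unfolding hf y_def by linarith
  have fcell: "f s \<in> cell i j" if "0 < s" "s < 1" for s
  proof -
    have "convex (cell i j)"
    proof -
      have "cell i j = cbox ((of_int i - 1/2) / 2, (of_int j - 1/2) / 2) ((of_int i + 1/2) / 2, (of_int j + 1/2) / 2)"
        by (auto simp: cell_def cbox_Pair_eq mem_Times_iff)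
      then show ?thesis by (simp only: convex_box)
    qed
    from convexD_alt[OF this ij(2) r(1), of s] that show ?thesis by (simp add: f_def algebra_simps)
  qed
  obtain E q where E: "system E" "\<And>p. p \<in> cell i j \<Longrightarrow> of_int m < 2 * height p \<Longrightarrow> 2 * height p < of_int m + 1 \<Longrightarrow>
    p - q \<in> strip \<and> dev E (p - q) = point_class (c, p)"
    using local_chart[OF ij(1), of m] by blast
  have "\<exists>y. y \<in> cyl E \<and> y \<in> T" if T: "x \<in> T" "openin half_topology T" for T
  proof -
    have "openin (top_of_set half_table) {p \<in> half_table. point_class (c, p) \<in> T}" using T(2) openin_half_topology by blast
    then obtain \<epsilon> where eps: "\<epsilon> > 0" "ball p \<epsilon> \<inter> half_table \<subseteq> {p \<in> half_table. point_class (c, p) \<in> T}"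
      using p T(1) unfolding openin_contains_ball by blast
    have "(f \<longlongrightarrow> p + 0 *\<^sub>R (r - p)) (at_right 0)" unfolding f_def by (intro tendsto_intros)
    then have "\<forall>\<^sub>F s in at_right 0. dist (f s) p < \<epsilon>" using eps(1) by (auto dest: tendstoD)
    moreover have "\<forall>\<^sub>F s in at_right (0::real). 0 < s \<and> s < 1"
      unfolding eventually_at_right_field by (intro exI[of _ 1]) auto
    ultimately have "\<forall>\<^sub>F s in at_right 0. dist (f s) p < \<epsilon> \<and> 0 < s \<and> s < 1 \<and> \<bar>y + s * e\<bar> < 1/2"
      using ev by eventually_elim blast
    then obtain s where s: "dist (f s) p < \<epsilon>" "0 < s" "s < 1" "\<bar>y + s * e\<bar> < 1/2"
      using eventually_happens by fastforce
    have c: "f s \<in> cell i j" by (rule fcell[OF s(2,3)])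
    have "point_class (c, f s) \<in> cyl E" unfolding cyl_def using E(2)[OF c] good[OF s(4)] by (metis image_eqI)
    moreover have "f s \<in> ball p \<epsilon> \<inter> half_table" using s(1) cell_subset_table[OF ij(1) c] by (simp add: dist_commute)
    then have "point_class (c, f s) \<in> T" using eps(2) by blast
    ultimately show ?thesis by blast
  qed
  then have "x \<in> half_topology closure_of cyl E"
    using x by (auto simp: in_closure_of topspace_surface_topology)
  then show ?thesis using E(1) by blast
qed

lemma strongly_parabolic_dir: "strongly_parabolic (1/2) (1/2) dir"
  unfolding strongly_parabolic_def
proof (intro conjI completely_periodic_dir exI[of _ "{cyl E | E. system E}"] infinitely_many_cyls)
  show "\<forall>C\<in>{cyl E | E. system E}. cylinder (1/2) (1/2) dir C" using cyl_cylinder by blast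
  show "disjoint {cyl E | E. system E}" using cyl_overlap(1) by (fastforce simp: disjoint_def)
  show "(\<Union>C\<in>{cyl E | E. system E}. half_topology closure_of C) = surface (1/2) (1/2)"
    using closures_cover closure_of_subset_topspace[of half_topology] by (fastforce simp: topspace_surface_topology)
  show "\<forall>C\<in>{cyl E | E. system E}. \<forall>C'\<in>{cyl E | E. system E}. isometric (1/2) (1/2) C C'"
    using cyl_isometric by blast
qed

end

lemma odd_slope_strongly_parabolic:
  assumes "odd_slope s" shows "strongly_parabolic (1/2) (1/2) (Slope s)"
proof -
  obtain a b where ab: "odd a" "odd b" "s = real_of_int a / real_of_int b" using assms by (auto simp: odd_slope_def)
  have b0: "b \<noteq> 0" using ab(2) by auto
  obtain u0 v0 where uv0: "a = u0 * gcd a b" "b = v0 * gcd a b" "coprime u0 v0"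
    using gcd_coprime_exists[of a b] b0 by auto
  define u where "u = sgn b * u0"
  define v where "v = sgn b * v0"
  have "v * gcd a b = \<bar>b\<bar>" using uv0(2) by (metis abs_sgn mult.assoc mult.commute v_def)
  then have "v > 0" using b0 by (metis abs_of_nonneg gcd_ge_0_int mult_less_0_iff not_le zero_less_abs_iff zero_less_mult_iff)
  moreover have "odd u0" "odd v0" using ab(1,2) uv0(1,2) by (metis even_mult_iff)+
  then have "odd u" "odd v" using b0 by (auto simp: u_def v_def sgn_if)
  moreover have "coprime u v" using uv0(3) b0 by (auto simp: u_def v_def sgn_if)
  ultimately interpret odd_direction u v by unfold_locales
  have "s = real_of_int u / real_of_int v"
  proof -
    have "s = (of_int u0 * of_int (gcd a b)) / (of_int v0 * real_of_int (gcd a b))"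
      using ab(3) uv0(1,2) by (metis of_int_mult)
    also have "\<dots> = of_int u0 / of_int v0" using b0 by simp
    also have "\<dots> = of_int u / of_int v" using b0 by (simp add: u_def v_def sgn_if)
    finally show ?thesis .
  qed
  then have "Slope s = dir" by (simp add: dir_def)
  then show ?thesis using strongly_parabolic_dir by simp
qed

theorem mainTheorem5:
  shows "{\<theta>. strongly_parabolic (1/2) (1/2) \<theta>} =
           {Slope (real_of_int u / real_of_int v) | u v. odd u \<and> odd v} \<and>
         {\<theta>. completely_periodic (1/2) (1/2) \<theta>} =
           {Slope (real_of_int u / real_of_int v) | u v. odd u \<and> odd v}"
proof -
  let ?O = "{Slope (real_of_int u / real_of_int v) | u v. odd u \<and> odd v}"
  have O: "Slope s \<in> ?O \<longleftrightarrow> odd_slope s" for s by (auto simp: odd_slope_def)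
  have "\<theta> \<in> ?O" if "completely_periodic (1/2) (1/2) \<theta>" for \<theta>
    using that not_completely_periodic_vertical not_completely_periodic_slope O by (cases \<theta>) auto
  moreover have "strongly_parabolic (1/2) (1/2) \<theta>" if "\<theta> \<in> ?O" for \<theta>
    using that odd_slope_strongly_parabolic by (auto simp: odd_slope_def)
  moreover have "completely_periodic (1/2) (1/2) \<theta>" if "strongly_parabolic (1/2) (1/2) \<theta>" for \<theta>
    using that by (simp add: strongly_parabolic_def)
  ultimately show ?thesis by blast
qed

end
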